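(* Let $\sigma_{LG},\sigma_{SG},\sigma_{SL},\delta,\xi,\zeta>0$, let $\Omega\subset\mathbb R^3$ be a bounded Lipschitz domain with flat boundary portion $\Gamma=\{(x,y,z)\in\partial\Omega: z=0\}$, and let $\phi$ be a sufficiently smooth function on $\overline\Omega\times[0,\infty)$ with $\partial_n\phi=0$ on $\partial\Omega\setminus\Gamma$ and with $\int_\Omega\partial_t\phi\,\mathrm d^3x=0$. Suppose that $\phi$ evolves according to the Onsager variational principle: at each time $t$, the rate $u=\partial_t\phi$, $u|_\Gamma=\partial_t\phi|_\Gamma$ minimizes, among smooth mean-zero rates $u$ on $\overline\Omega$ with boundary values $u|_\Gamma$ on $\Gamma$, the functional $$\mathcal R(u,u|_\Gamma)=\dot E(u,u|_\Gamma)+\mathcal D_{CH}(u,u|_\Gamma),$$ where the energy rate $\dot E$ and the dissipation functional $\mathcal D_{CH}$ are defined in the context. Then $\phi$ satisfies the Cahn--Hilliard system with contact line dynamics $$\left\{\begin{aligned} &\xi\,\partial_t\phi=\Delta\mu,\qquad \mu=-\sigma_{LG}\,\delta\,\Delta\phi+\frac{\sigma_{LG}}{\delta}F'(\phi), &&\text{in }\Omega,\\ &\zeta\delta\,\partial_t\phi=-\sigma_{LG}\,\delta\,\partial_n\phi-(\sigma_{SL}-\sigma_{SG})\,\frac{4}{3\sqrt2}\,f_w'(\phi), &&\text{on }\Gamma,\\ &\partial_n\phi=0\ \text{ on }\partial\Omega\setminus\Gamma,\qquad \partial_n\mu=0\ \text{ on }\partial\Omega . \end{aligned}\right.$$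
   Context: Potentials: $F(\phi)=\frac14(\phi^2-1)^2$ and $f_w(\phi)=\frac{\phi^3-3\phi}{4}+\frac12$. Free energy: $$E(\phi)=\frac{3\sqrt2}{4}\sigma_{LG}\int_\Omega\Bigl[\frac\delta2|\nabla\phi|^2+\frac1\delta F(\phi)\Bigr]\mathrm d^3x+(\sigma_{SL}-\sigma_{SG})\int_\Gamma f_w(\phi)\,\mathrm d^2x .$$ With $\partial_n\phi=0$ imposed on $\partial\Omega\setminus\Gamma$, its rate of change when $\phi$ has rate $u$ is $$\dot E(u,u|_\Gamma)=\frac{3\sqrt2}{4}\sigma_{LG}\int_\Omega\Bigl[\frac1\delta F'(\phi)-\delta\Delta\phi\Bigr]u\,\mathrm d^3x+\frac{3\sqrt2}{4}\sigma_{LG}\,\delta\int_\Gamma\partial_n\phi\;u|_\Gamma\,\mathrm d^2x+(\sigma_{SL}-\sigma_{SG})\int_\Gamma f_w'(\phi)\,u|_\Gamma\,\mathrm d^2x .$$ Here $\partial_n$ is the outward normal derivative on $\partial\Omega$ (on $\Gamma$ the outward normal points into the solid). Dissipation functional: $$\mathcal D_{CH}(u,u|_\Gamma)=\frac{3\sqrt2}{4}\,\frac{\xi}{2}\int_\Omega u\,(-\Delta_N)^{-1}u\,\mathrm d^3x+\frac{3\sqrt2}{4}\,\frac{\zeta\delta}{2}\int_\Gamma (u|_\Gamma)^2\,\mathrm d^2x,$$ where $(-\Delta_N)^{-1}$ is the inverse Neumann Laplacian on mean-zero functions: $\psi=(-\Delta_N)^{-1}u$ is the mean-zero (weak) solution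 of $-\Delta\psi=u$ in $\Omega$, $\partial_n\psi=0$ on $\partial\Omega$. *)

theory Defs
  imports "HOL-Analysis.Analysis" "HOL-Library.Extended_Nat"
begin

section \<open>Lipschitz domains, the flat boundary portion and the outward normal\<close>

text \<open>
  Near every boundary point the domain is the epigraph of a Lipschitz function over the plane
  orthogonal to some direction \<open>e\<close>; \<open>x - (x \<bullet> e) *\<^sub>R e\<close> is the projection of \<open>x\<close> to that plane.
\<close>

definition lipschitz_boundary :: "(real^3) set \<Rightarrow> bool" where
  "lipschitz_boundary \<Omega> \<longleftrightarrow>
     (\<forall>p\<in>frontier \<Omega>. \<exists>e h L r. norm e = 1 \<and> r > 0 \<and> L-lipschitz_on {y. y \<bullet> e = 0} h \<and>
        (\<forall>x\<in>ball p r. x \<in> \<Omega> \<longleftrightarrow> h (x - (x \<bullet> e) *\<^sub>R e) < x \<bullet> e))"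

definition bounded_lipschitz_domain :: "(real^3) set \<Rightarrow> bool" where
  "bounded_lipschitz_domain \<Omega> \<longleftrightarrow>
     open \<Omega> \<and> connected \<Omega> \<and> \<Omega> \<noteq> {} \<and> bounded \<Omega> \<and> lipschitz_boundary \<Omega>"

definition flat_part :: "(real^3) set \<Rightarrow> (real^3) set" where
  "flat_part \<Omega> = {p \<in> frontier \<Omega>. p $ 3 = 0}"

text \<open>
  \<open>n\<close> is the outward unit normal at \<open>p\<close> if, up to \<open>o(norm (x - p))\<close>, the domain is the half-space
  \<open>{x. (x - p) \<bullet> n < 0}\<close> near \<open>p\<close>.  For a Lipschitz domain this holds for some \<open>n\<close> iff the local
  graph is differentiable at \<open>p\<close>, hence at almost every boundary point; such an \<open>n\<close> is unique.
\<close>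

definition outward_normal :: "(real^3) set \<Rightarrow> real^3 \<Rightarrow> real^3 \<Rightarrow> bool" where
  "outward_normal \<Omega> p n \<longleftrightarrow> p \<in> frontier \<Omega> \<and> norm n = 1 \<and>
     (\<forall>\<epsilon>>0. \<exists>r>0. \<forall>x\<in>ball p r.
        ((x - p) \<bullet> n < - \<epsilon> * norm (x - p) \<longrightarrow> x \<in> \<Omega>) \<and>
        ((x - p) \<bullet> n > \<epsilon> * norm (x - p) \<longrightarrow> x \<notin> \<Omega>))"

definition unit_normal :: "(real^3) set \<Rightarrow> real^3 \<Rightarrow> real^3" where
  "unit_normal \<Omega> p = (THE n. outward_normal \<Omega> p n)"

section \<open>Differential operators and smoothness up to the boundary\<close>

definition partial :: "3 \<Rightarrow> (real^3 \<Rightarrow> real) \<Rightarrow> real^3 \<Rightarrow> real" where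
  "partial i f x = frechet_derivative f (at x) (axis i 1)"

definition grad :: "(real^3 \<Rightarrow> real) \<Rightarrow> real^3 \<Rightarrow> real^3" where
  "grad f x = (\<chi> i. partial i f x)"

definition laplacian :: "(real^3 \<Rightarrow> real) \<Rightarrow> real^3 \<Rightarrow> real" where
  "laplacian f x = (\<Sum>i\<in>UNIV. partial i (partial i f) x)"

text \<open>
  The gradient at a boundary point is the limit of the gradient from inside the domain, so that
  the normal derivative only depends on the values of \<open>f\<close> in \<open>\<Omega>\<close>.
\<close>

definition normal_derivative :: "(real^3) set \<Rightarrow> (real^3 \<Rightarrow> real) \<Rightarrow> real^3 \<Rightarrow> real" where
  "normal_derivative \<Omega> f p = Lim (at p within \<Omega>) (\<lambda>x. grad f x \<bullet> unit_normal \<Omega> p)"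

definition extends_to_closure :: "(real^3) set \<Rightarrow> (real^3 \<Rightarrow> real) \<Rightarrow> bool" where
  "extends_to_closure \<Omega> f \<longleftrightarrow> (\<exists>g. continuous_on (closure \<Omega>) g \<and> (\<forall>x\<in>\<Omega>. g x = f x))"

text \<open>
  All partial derivatives up to order \<open>k\<close> exist in \<open>\<Omega>\<close> and extend continuously to the closure.
\<close>

primrec Ck_up_to_boundary :: "nat \<Rightarrow> (real^3) set \<Rightarrow> (real^3 \<Rightarrow> real) \<Rightarrow> bool" where
  "Ck_up_to_boundary 0 \<Omega> f \<longleftrightarrow> extends_to_closure \<Omega> f"
| "Ck_up_to_boundary (Suc k) \<Omega> f \<longleftrightarrow>
     extends_to_closure \<Omega> f \<and> f differentiable_on \<Omega> \<and>
     (\<forall>i. Ck_up_to_boundary k \<Omega> (partial i f))"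

text \<open>
  The space \<open>C^m\<close> of the closure of \<open>\<Omega>\<close>, with \<open>m = \<infinity>\<close> allowed.  The boundary values of \<open>f\<close> itself
  are required to be the continuous ones, so \<open>f\<close> restricted to the boundary is its trace.
\<close>

definition C_closure :: "enat \<Rightarrow> (real^3) set \<Rightarrow> (real^3 \<Rightarrow> real) \<Rightarrow> bool" where
  "C_closure m \<Omega> f \<longleftrightarrow>
     continuous_on (closure \<Omega>) f \<and> (\<forall>k. enat k \<le> m \<longrightarrow> Ck_up_to_boundary k \<Omega> f)"

section \<open>The inverse Neumann Laplacian\<close>

definition square_integrable :: "(real^3) set \<Rightarrow> (real^3 \<Rightarrow> 'b::euclidean_space) \<Rightarrow> bool" where
  "square_integrable \<Omega> f \<longleftrightarrow>
     set_borel_measurable lebesgue \<Omega> f \<and> set_integrable lebesgue \<Omega> (\<lambda>x. (norm (f x))\<^sup>2)"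

text \<open>
  \<open>f\<close> belongs to the Sobolev space \<open>H^1\<close> of \<open>\<Omega>\<close> with weak gradient \<open>G\<close>.  For a bounded Lipschitz
  domain, \<open>H^1\<close> is the completion of the functions that are smooth up to the boundary.
\<close>

definition H1_gradient :: "(real^3) set \<Rightarrow> (real^3 \<Rightarrow> real) \<Rightarrow> (real^3 \<Rightarrow> real^3) \<Rightarrow> bool" where
  "H1_gradient \<Omega> f G \<longleftrightarrow>
     square_integrable \<Omega> f \<and> square_integrable \<Omega> G \<and>
     (\<exists>F :: nat \<Rightarrow> real^3 \<Rightarrow> real. (\<forall>k. C_closure \<infinity> \<Omega> (F k)) \<and>
        (\<lambda>k. LINT x:\<Omega>|lebesgue. (F k x - f x)\<^sup>2) \<longlonglongrightarrow> 0 \<and>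
        (\<lambda>k. LINT x:\<Omega>|lebesgue. (norm (grad (F k) x - G x))\<^sup>2) \<longlonglongrightarrow> 0)"

definition weak_neumann_solution :: "(real^3) set \<Rightarrow> (real^3 \<Rightarrow> real) \<Rightarrow> (real^3 \<Rightarrow> real) \<Rightarrow> bool" where
  "weak_neumann_solution \<Omega> u \<psi> \<longleftrightarrow>
     (LINT x:\<Omega>|lebesgue. \<psi> x) = 0 \<and>
     (\<exists>G. H1_gradient \<Omega> \<psi> G \<and>
        (\<forall>v H. H1_gradient \<Omega> v H \<longrightarrow>
           (LINT x:\<Omega>|lebesgue. G x \<bullet> H x) = (LINT x:\<Omega>|lebesgue. u x * v x)))"

text \<open>The solution is unique up to null sets, on which the functionals below do not depend.\<close>

definition inv_neumann_laplacian :: "(real^3) set \<Rightarrow> (real^3 \<Rightarrow> real) \<Rightarrow> real^3 \<Rightarrow> real" where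
  "inv_neumann_laplacian \<Omega> u = (SOME \<psi>. weak_neumann_solution \<Omega> u \<psi>)"

section \<open>Energy rate, dissipation and the Rayleighian\<close>

definition F :: "real \<Rightarrow> real" where
  "F s = (1/4) * (s\<^sup>2 - 1)\<^sup>2"

definition f_w :: "real \<Rightarrow> real" where
  "f_w s = (s ^ 3 - 3 * s) / 4 + 1/2"

text \<open>
  The flat part lies in the plane \<open>z = 0\<close>, so its surface measure is the Lebesgue measure of
  that plane.
\<close>

definition on_plane :: "real^2 \<Rightarrow> real^3" where
  "on_plane q = vector [q $ 1, q $ 2, 0]"

definition flat_part_integral :: "(real^3) set \<Rightarrow> (real^3 \<Rightarrow> real) \<Rightarrow> real" where
  "flat_part_integral \<Omega> g = (LINT q:{q. on_plane q \<in> flat_part \<Omega>}|lebesgue. g (on_plane q))"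

text \<open>
  The rate of change of the free energy for the phase field \<open>f\<close> with rate \<open>u\<close>, when the normal
  derivative of \<open>f\<close> vanishes off the flat part.
\<close>

definition energy_rate ::
  "(real^3) set \<Rightarrow> real \<Rightarrow> real \<Rightarrow> real \<Rightarrow> real \<Rightarrow> (real^3 \<Rightarrow> real) \<Rightarrow> (real^3 \<Rightarrow> real) \<Rightarrow> real" where
  "energy_rate \<Omega> \<sigma>LG \<sigma>SG \<sigma>SL \<delta> f u =
     3 * sqrt 2 / 4 * \<sigma>LG * (LINT x:\<Omega>|lebesgue. (1/\<delta> * deriv F (f x) - \<delta> * laplacian f x) * u x)
     + 3 * sqrt 2 / 4 * \<sigma>LG * \<delta> * flat_part_integral \<Omega> (\<lambda>p. normal_derivative \<Omega> f p * u p)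
     + (\<sigma>SL - \<sigma>SG) * flat_part_integral \<Omega> (\<lambda>p. deriv f_w (f p) * u p)"

definition dissipation ::
  "(real^3) set \<Rightarrow> real \<Rightarrow> real \<Rightarrow> real \<Rightarrow> (real^3 \<Rightarrow> real) \<Rightarrow> real" where
  "dissipation \<Omega> \<delta> \<xi> \<zeta> u =
     3 * sqrt 2 / 4 * (\<xi> / 2) * (LINT x:\<Omega>|lebesgue. u x * inv_neumann_laplacian \<Omega> u x)
     + 3 * sqrt 2 / 4 * (\<zeta> * \<delta> / 2) * flat_part_integral \<Omega> (\<lambda>p. (u p)\<^sup>2)"

definition rayleighian ::
  "(real^3) set \<Rightarrow> real \<Rightarrow> real \<Rightarrow> real \<Rightarrow> real \<Rightarrow> real \<Rightarrow> real \<Rightarrow>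
   (real^3 \<Rightarrow> real) \<Rightarrow> (real^3 \<Rightarrow> real) \<Rightarrow> real" where
  "rayleighian \<Omega> \<sigma>LG \<sigma>SG \<sigma>SL \<delta> \<xi> \<zeta> f u =
     energy_rate \<Omega> \<sigma>LG \<sigma>SG \<sigma>SL \<delta> f u + dissipation \<Omega> \<delta> \<xi> \<zeta> u"

definition mean_zero :: "(real^3) set \<Rightarrow> (real^3 \<Rightarrow> real) \<Rightarrow> bool" where
  "mean_zero \<Omega> u \<longleftrightarrow> (LINT x:\<Omega>|lebesgue. u x) = 0"

section \<open>Evolutions\<close>

definition time_derivative :: "(real \<Rightarrow> real^3 \<Rightarrow> real) \<Rightarrow> real \<Rightarrow> real^3 \<Rightarrow> real" where
  "time_derivative \<phi> t x = vector_derivative (\<lambda>s. \<phi> s x) (at t within {0..})"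

text \<open>
  \<open>m\<close> is the regularity class of the rates.  Order four in space is what makes sense of the
  normal derivative of the chemical potential at the boundary.
\<close>

definition sufficiently_smooth :: "enat \<Rightarrow> (real^3) set \<Rightarrow> (real \<Rightarrow> real^3 \<Rightarrow> real) \<Rightarrow> bool" where
  "sufficiently_smooth m \<Omega> \<phi> \<longleftrightarrow>
     (\<forall>t\<ge>0. C_closure 4 \<Omega> (\<phi> t) \<and>
        (\<forall>x\<in>closure \<Omega>. (\<lambda>s. \<phi> s x) differentiable (at t within {0..})) \<and>
        C_closure m \<Omega> (time_derivative \<phi> t))"

definition chemical_potential :: "real \<Rightarrow> real \<Rightarrow> (real^3 \<Rightarrow> real) \<Rightarrow> real^3 \<Rightarrow> real" where
  "chemical_potential \<sigma>LG \<delta> f x = - \<sigma>LG * \<delta> * laplacian f x + \<sigma>LG / \<delta> * deriv F (f x)"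

text \<open>
  A boundary condition involving the normal derivative is imposed wherever the boundary has a
  normal.
\<close>

definition zero_normal_derivative_on :: "(real^3) set \<Rightarrow> (real^3) set \<Rightarrow> (real^3 \<Rightarrow> real) \<Rightarrow> bool" where
  "zero_normal_derivative_on \<Omega> S f \<longleftrightarrow>
     (\<forall>p\<in>S. (\<exists>n. outward_normal \<Omega> p n) \<longrightarrow> normal_derivative \<Omega> f p = 0)"

text \<open>
  A condition holds on the flat part if it holds at every point of its interior relative to the
  boundary of \<open>\<Omega>\<close> (where the boundary is a piece of plane, so the normal exists) and at almost
  every remaining point with respect to surface measure.
\<close>

definition holds_on_flat_part :: "(real^3) set \<Rightarrow> (real^3 \<Rightarrow> bool) \<Rightarrow> bool" where
  "holds_on_flat_part \<Omega> P \<longleftrightarrow>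
     (\<forall>p \<in> top_of_set (frontier \<Omega>) interior_of flat_part \<Omega>. P p) \<and>
     (AE q in lebesgue. on_plane q \<in> flat_part \<Omega> \<longrightarrow> P (on_plane q))"

end

theory Submission
  imports Defs
begin

text \<open>
  The dissipation is a quadratic form in the rate, so the first variation of the Rayleighian at its
  minimizer \<open>u = \<partial>\<^sub>t \<phi>\<close> in a mean-zero direction \<open>v\<close> is
  \<open>\<integral>\<^sub>\<Omega> (\<mu> + \<xi> \<psi>) v + \<integral>\<^sub>\<Gamma> B v = 0\<close> up to a factor, where \<open>\<psi>\<close> is the weak Neumann solution for \<open>u\<close> and
  \<open>B\<close> is the residual of the condition on \<open>\<Gamma>\<close>.  Polynomials are smooth up to the boundary and dense in the
  continuous functions, so they suffice as directions: \<open>B\<close> vanishes almost everywhere on \<open>\<Gamma>\<close>,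
  and \<open>\<mu> + \<xi> \<psi>\<close> is constant.  Hence \<open>\<mu>\<close> is a weak solution of \<open>\<Delta> \<mu> = \<xi> u\<close> with the natural
  boundary condition, which gives the equation inside by radial bumps, and \<open>\<partial>\<^sub>n \<mu> = 0\<close> at every
  boundary point with a normal by blowing up the domain to a half-space there.

  The existence of \<open>\<psi>\<close> rests on the Poincare inequality, which is propagated from a ball to the whole
  domain by translations; at the boundary one translates along the axis of the Lipschitz graph.
  The normal on \<open>\<Gamma>\<close> is known at almost every point, because at a density point of \<open>\<Gamma>\<close> the
  graph deviates from the plane by \<open>o(norm (x - p))\<close>.
\<close>

text \<open>Rates range over \<open>C_closure m\<close> for an arbitrary \<open>m\<close>, possibly
  \<infinity>, so a variation must be smooth to every order up to the boundary of a domain that is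
  merely Lipschitz. Polynomials are; the bumps are only C^1 and enter as limits of polynomials,
  together with their gradients. These limits are uniform on a ball around \<Omega>, so a bump may
  be centred on the boundary, as the blow-up requires. The constant that
  \<open>\<mu> + \<xi> \<psi>\<close> equals is the Lagrange multiplier of the mean-zero constraint.
  Two definitions are choices and tell nothing by themselves. \<open>inv_neumann_laplacian\<close>
  is a \<open>SOME\<close>, so the dissipation can be expanded only after weak solutions are known
  to exist; \<psi> is then a mere H^1 function, and identifying its weak gradient with the classical
  gradient of the C^1 function that it equals almost everywhere is the closability of the gradient.
  \<open>unit_normal\<close> is a \<open>THE\<close>, so measurability of the normal derivative on
  \<Gamma> has to be proved before the boundary integral can be split: a function that is not
  integrable has integral 0 by convention.\<close>

lemma partial_eq: "(f has_derivative f') (at x) \<Longrightarrow> partial i f x = f' (axis i 1)"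
  by (simp add: partial_def frechet_derivative_at[symmetric])

text \<open>Holds at points without a derivative as well: \<open>frechet_derivative\<close> is a
  choice from the set of all derivatives, and functions that agree near \<open>x\<close> have the
  same set there.\<close>

lemma partial_cong:
  assumes "open S" "x \<in> S" "\<And>y. y \<in> S \<Longrightarrow> f y = g y"
  shows "partial i f x = partial i g x"
proof -
  have "(f has_derivative D) (at x) \<longleftrightarrow> (g has_derivative D) (at x)" for D
    using has_derivative_transform_within_open[OF _ assms(1,2), of f D UNIV g]
      has_derivative_transform_within_open[OF _ assms(1,2), of g D UNIV f] assms(3) by auto
  then show ?thesis by (simp add: partial_def frechet_derivative_def)
qed

lemma grad_nth [simp]: "grad f x $ i = partial i f x"
  by (simp add: grad_def)

lemma has_derivative_grad:
  assumes "f differentiable at x"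
  shows "(f has_derivative (\<lambda>h. grad f x \<bullet> h)) (at x)"
proof -
  let ?D = "frechet_derivative f (at x)"
  have D: "(f has_derivative ?D) (at x)" using assms by (simp add: frechet_derivative_works)
  then have lin: "linear ?D" by (simp add: has_derivative_linear)
  have "?D h = grad f x \<bullet> h" for h
  proof -
    have "?D h = ?D (\<Sum>i\<in>UNIV. h $ i *\<^sub>R axis i 1)" by (simp add: basis_expansion flip: scalar_mult_eq_scaleR)
    also have "\<dots> = (\<Sum>i\<in>UNIV. h $ i * ?D (axis i 1))"
      by (simp add: linear_sum[OF lin] linear_scale[OF lin])
    also have "\<dots> = grad f x \<bullet> h"
      by (simp add: inner_vec_def partial_def mult.commute)
    finally show ?thesis .
  qed
  then have "?D = (\<lambda>h. grad f x \<bullet> h)" by (intro ext)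
  with D show ?thesis by simp
qed

lemma grad_eq:
  assumes "(f has_derivative (\<lambda>h. v \<bullet> h)) (at x)"
  shows "grad f x = v"
  by (simp add: vec_eq_iff partial_eq[OF assms] inner_axis)

lemma grad_add:
  "f differentiable at x \<Longrightarrow> g differentiable at x \<Longrightarrow> grad (\<lambda>y. f y + g y) x = grad f x + grad g x"
  by (rule grad_eq, rule has_derivative_eq_rhs, rule has_derivative_add)
    (auto intro: has_derivative_grad simp: inner_add_left)

lemma grad_cmul:
  "f differentiable at x \<Longrightarrow> grad (\<lambda>y. c * f y) x = c *\<^sub>R grad f x"
  by (rule grad_eq, rule has_derivative_eq_rhs, rule has_derivative_mult_right)
    (auto intro: has_derivative_grad)

lemma grad_const [simp]: "grad (\<lambda>y. c) x = 0"
  by (rule grad_eq) simp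

lemma grad_mult:
  "f differentiable at x \<Longrightarrow> g differentiable at x \<Longrightarrow>
   grad (\<lambda>y. f y * g y) x = f x *\<^sub>R grad g x + g x *\<^sub>R grad f x"
  by (rule grad_eq, rule has_derivative_eq_rhs, rule has_derivative_mult)
    (auto intro: has_derivative_grad simp: inner_add_left)

lemma partial_add:
  "f differentiable at x \<Longrightarrow> g differentiable at x \<Longrightarrow>
   partial i (\<lambda>y. f y + g y) x = partial i f x + partial i g x"
  using grad_add[of f x g] by (metis grad_nth vector_add_component)

lemma partial_mult:
  "f differentiable at x \<Longrightarrow> g differentiable at x \<Longrightarrow>
   partial i (\<lambda>y. f y * g y) x = f x * partial i g x + partial i f x * g x"
  using arg_cong[OF grad_mult[of f x g], of "\<lambda>v. v $ i"] by (simp add: mult.commute)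

section \<open>Functions smooth up to the boundary\<close>

lemma extends_to_closure_cong:
  "(\<And>x. x \<in> \<Omega> \<Longrightarrow> f x = g x) \<Longrightarrow> extends_to_closure \<Omega> f = extends_to_closure \<Omega> g"
  by (simp add: extends_to_closure_def)

lemma Ck_extends: "Ck_up_to_boundary k \<Omega> f \<Longrightarrow> extends_to_closure \<Omega> f"
  by (cases k) auto

lemma Ck_cong:
  assumes "open \<Omega>" "\<And>x. x \<in> \<Omega> \<Longrightarrow> f x = g x"
  shows "Ck_up_to_boundary k \<Omega> f \<longleftrightarrow> Ck_up_to_boundary k \<Omega> g"
  using assms(2)
proof (induction k arbitrary: f g)
  case 0
  then show ?case by (simp cong: extends_to_closure_cong)
next
  case (Suc k)
  have "f differentiable_on \<Omega> \<longleftrightarrow> g differentiable_on \<Omega>"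
    using Suc.prems by (metis differentiable_transform_within differentiable_on_def zero_less_one)
  moreover have "Ck_up_to_boundary k \<Omega> (partial i f) = Ck_up_to_boundary k \<Omega> (partial i g)" for i
    using Suc.prems by (intro Suc.IH partial_cong[OF assms(1)]) auto
  ultimately show ?case using Suc.prems by (simp cong: extends_to_closure_cong)
qed

lemma Ck_Suc_imp: "Ck_up_to_boundary (Suc k) \<Omega> f \<Longrightarrow> Ck_up_to_boundary k \<Omega> f"
proof (induction k arbitrary: f)
  case (Suc k)
  then show ?case by (metis Ck_up_to_boundary.simps(2))
qed auto

lemma extends_to_closure_add:
  "extends_to_closure \<Omega> f \<Longrightarrow> extends_to_closure \<Omega> g \<Longrightarrow> extends_to_closure \<Omega> (\<lambda>x. f x + g x)"
  unfolding extends_to_closure_def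
  apply clarify
  subgoal for f' g' by (rule exI[of _ "\<lambda>x. f' x + g' x"]) (auto intro: continuous_intros)
  done

lemma extends_to_closure_mult:
  "extends_to_closure \<Omega> f \<Longrightarrow> extends_to_closure \<Omega> g \<Longrightarrow> extends_to_closure \<Omega> (\<lambda>x. f x * g x)"
  unfolding extends_to_closure_def
  apply clarify
  subgoal for f' g' by (rule exI[of _ "\<lambda>x. f' x * g' x"]) (auto intro: continuous_intros)
  done

lemma Ck_const: "Ck_up_to_boundary k \<Omega> (\<lambda>x. c)"
proof (induction k arbitrary: c)
  case (Suc k)
  have "partial i (\<lambda>x. c) = (\<lambda>x. 0)" for i
    by (rule ext) (simp add: partial_eq[OF has_derivative_const])
  moreover have "extends_to_closure \<Omega> (\<lambda>x. c)"
    by (metis continuous_on_const extends_to_closure_def)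
  ultimately show ?case using Suc by (simp add: differentiable_on_const)
qed (metis Ck_up_to_boundary.simps(1) continuous_on_const extends_to_closure_def)

lemma Ck_add:
  assumes "open \<Omega>"
  shows "Ck_up_to_boundary k \<Omega> f \<Longrightarrow> Ck_up_to_boundary k \<Omega> g \<Longrightarrow> Ck_up_to_boundary k \<Omega> (\<lambda>x. f x + g x)"
proof (induction k arbitrary: f g)
  case (Suc k)
  have "Ck_up_to_boundary k \<Omega> (partial i (\<lambda>x. f x + g x))" for i
    using Suc assms
    by (subst Ck_cong[OF assms, where g = "\<lambda>x. partial i f x + partial i g x"])
      (auto intro!: Suc.IH partial_add simp: differentiable_on_eq_differentiable_at)
  with Suc show ?case by (auto intro: extends_to_closure_add differentiable_on_add)
qed (auto intro: extends_to_closure_add)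

lemma Ck_mult:
  assumes "open \<Omega>"
  shows "Ck_up_to_boundary k \<Omega> f \<Longrightarrow> Ck_up_to_boundary k \<Omega> g \<Longrightarrow> Ck_up_to_boundary k \<Omega> (\<lambda>x. f x * g x)"
proof (induction k arbitrary: f g)
  case (Suc k)
  \<comment> \<open>The product rule pairs \<open>f\<close> and \<open>g\<close> themselves with
    derivatives, so the induction hypothesis is also applied to the factors, at the lower
    order.\<close>
  have *: "Ck_up_to_boundary k \<Omega> f" "Ck_up_to_boundary k \<Omega> g"
    using Suc.prems by (metis Ck_Suc_imp)+
  have "Ck_up_to_boundary k \<Omega> (partial i (\<lambda>x. f x * g x))" for i
    using Suc assms *
    by (subst Ck_cong[OF assms, where g = "\<lambda>x. f x * partial i g x + partial i f x * g x"])
      (auto intro!: Suc.IH Ck_add partial_mult simp: differentiable_on_eq_differentiable_at)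
  with Suc show ?case by (auto intro: extends_to_closure_mult differentiable_on_mult)
qed (auto intro: extends_to_closure_mult)

lemma Ck_cmul: "open \<Omega> \<Longrightarrow> Ck_up_to_boundary k \<Omega> f \<Longrightarrow> Ck_up_to_boundary k \<Omega> (\<lambda>x. c * f x)"
  by (intro Ck_mult Ck_const)

lemma Ck_bounded_linear:
  assumes "bounded_linear f"
  shows "Ck_up_to_boundary k \<Omega> f"
proof -
  have e: "extends_to_closure \<Omega> f"
    using assms by (auto simp: extends_to_closure_def intro!: exI[of _ f] linear_continuous_on)
  have "partial i f = (\<lambda>x. f (axis i 1))" for i
    by (rule ext) (simp add: partial_eq[OF bounded_linear_imp_has_derivative[OF assms]])
  with e show ?thesis
    by (cases k) (auto simp: Ck_const intro: bounded_linear_imp_differentiable_on assms)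
qed

lemma Ck_polynomial:
  assumes "open \<Omega>" "real_polynomial_function p"
  shows "Ck_up_to_boundary k \<Omega> p"
  using assms(2) by induction (auto intro: Ck_bounded_linear Ck_const Ck_add[OF assms(1)] Ck_mult[OF assms(1)])

text \<open>Valid for every order \<open>m\<close>, infinite included: this makes polynomials
  admissible both as variations of the rate and as test functions of the weak Neumann
  problem.\<close>

lemma C_closure_polynomial:
  assumes "open \<Omega>" "real_polynomial_function p"
  shows "C_closure m \<Omega> p"
  using assms by (auto simp: C_closure_def intro!: Ck_polynomial continuous_on_polymonial_function
      simp: real_polynomial_function_eq)

lemma C_closure_add:
  "open \<Omega> \<Longrightarrow> C_closure m \<Omega> f \<Longrightarrow> C_closure m \<Omega> g \<Longrightarrow> C_closure m \<Omega> (\<lambda>x. f x + g x)"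
  by (auto simp: C_closure_def intro: Ck_add continuous_intros)

lemma C_closure_cmul:
  "open \<Omega> \<Longrightarrow> C_closure m \<Omega> f \<Longrightarrow> C_closure m \<Omega> (\<lambda>x. c * f x)"
  by (auto simp: C_closure_def intro: Ck_cmul continuous_intros)

lemma C_closure_const: "C_closure m \<Omega> (\<lambda>x. c)"
  by (auto simp: C_closure_def intro: Ck_const)

text \<open>The last item provides the field that replaces the gradient at boundary points, where
  \<open>grad\<close> would depend on values of \<open>f\<close> outside \<Omega>.\<close>

lemma Ck_1_D:
  assumes "open \<Omega>" "Ck_up_to_boundary (Suc 0) \<Omega> f"
  shows "\<And>x. x \<in> \<Omega> \<Longrightarrow> f differentiable at x"
    and "\<And>x. x \<in> \<Omega> \<Longrightarrow> (f has_derivative (\<lambda>h. grad f x \<bullet> h)) (at x)"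
    and "continuous_on \<Omega> f" "continuous_on \<Omega> (grad f)"
    and "\<exists>X. continuous_on (closure \<Omega>) X \<and> (\<forall>x\<in>\<Omega>. X x = grad f x)"
proof -
  show 1: "f differentiable at x" if "x \<in> \<Omega>" for x
    using assms that by (simp add: differentiable_on_eq_differentiable_at)
  then show "(f has_derivative (\<lambda>h. grad f x \<bullet> h)) (at x)" if "x \<in> \<Omega>" for x
    using that has_derivative_grad by blast
  show "continuous_on \<Omega> f"
    using assms by (simp add: differentiable_imp_continuous_on)
  have "\<exists>g. continuous_on (closure \<Omega>) g \<and> (\<forall>x\<in>\<Omega>. g x = partial i f x)" for i
    using assms(2) by (simp add: extends_to_closure_def)
  then obtain g where g: "\<And>i. continuous_on (closure \<Omega>) (g i)" "\<And>i x. x \<in> \<Omega> \<Longrightarrow> g i x = partial i f x"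
    by metis
  have *: "continuous_on (closure \<Omega>) (\<lambda>x. \<chi> i. g i x)" by (intro continuous_intros g)
  moreover have **: "\<forall>x\<in>\<Omega>. (\<chi> i. g i x) = grad f x" using g by (simp add: grad_def)
  ultimately show "\<exists>X. continuous_on (closure \<Omega>) X \<and> (\<forall>x\<in>\<Omega>. X x = grad f x)" by blast
  show "continuous_on \<Omega> (grad f)"
    using continuous_on_subset[OF * closure_subset] ** by (simp cong: continuous_on_cong)
qed

lemma extends_to_closure_bounded:
  fixes X :: "real^3 \<Rightarrow> 'b::real_normed_vector"
  assumes "bounded \<Omega>" "continuous_on (closure \<Omega>) X"
  shows "\<exists>B. \<forall>x\<in>closure \<Omega>. norm (X x) \<le> B"
proof -
  have "compact (closure \<Omega>)" using assms by simp
  then have "bounded (X ` closure \<Omega>)" using assms compact_continuous_image compact_imp_bounded by blast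
  then show ?thesis by (auto simp: bounded_iff)
qed

lemma C_closure_Suc0: "C_closure \<infinity> \<Omega> f \<Longrightarrow> Ck_up_to_boundary (Suc 0) \<Omega> f"
  by (auto simp: C_closure_def)

section \<open>Square integrable functions\<close>

text \<open>Functions rather than classes, and an arbitrary measure: the same facts serve the volume
  and the flat portion, which is measured as a set in the plane.\<close>

definition L2 :: "'a measure \<Rightarrow> ('a \<Rightarrow> 'b::euclidean_space) \<Rightarrow> bool" where
  "L2 M f \<longleftrightarrow> f \<in> borel_measurable M \<and> integrable M (\<lambda>x. (norm (f x))\<^sup>2)"

lemma norm_add_sq_le: "(norm (a + b))\<^sup>2 \<le> 2 * (norm a)\<^sup>2 + 2 * (norm (b::'b::real_inner))\<^sup>2"
proof -
  have "0 \<le> (norm (a - b))\<^sup>2" by simp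
  then show ?thesis unfolding power2_norm_eq_inner by (simp add: algebra_simps inner_commute)
qed

lemma norm_inner_le_squares: "\<bar>a \<bullet> b\<bar> \<le> (norm a)\<^sup>2 + (norm (b::'b::real_inner))\<^sup>2"
proof -
  have "\<bar>a \<bullet> b\<bar> \<le> norm a * norm b" by (rule Cauchy_Schwarz_ineq2)
  also have "\<dots> \<le> (norm a)\<^sup>2 + (norm b)\<^sup>2"
    using sum_squares_bound[of "norm a" "norm b"] zero_le_power2[of "norm a"] zero_le_power2[of "norm b"]
      mult_nonneg_nonneg[of "norm a" "norm b"] by linarith
  finally show ?thesis .
qed

lemma L2_integrable: "L2 M f \<Longrightarrow> integrable M (\<lambda>x. (norm (f x))\<^sup>2)"
  by (simp add: L2_def)

lemma L2_add:
  assumes "L2 M f" "L2 M g"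
  shows "L2 M (\<lambda>x. f x + g x)"
  unfolding L2_def
proof
  have [measurable]: "f \<in> borel_measurable M" "g \<in> borel_measurable M" using assms by (auto simp: L2_def)
  show "(\<lambda>x. f x + g x) \<in> borel_measurable M" by measurable
  show "integrable M (\<lambda>x. (norm (f x + g x))\<^sup>2)"
  proof (rule Bochner_Integration.integrable_bound)
    show "integrable M (\<lambda>x. 2 * (norm (f x))\<^sup>2 + 2 * (norm (g x))\<^sup>2)"
      using assms by (auto simp: L2_def)
    show "AE x in M. norm ((norm (f x + g x))\<^sup>2) \<le> norm (2 * (norm (f x))\<^sup>2 + 2 * (norm (g x))\<^sup>2)"
      using norm_add_sq_le by auto
  qed measurable
qed

lemma L2_scale: "L2 M f \<Longrightarrow> L2 M (\<lambda>x. c *\<^sub>R f x)"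
  by (auto simp: L2_def power_mult_distrib)

lemma L2_cmul: "L2 M f \<Longrightarrow> L2 M (\<lambda>x. c * f x :: real)"
  using L2_scale[of M f c] by simp

lemma L2_minus: "L2 M f \<Longrightarrow> L2 M (\<lambda>x. - f x)"
  by (auto simp: L2_def)

lemma L2_diff: "L2 M f \<Longrightarrow> L2 M g \<Longrightarrow> L2 M (\<lambda>x. f x - g x)"
  using L2_add[of M f "\<lambda>x. - g x"] by (simp add: L2_minus)

lemma L2_inner:
  assumes "L2 M f" "L2 M g"
  shows "integrable M (\<lambda>x. f x \<bullet> g x)"
proof (rule Bochner_Integration.integrable_bound)
  have [measurable]: "f \<in> borel_measurable M" "g \<in> borel_measurable M" using assms by (auto simp: L2_def)
  show "(\<lambda>x. f x \<bullet> g x) \<in> borel_measurable M" by measurable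
  show "integrable M (\<lambda>x. (norm (f x))\<^sup>2 + (norm (g x))\<^sup>2)"
    using assms by (auto simp: L2_def)
  show "AE x in M. norm (f x \<bullet> g x) \<le> norm ((norm (f x))\<^sup>2 + (norm (g x))\<^sup>2)"
    using norm_inner_le_squares by auto
qed

lemma L2_mult: "L2 M f \<Longrightarrow> L2 M g \<Longrightarrow> integrable M (\<lambda>x. f x * g x :: real)"
  using L2_inner[of M f g] by simp

lemma L2_bounded:
  assumes "finite_measure M" "f \<in> borel_measurable M" "AE x in M. norm (f x) \<le> B"
  shows "L2 M f"
proof -
  interpret finite_measure M by fact
  note [measurable] = assms(2)
  have "integrable M (\<lambda>x. (norm (f x))\<^sup>2)"
    by (rule integrable_const_bound[where B = "B\<^sup>2"])
      (use assms(3) in \<open>auto elim!: eventually_mono intro: power_mono\<close>)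
  with assms(2) show ?thesis by (simp add: L2_def)
qed

lemma L2_const: "finite_measure M \<Longrightarrow> L2 M (\<lambda>x. c)"
  by (rule L2_bounded[where B = "norm c"]) auto

lemma L2_imp_integrable: "finite_measure M \<Longrightarrow> L2 M f \<Longrightarrow> integrable M (f :: _ \<Rightarrow> real)"
  using L2_mult[OF _ L2_const[of M 1], of f] by simp

lemma norm_add_scale_sq:
  "(norm (a + c *\<^sub>R b))\<^sup>2 = (norm a)\<^sup>2 + 2 * c * (a \<bullet> b) + c\<^sup>2 * (norm (b::'b::real_inner))\<^sup>2"
  unfolding power2_norm_eq_inner by (simp add: algebra_simps inner_commute power2_eq_square)

lemma L2_expand:
  assumes "L2 M f" "L2 M g"
  shows "(LINT x|M. (norm (f x + c *\<^sub>R g x))\<^sup>2) =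
    (LINT x|M. (norm (f x))\<^sup>2) + 2 * c * (LINT x|M. f x \<bullet> g x) + c\<^sup>2 * (LINT x|M. (norm (g x))\<^sup>2)"
  unfolding norm_add_scale_sq using assms L2_inner[OF assms]
  by (simp add: L2_integrable)

text \<open>The square norm of \<open>f + t g\<close> is a nonnegative quadratic polynomial in
  \<open>t\<close>, so its discriminant is at most zero.\<close>

lemma L2_Cauchy_Schwarz:
  assumes "L2 M f" "L2 M g"
  shows "(LINT x|M. f x \<bullet> g x)\<^sup>2 \<le> (LINT x|M. (norm (f x))\<^sup>2) * (LINT x|M. (norm (g x))\<^sup>2)"
proof -
  define a b c where "a = (LINT x|M. (norm (f x))\<^sup>2)" "b = (LINT x|M. (norm (g x))\<^sup>2)"
    "c = (LINT x|M. f x \<bullet> g x)"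
  have q: "0 \<le> a + 2 * t * c + t\<^sup>2 * b" for t
  proof -
    have "0 \<le> (LINT x|M. (norm (f x + t *\<^sub>R g x))\<^sup>2)" by simp
    then show ?thesis unfolding L2_expand[OF assms] a_b_c_def .
  qed
  have b0: "0 \<le> b" "0 \<le> a" unfolding a_b_c_def by auto
  have "c\<^sup>2 \<le> a * b"
  proof (cases "b = 0")
    case True
    have "c = 0"
    proof (rule ccontr)
      assume "c \<noteq> 0"
      \<comment> \<open>With \<open>b = 0\<close> the polynomial is affine, and this
        \<open>t\<close> gives it the value -1.\<close>
      then show False using q[of "- (a + 1) / (2 * c)"] True by (simp add: field_simps)
    qed
    then show ?thesis using True by simp
  next
    case False
    have "0 \<le> a - c\<^sup>2 / b"
      using q[of "- c / b"] False by (simp add: field_simps power2_eq_square)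
    then show ?thesis using False b0 by (simp add: field_simps)
  qed
  then show ?thesis by (simp add: a_b_c_def)
qed

lemma L2_tendsto_inner:
  assumes f: "\<And>k. L2 M (f k)" "L2 M g" and h: "L2 M h"
    and lim: "(\<lambda>k. LINT x|M. (norm (f k x - g x))\<^sup>2) \<longlonglongrightarrow> 0"
  shows "(\<lambda>k. LINT x|M. f k x \<bullet> h x) \<longlonglongrightarrow> (LINT x|M. g x \<bullet> h x)"
proof -
  have "(LINT x|M. f k x \<bullet> h x) - (LINT x|M. g x \<bullet> h x) = (LINT x|M. (f k x - g x) \<bullet> h x)" for k
    by (simp add: inner_diff_left L2_inner f h)
  then have le: "\<bar>(LINT x|M. f k x \<bullet> h x) - (LINT x|M. g x \<bullet> h x)\<bar>
      \<le> sqrt ((LINT x|M. (norm (f k x - g x))\<^sup>2) * (LINT x|M. (norm (h x))\<^sup>2))" for k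
    using L2_Cauchy_Schwarz[OF L2_diff[OF f(1) f(2)] h, of k] by (simp add: real_le_rsqrt)
  have "(\<lambda>k. sqrt ((LINT x|M. (norm (f k x - g x))\<^sup>2) * (LINT x|M. (norm (h x))\<^sup>2))) \<longlonglongrightarrow>
      sqrt (0 * (LINT x|M. (norm (h x))\<^sup>2))"
    by (intro tendsto_intros lim)
  then have "(\<lambda>k. (LINT x|M. f k x \<bullet> h x) - (LINT x|M. g x \<bullet> h x)) \<longlonglongrightarrow> 0"
    by (rule_tac Lim_null_comparison[where g = "\<lambda>k. sqrt ((LINT x|M. (norm (f k x - g x))\<^sup>2) * (LINT x|M. (norm (h x))\<^sup>2))"])
      (use le in auto)
  then show ?thesis by (rule LIM_zero_cancel)
qed

lemma le_suminf_ennreal: "a k \<le> (\<Sum>n. a n :: ennreal)"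
  using sum_le_suminf[of a "{k}"] by (simp add: summableI)

text \<open>Along a fast subsequence \<open>\<Sum>k. 2 ^ k * (norm (f (r (Suc k)) - f (r k)))\<^sup>2\<close> is integrable, hence
  finite almost everywhere, which gives pointwise convergence; Fatou's lemma does the rest.\<close>

lemma L2_complete:
  fixes f :: "nat \<Rightarrow> 'a \<Rightarrow> 'b::euclidean_space"
  assumes f: "\<And>k. L2 M (f k)"
    and cauchy: "\<And>e. e > 0 \<Longrightarrow> \<exists>N. \<forall>m\<ge>N. \<forall>n\<ge>N. (LINT x|M. (norm (f m x - f n x))\<^sup>2) < e"
  obtains g where "L2 M g" "(\<lambda>k. LINT x|M. (norm (f k x - g x))\<^sup>2) \<longlonglongrightarrow> 0"
proof -
  have [measurable]: "\<And>k. f k \<in> borel_measurable M" using f by (simp add: L2_def)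
  define D where "D m n = (LINT x|M. (norm (f m x - f n x))\<^sup>2)" for m n
  have int: "integrable M (\<lambda>x. (norm (f m x - f n x))\<^sup>2)" for m n
    using L2_diff[OF f f] by (simp add: L2_def)
  have D0: "D m n \<ge> 0" for m n by (simp add: D_def)
  have nnD: "(\<integral>\<^sup>+x. ennreal ((norm (f m x - f n x))\<^sup>2) \<partial>M) = ennreal (D m n)" for m n
    unfolding D_def by (rule nn_integral_eq_integral[OF int]) auto
  \<comment> \<open>The rate 1/4 beats the weight 2 in \<open>S\<close>: the integral of the term
    number \<open>k\<close> is at most \<open>(1/2)^k\<close>.\<close>
  have "\<exists>N. \<forall>m\<ge>N. \<forall>n\<ge>N. D m n < (1/4)^k" for k
    using cauchy[of "(1/4)^k"] by (simp add: D_def)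
  then obtain N where N: "\<And>k m n. m \<ge> N k \<Longrightarrow> n \<ge> N k \<Longrightarrow> D m n < (1/4)^k" by metis
  \<comment> \<open>The sum makes \<open>r\<close> monotone and at least \<open>N k\<close>; the
    added \<open>k\<close> makes it tend to infinity.\<close>
  define r where "r k = (\<Sum>i\<le>k. N i) + k" for k
  have rN: "r k \<ge> N k" for k
    unfolding r_def by (simp add: sum.atMost_Suc trans_le_add1 member_le_sum)
  have rk: "r k \<ge> k" "r (Suc k) \<ge> r k" for k unfolding r_def by auto
  have Dr: "D (r (Suc k)) (r k) < (1/4)^k" for k
    by (rule N) (use rN[of k] rk(2)[of k] in linarith)+
  define S where "S x = (\<Sum>k. ennreal (2^k * (norm (f (r (Suc k)) x - f (r k) x))\<^sup>2))" for x
  have [measurable]: "S \<in> borel_measurable M" unfolding S_def by measurable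
  have "(\<integral>\<^sup>+x. S x \<partial>M) = (\<Sum>k. \<integral>\<^sup>+x. ennreal (2^k * (norm (f (r (Suc k)) x - f (r k) x))\<^sup>2) \<partial>M)"
    unfolding S_def by (rule nn_integral_suminf) measurable
  also have "\<dots> = (\<Sum>k. ennreal (2^k * D (r (Suc k)) (r k)))"
    by (simp add: ennreal_mult D0 nn_integral_cmult nnD)
  also have "\<dots> \<le> (\<Sum>k. ennreal ((1/2)^k))"
  proof (intro suminf_le ennreal_leI summableI)
    fix k have "2^k * D (r (Suc k)) (r k) \<le> 2^k * (1/4)^k" using Dr[of k] by simp
    also have "\<dots> = (1/2::real)^k" by (simp flip: power_mult_distrib)
    finally show "2^k * D (r (Suc k)) (r k) \<le> (1/2)^k" .
  qed
  also have "\<dots> < \<infinity>"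
    by (subst suminf_ennreal2) (auto simp: summable_geometric)
  finally have "(\<integral>\<^sup>+x. S x \<partial>M) \<noteq> \<infinity>" by simp
  then have "AE x in M. S x \<noteq> \<infinity>" by (intro nn_integral_PInf_AE) auto
  then have conv: "AE x in M. convergent (\<lambda>k. f (r k) x)"
  proof eventually_elim
    case (elim x)
    define d where "d k = f (r (Suc k)) x - f (r k) x" for k
    \<comment> \<open>One term is at most the whole sum, so the increments decay geometrically with
      ratio \<open>sqrt (1/2)\<close> and telescope to a convergent sequence.\<close>
    have "2^k * (norm (d k))\<^sup>2 \<le> enn2real (S x)" for k
    proof -
      have "ennreal (2^k * (norm (d k))\<^sup>2) \<le> S x"
        unfolding S_def d_def by (rule le_suminf_ennreal)
      then have "enn2real (ennreal (2^k * (norm (d k))\<^sup>2)) \<le> enn2real (S x)"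
        using elim by (intro enn2real_mono) (auto simp: less_top)
      then show ?thesis by simp
    qed
    then have sq: "(norm (d k))\<^sup>2 \<le> enn2real (S x) * (1/2)^k" for k
      by (simp add: field_simps power_divide)
    have "norm (d k) \<le> sqrt (enn2real (S x)) * (sqrt (1/2))^k" for k
      using real_le_rsqrt[OF sq[of k]] by (simp add: real_sqrt_mult real_sqrt_power)
    moreover have "summable (\<lambda>k. sqrt (enn2real (S x)) * (sqrt (1/2))^k)"
      by (intro summable_mult summable_geometric) (auto simp: real_sqrt_lt_1_iff)
    ultimately have "summable d" by (metis summable_comparison_test)
    then have "convergent (\<lambda>n. \<Sum>k<n. d k)" by (simp add: summable_iff_convergent)
    then have "convergent (\<lambda>n. (\<Sum>k<n. d k) + f (r 0) x)"
      by (intro convergent_add convergent_const)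
    moreover have "(\<Sum>k<n. d k) + f (r 0) x = f (r n) x" for n
      unfolding d_def using sum_lessThan_telescope[of "\<lambda>k. f (r k) x" n] by simp
    ultimately show ?case by simp
  qed
  \<comment> \<open>\<open>lim\<close> is an unspecified value where the sequence diverges, which
    happens on a null set only.\<close>
  define g where "g x = lim (\<lambda>k. f (r k) x)" for x
  have g_m [measurable]: "g \<in> borel_measurable M" unfolding g_def by (rule borel_measurable_lim_metric) measurable
  have glim: "AE x in M. (\<lambda>k. f (r k) x) \<longlonglongrightarrow> g x"
    using conv by eventually_elim (simp add: g_def convergent_LIMSEQ_iff)
  \<comment> \<open>Only the second index runs along the subsequence; \<open>n\<close> is any index,
    so the estimate applies to the full sequence.\<close>
  have fatou: "(\<integral>\<^sup>+x. ennreal ((norm (f n x - g x))\<^sup>2) \<partial>M) \<le> ennreal e"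
    if "\<And>m. m \<ge> K \<Longrightarrow> D n m \<le> e" for n e K
  proof -
    have "(\<integral>\<^sup>+x. ennreal ((norm (f n x - g x))\<^sup>2) \<partial>M)
        = (\<integral>\<^sup>+x. liminf (\<lambda>k. ennreal ((norm (f n x - f (r k) x))\<^sup>2)) \<partial>M)"
    proof (rule nn_integral_cong_AE)
      show "AE x in M. ennreal ((norm (f n x - g x))\<^sup>2) = liminf (\<lambda>k. ennreal ((norm (f n x - f (r k) x))\<^sup>2))"
        using glim
      proof eventually_elim
        case (elim x)
        have "(\<lambda>k. ennreal ((norm (f n x - f (r k) x))\<^sup>2)) \<longlonglongrightarrow> ennreal ((norm (f n x - g x))\<^sup>2)"
          by (intro tendsto_intros elim)
        then show ?case by (rule lim_imp_Liminf[OF trivial_limit_sequentially, symmetric])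
      qed
    qed
    also have "\<dots> \<le> liminf (\<lambda>k. \<integral>\<^sup>+x. ennreal ((norm (f n x - f (r k) x))\<^sup>2) \<partial>M)"
      by (rule nn_integral_liminf) measurable
    also have "\<dots> \<le> liminf (\<lambda>k::nat. ennreal e)"
    proof (rule Liminf_mono)
      show "\<forall>\<^sub>F k in sequentially. (\<integral>\<^sup>+x. ennreal ((norm (f n x - f (r k) x))\<^sup>2) \<partial>M) \<le> ennreal e"
        unfolding nnD using that rk(1) by (auto simp: eventually_sequentially intro!: exI[of _ K] ennreal_leI)
          (meson order_trans)
    qed
    also have "\<dots> = ennreal e" by (simp add: Liminf_const)
    finally show ?thesis .
  qed
  have "\<exists>K. \<forall>n\<ge>K. (\<integral>\<^sup>+x. ennreal ((norm (f n x - g x))\<^sup>2) \<partial>M) \<le> ennreal e" if "e > 0" for e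
  proof -
    obtain K where K: "\<forall>m\<ge>K. \<forall>n\<ge>K. D m n < e" using cauchy[OF \<open>e > 0\<close>] by (auto simp: D_def)
    then show ?thesis by (intro exI[of _ K] allI impI fatou[of K]) (auto intro: less_imp_le)
  qed
  note fin = this
  obtain K where K: "(\<integral>\<^sup>+x. ennreal ((norm (f K x - g x))\<^sup>2) \<partial>M) \<le> ennreal 1"
    using fin[of 1] by auto
  have "integrable M (\<lambda>x. (norm (f K x - g x))\<^sup>2)"
    by (rule integrableI_nonneg) (use K in \<open>auto simp: le_less_trans\<close>)
  then have "L2 M (\<lambda>x. f K x - g x)" by (simp add: L2_def)
  from L2_diff[OF f[of K] this] have g: "L2 M g" by simp
  have eq: "(\<integral>\<^sup>+x. ennreal ((norm (f n x - g x))\<^sup>2) \<partial>M) = ennreal (LINT x|M. (norm (f n x - g x))\<^sup>2)" for n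
    by (rule nn_integral_eq_integral) (use L2_diff[OF f g] in \<open>auto simp: L2_def\<close>)
  have "(\<lambda>k. LINT x|M. (norm (f k x - g x))\<^sup>2) \<longlonglongrightarrow> 0"
  proof (rule LIMSEQ_I)
    fix e :: real assume "e > 0"
    then obtain K where "\<forall>n\<ge>K. (LINT x|M. (norm (f n x - g x))\<^sup>2) \<le> e / 2"
      using fin[of "e/2"] unfolding eq by (auto simp: ennreal_le_iff)
    then show "\<exists>K. \<forall>n\<ge>K. norm ((LINT x|M. (norm (f n x - g x))\<^sup>2) - 0) < e"
      using \<open>e > 0\<close> by (intro exI[of _ K]) force
  qed
  with g that show ?thesis by blast
qed

section \<open>Lipschitz charts\<close>

text \<open>The Lipschitz graph of the definition is the zero set of \<open>H x = h (x - (x \<bullet> e) *\<^sub>R e) - x \<bullet> e\<close>.\<close>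

definition lip_chart :: "(real^3) set \<Rightarrow> real^3 \<Rightarrow> real^3 \<Rightarrow> (real^3 \<Rightarrow> real) \<Rightarrow> real \<Rightarrow> real \<Rightarrow> bool" where
  "lip_chart \<Omega> p e H K r \<longleftrightarrow> norm e = 1 \<and> r > 0 \<and> K > 0 \<and>
     (\<forall>x y. \<bar>H x - H y\<bar> \<le> K * norm (x - y)) \<and> (\<forall>x t. H (x + t *\<^sub>R e) = H x - t) \<and>
     (\<forall>x\<in>ball p r. x \<in> \<Omega> \<longleftrightarrow> H x < 0)"

text \<open>\<open>P\<close> is the orthogonal projection along \<open>e\<close>: it does not
  increase distances, and moves along \<open>e\<close> do not change it, which gives
  \<open>H\<close> the slope -1 in that direction.\<close>

lemma lip_chart_exists:
  assumes "lipschitz_boundary \<Omega>" "p \<in> frontier \<Omega>"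
  obtains e H K r where "lip_chart \<Omega> p e H K r"
proof -
  obtain e h L r where e: "norm e = 1" and r: "r > 0" and L: "L-lipschitz_on {y. y \<bullet> e = 0} h"
    and h: "\<forall>x\<in>ball p r. x \<in> \<Omega> \<longleftrightarrow> h (x - (x \<bullet> e) *\<^sub>R e) < x \<bullet> e"
    using assms unfolding lipschitz_boundary_def by blast
  have ee: "e \<bullet> e = 1" using e by (simp add: norm_eq_1)
  define P where "P x = x - (x \<bullet> e) *\<^sub>R e" for x
  define H where "H x = h (P x) - x \<bullet> e" for x
  have L0: "L \<ge> 0" using L by (rule lipschitz_on_nonneg)
  have P0: "P x \<bullet> e = 0" for x by (simp add: P_def inner_diff_left ee)
  have Pn: "norm (P x - P y) \<le> norm (x - y)" for x y
  proof -
    have "P x - P y = (x - y) - ((x - y) \<bullet> e) *\<^sub>R e" by (simp add: P_def algebra_simps)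
    moreover have "(norm (z - (z \<bullet> e) *\<^sub>R e))\<^sup>2 = (norm z)\<^sup>2 - (z \<bullet> e)\<^sup>2" for z
      unfolding power2_norm_eq_inner
      by (simp add: inner_diff_left inner_diff_right ee inner_commute power2_eq_square)
    ultimately have "(norm (P x - P y))\<^sup>2 = (norm (x - y))\<^sup>2 - ((x - y) \<bullet> e)\<^sup>2" by metis
    then have "(norm (P x - P y))\<^sup>2 \<le> (norm (x - y))\<^sup>2" by simp
    then show ?thesis by (rule power2_le_imp_le) simp
  qed
  \<comment> \<open>\<open>L\<close> comes from the graph and 1 from the height
    \<open>x \<bullet> e\<close>; the sum is positive even if \<open>L\<close> is 0.\<close>
  have "lip_chart \<Omega> p e H (L + 1) r"
    unfolding lip_chart_def
  proof (intro conjI allI)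
    fix x y
    have "\<bar>h (P x) - h (P y)\<bar> \<le> L * norm (P x - P y)"
      using lipschitz_onD[OF L, of "P x" "P y"] P0 by (simp add: dist_norm)
    also have "\<dots> \<le> L * norm (x - y)" using Pn L0 by (intro mult_left_mono)
    finally have "\<bar>h (P x) - h (P y)\<bar> \<le> L * norm (x - y)" .
    moreover have "\<bar>x \<bullet> e - y \<bullet> e\<bar> \<le> norm (x - y)"
      using Cauchy_Schwarz_ineq2[of "x - y" e] e by (simp add: inner_diff_left)
    ultimately show "\<bar>H x - H y\<bar> \<le> (L + 1) * norm (x - y)"
      unfolding H_def by (simp add: algebra_simps)
  next
    fix x t
    have "P (x + t *\<^sub>R e) = P x" by (simp add: P_def inner_add_left ee algebra_simps)
    then show "H (x + t *\<^sub>R e) = H x - t" by (simp add: H_def inner_add_left ee)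
  next
    show "\<forall>x\<in>ball p r. x \<in> \<Omega> \<longleftrightarrow> H x < 0" using h by (simp add: H_def P_def)
  qed (use e r L0 in auto)
  then show ?thesis by (rule that)
qed

text \<open>\<open>H\<close> falls with unit speed along \<open>e\<close>, so its zeros are limits
  of points of the domain; where \<open>H\<close> is positive, the Lipschitz bound keeps it positive
  nearby, so no point of the closure is there.\<close>

lemma lip_chart_frontier:
  assumes c: "lip_chart \<Omega> p e H K r" and op: "open \<Omega>" and x: "x \<in> ball p r"
  shows "x \<in> frontier \<Omega> \<longleftrightarrow> H x = 0"
proof
  have K: "K > 0" "\<And>x y. \<bar>H x - H y\<bar> \<le> K * norm (x - y)" and e: "norm e = 1"
    and sh: "\<And>x t. H (x + t *\<^sub>R e) = H x - t"
    and \<Omega>: "\<And>x. x \<in> ball p r \<Longrightarrow> x \<in> \<Omega> \<longleftrightarrow> H x < 0"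
    using c by (auto simp: lip_chart_def)
  obtain d where d: "d > 0" "ball x d \<subseteq> ball p r" using x open_ball open_contains_ball by metis
  show "H x = 0" if xf: "x \<in> frontier \<Omega>"
  proof (rule ccontr)
    have "x \<notin> \<Omega>" using xf op by (simp add: frontier_def interior_open)
    moreover assume "H x \<noteq> 0"
    ultimately have pos: "H x > 0" using \<Omega>[OF x] by auto
    define d' where "d' = min d (H x / K)"
    have "d' > 0" using d pos K by (simp add: d'_def)
    then obtain y where y: "y \<in> \<Omega>" "dist y x < d'"
      using xf by (auto simp: frontier_def closure_approachable)
    then have "y \<in> ball p r" using d by (auto simp: d'_def dist_commute)
    then have "H y < 0" using \<Omega> y by auto
    moreover have "K * norm (x - y) < H x"
      using y K by (simp add: d'_def dist_norm norm_minus_commute field_simps)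
    ultimately show False using K(2)[of x y] by auto
  qed
  show "x \<in> frontier \<Omega>" if Hx: "H x = 0"
  proof -
    have "x \<notin> \<Omega>" using \<Omega>[OF x] Hx by simp
    moreover have "x \<in> closure \<Omega>"
      unfolding closure_approachable
    proof (intro allI impI)
      fix \<epsilon> :: real assume "\<epsilon> > 0"
      define t where "t = min d \<epsilon> / 2"
      have t: "t > 0" "t < d" "t < \<epsilon>" using d \<open>\<epsilon> > 0\<close> by (auto simp: t_def)
      have "dist x (x + t *\<^sub>R e) = t" using t e by (simp add: dist_norm)
      then have "x + t *\<^sub>R e \<in> ball x d" using t by simp
      then have "x + t *\<^sub>R e \<in> ball p r" using d by blast
      then have "x + t *\<^sub>R e \<in> \<Omega>" using \<Omega> sh Hx t by auto
      then show "\<exists>y\<in>\<Omega>. dist y x < \<epsilon>"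
        using \<open>dist x (x + t *\<^sub>R e) = t\<close> t by (metis dist_commute)
    qed
    ultimately show ?thesis using op by (simp add: frontier_def interior_open)
  qed
qed

section \<open>The Poincare inequality\<close>

text \<open>Fundamental theorem of calculus on the segment, then Jensen's inequality on the unit
  interval. The indicator of \<Omega> is 1 on the segment; it makes the integrand Borel measurable
  on the whole space, as the later exchange of integrals requires.\<close>

lemma C1_translate_integral:
  fixes v :: "real^3 \<Rightarrow> real"
  assumes op: "open \<Omega>" and v: "\<And>x. x \<in> \<Omega> \<Longrightarrow> v differentiable at x" "continuous_on \<Omega> (grad v)"
    and seg: "\<And>s. 0 \<le> s \<Longrightarrow> s \<le> 1 \<Longrightarrow> x + s *\<^sub>R w \<in> \<Omega>"
  shows "ennreal ((v (x + w) - v x)\<^sup>2) \<le> ennreal ((norm w)\<^sup>2) *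
    (\<integral>\<^sup>+s. indicator {0..1} s * ennreal (indicator \<Omega> (x + s *\<^sub>R w) *\<^sub>R (norm (grad v (x + s *\<^sub>R w)))\<^sup>2) \<partial>lborel)"
proof -
  define g where "g s = grad v (x + s *\<^sub>R w) \<bullet> w" for s
  have cgrad: "continuous_on {0..1} (\<lambda>s. grad v (x + s *\<^sub>R w))"
    by (rule continuous_on_compose2[OF v(2)]) (auto intro!: continuous_intros seg)
  then have cg: "continuous_on {0..1} g" unfolding g_def by (intro continuous_intros)
  have der: "((\<lambda>s. v (x + s *\<^sub>R w)) has_vector_derivative g s) (at s within {0..1})" if "0 \<le> s" "s \<le> 1" for s
  proof -
    have "((\<lambda>s. x + s *\<^sub>R w) has_derivative (\<lambda>h. h *\<^sub>R w)) (at s within {0..1})"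
      by (auto intro!: derivative_eq_intros)
    moreover have "(v has_derivative (\<lambda>h. grad v (x + s *\<^sub>R w) \<bullet> h)) (at (x + s *\<^sub>R w))"
      by (rule has_derivative_grad) (use v seg that in auto)
    ultimately have "((\<lambda>s. v (x + s *\<^sub>R w)) has_derivative (\<lambda>h. grad v (x + s *\<^sub>R w) \<bullet> (h *\<^sub>R w))) (at s within {0..1})"
      by (rule has_derivative_compose)
    then show ?thesis by (simp add: has_vector_derivative_def g_def)
  qed
  let ?I = "\<lambda>f. LINT s|lborel. indicator {0..1} s *\<^sub>R (f s :: real)"
  have ftc: "?I g = v (x + w) - v x"
    using integral_FTC_Icc[of 0 1 "\<lambda>s. v (x + s *\<^sub>R w)" g] der cg by simp
  have int: "integrable lborel (\<lambda>s. indicator {0..1} s *\<^sub>R f s)" if "continuous_on {0..1} f" for f :: "real \<Rightarrow> real"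
    using borel_integrable_compact[of "{0..1}" f] that by simp
  define c where "c = v (x + w) - v x"
  have Ig: "?I g = c" using ftc by (simp add: c_def)
  \<comment> \<open>The variance of \<open>g\<close> over the unit interval is nonnegative, which
    bounds the square of its mean by the mean of its square.\<close>
  have "0 \<le> ?I (\<lambda>s. (g s - c)\<^sup>2)" by (intro integral_nonneg_AE) auto
  also have "?I (\<lambda>s. (g s - c)\<^sup>2) = ?I (\<lambda>s. (g s)\<^sup>2) - 2 * c * ?I g + c\<^sup>2"
  proof -
    have "?I (\<lambda>s. (g s - c)\<^sup>2) = (LINT s|lborel. indicator {0..1} s *\<^sub>R (g s)\<^sup>2 - 2 * c * (indicator {0..1} s *\<^sub>R g s) + c\<^sup>2 * indicator {0..1} s)"
      by (intro Bochner_Integration.integral_cong) (auto simp: power2_eq_square algebra_simps)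
    also have "\<dots> = ?I (\<lambda>s. (g s)\<^sup>2) - 2 * c * ?I g + c\<^sup>2"
      using int[OF cg] int[of "\<lambda>s. (g s)\<^sup>2"] cg by (simp add: continuous_on_power)
    finally show ?thesis .
  qed
  finally have "c\<^sup>2 \<le> ?I (\<lambda>s. (g s)\<^sup>2)" unfolding Ig by (simp add: power2_eq_square)
  also have "\<dots> \<le> ?I (\<lambda>s. (norm w)\<^sup>2 * (norm (grad v (x + s *\<^sub>R w)))\<^sup>2)"
  proof (intro integral_mono int)
    show "indicator {0..1} s *\<^sub>R (g s)\<^sup>2 \<le> indicator {0..1} s *\<^sub>R ((norm w)\<^sup>2 * (norm (grad v (x + s *\<^sub>R w)))\<^sup>2)" for s
      using Cauchy_Schwarz_ineq[of "grad v (x + s *\<^sub>R w)" w]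
      by (auto simp: g_def indicator_def power2_norm_eq_inner mult.commute)
  qed (use cg cgrad in \<open>auto intro!: continuous_intros\<close>)
  finally have "ennreal (c\<^sup>2) \<le> ennreal (?I (\<lambda>s. (norm w)\<^sup>2 * (norm (grad v (x + s *\<^sub>R w)))\<^sup>2))"
    by (rule ennreal_leI)
  also have "\<dots> = (\<integral>\<^sup>+s. ennreal (indicator {0..1} s *\<^sub>R ((norm w)\<^sup>2 * (norm (grad v (x + s *\<^sub>R w)))\<^sup>2)) \<partial>lborel)"
    by (rule nn_integral_eq_integral[symmetric], intro int continuous_intros cgrad) auto
  also have "\<dots> = (\<integral>\<^sup>+s. ennreal ((norm w)\<^sup>2) * (indicator {0..1} s * ennreal (indicator \<Omega> (x + s *\<^sub>R w) *\<^sub>R (norm (grad v (x + s *\<^sub>R w)))\<^sup>2)) \<partial>lborel)"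
    by (intro nn_integral_cong) (auto simp: indicator_def ennreal_mult seg)
  also have "\<dots> = ennreal ((norm w)\<^sup>2) * (\<integral>\<^sup>+s. indicator {0..1} s * ennreal (indicator \<Omega> (x + s *\<^sub>R w) *\<^sub>R (norm (grad v (x + s *\<^sub>R w)))\<^sup>2) \<partial>lborel)"
  proof (rule nn_integral_cmult)
    have "(\<lambda>z. indicator \<Omega> z *\<^sub>R (norm (grad v z))\<^sup>2) \<in> borel_measurable borel"
      by (rule borel_measurable_continuous_on_indicator) (use op v(2) in \<open>auto intro!: continuous_intros\<close>)
    then have [measurable]: "(\<lambda>s. indicator \<Omega> (x + s *\<^sub>R w) *\<^sub>R (norm (grad v (x + s *\<^sub>R w)))\<^sup>2) \<in> borel_measurable lborel"
      by (rule measurable_compose[rotated]) simp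
    show "(\<lambda>s. indicator {0..1} s * ennreal (indicator \<Omega> (x + s *\<^sub>R w) *\<^sub>R (norm (grad v (x + s *\<^sub>R w)))\<^sup>2)) \<in> borel_measurable lborel"
      by measurable
  qed
  finally show ?thesis unfolding c_def .
qed

lemma nn_integral_lborel_translate:
  fixes f :: "'a::euclidean_space \<Rightarrow> ennreal"
  assumes [measurable]: "f \<in> borel_measurable borel"
  shows "(\<integral>\<^sup>+x. f (x + c) \<partial>lborel) = (\<integral>\<^sup>+x. f x \<partial>lborel)"
proof -
  have "(\<integral>\<^sup>+x. f x \<partial>lborel) = (\<integral>\<^sup>+x. f x \<partial>distr lborel borel ((+) c))"
    by (simp add: lborel_distr_plus)
  also have "\<dots> = (\<integral>\<^sup>+x. f (c + x) \<partial>lborel)" by (rule nn_integral_distr) auto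
  finally show ?thesis by (simp add: add.commute)
qed

section \<open>Propagating a Poincare inequality by translations\<close>

abbreviation dirichlet :: "(real^3) set \<Rightarrow> (real^3 \<Rightarrow> real) \<Rightarrow> ennreal" where
  "dirichlet \<Omega> v \<equiv> \<integral>\<^sup>+x. ennreal (indicator \<Omega> x *\<^sub>R (norm (grad v x))\<^sup>2) \<partial>lborel"

abbreviation sqdev :: "(real^3) set \<Rightarrow> (real^3 \<Rightarrow> real) \<Rightarrow> real \<Rightarrow> ennreal" where
  "sqdev A v c \<equiv> \<integral>\<^sup>+x. indicator A x * ennreal ((v x - c)\<^sup>2) \<partial>lborel"

abbreviation C1_on :: "(real^3) set \<Rightarrow> (real^3 \<Rightarrow> real) \<Rightarrow> bool" where
  "C1_on \<Omega> v \<equiv> (\<forall>x\<in>\<Omega>. v differentiable at x) \<and> continuous_on \<Omega> (grad v)"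

text \<open>Integrating the segment estimate and exchanging the integrals leaves, for each
  \<open>s\<close>, a translate of the energy density; continued by 0 to the whole space, it has the
  same integral as the density itself.\<close>

lemma translate_dirichlet:
  assumes op: "open \<Omega>" and v: "C1_on \<Omega> v" and A: "A \<in> sets borel"
    and seg: "\<And>x s. x \<in> A \<Longrightarrow> 0 \<le> s \<Longrightarrow> s \<le> 1 \<Longrightarrow> x + s *\<^sub>R w \<in> \<Omega>"
  shows "(\<integral>\<^sup>+x. indicator A x * ennreal ((v (x + w) - v x)\<^sup>2) \<partial>lborel) \<le> ennreal ((norm w)\<^sup>2) * dirichlet \<Omega> v"
proof -
  define g where "g z = indicator \<Omega> z *\<^sub>R (norm (grad v z))\<^sup>2" for z
  have g [measurable]: "g \<in> borel_measurable borel"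
    unfolding g_def by (rule borel_measurable_continuous_on_indicator) (use op v in \<open>auto intro!: continuous_intros\<close>)
  have "(\<integral>\<^sup>+x. indicator A x * ennreal ((v (x + w) - v x)\<^sup>2) \<partial>lborel)
      \<le> (\<integral>\<^sup>+x. ennreal ((norm w)\<^sup>2) * (\<integral>\<^sup>+s. indicator {0..1} s * ennreal (g (x + s *\<^sub>R w)) \<partial>lborel) \<partial>lborel)"
    unfolding g_def
    by (intro nn_integral_mono) (use C1_translate_integral[OF op, of v _ w] v seg in \<open>auto simp: indicator_def\<close>)
  also have "\<dots> = ennreal ((norm w)\<^sup>2) * (\<integral>\<^sup>+x. (\<integral>\<^sup>+s. indicator {0..1} s * ennreal (g (x + s *\<^sub>R w)) \<partial>lborel) \<partial>lborel)"
    by (rule nn_integral_cmult) measurable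
  also have "(\<integral>\<^sup>+x. (\<integral>\<^sup>+s. indicator {0..1} s * ennreal (g (x + s *\<^sub>R w)) \<partial>lborel) \<partial>lborel)
      = (\<integral>\<^sup>+s. (\<integral>\<^sup>+x. indicator {0..1::real} s * ennreal (g (x + s *\<^sub>R w)) \<partial>lborel) \<partial>lborel)"
    by (rule lborel_pair.Fubini') measurable
  also have "\<dots> = (\<integral>\<^sup>+s. indicator {0..1::real} s * dirichlet \<Omega> v \<partial>lborel)"
  proof (intro nn_integral_cong)
    fix s :: real
    have "(\<integral>\<^sup>+x. indicator {0..1} s * ennreal (g (x + s *\<^sub>R w)) \<partial>lborel)
       = indicator {0..1} s * (\<integral>\<^sup>+x. ennreal (g (x + s *\<^sub>R w)) \<partial>lborel)"
      by (rule nn_integral_cmult) measurable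
    also have "(\<integral>\<^sup>+x. ennreal (g (x + s *\<^sub>R w)) \<partial>lborel) = (\<integral>\<^sup>+x. ennreal (g x) \<partial>lborel)"
      by (rule nn_integral_lborel_translate) measurable
    finally show "(\<integral>\<^sup>+x. indicator {0..1} s * ennreal (g (x + s *\<^sub>R w)) \<partial>lborel) = indicator {0..1} s * dirichlet \<Omega> v"
      by (simp add: g_def)
  qed
  also have "\<dots> = dirichlet \<Omega> v" by (simp add: nn_integral_multc)
  finally show ?thesis .
qed


text \<open>A Poincare inequality on \<open>A\<close> relative to the base set \<open>D\<close>; in this form it propagates along
  translations inside \<open>\<Omega>\<close>.\<close>

definition controlled :: "(real^3) set \<Rightarrow> (real^3) set \<Rightarrow> (real^3) set \<Rightarrow> bool" where
  "controlled \<Omega> D A \<longleftrightarrow> (\<exists>C::real. C \<ge> 0 \<and> (\<forall>v c. C1_on \<Omega> v \<longrightarrow>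
     sqdev A v c \<le>
     ennreal C * (dirichlet \<Omega> v + sqdev D v c)))"

lemma C1_on_measurable:
  assumes "open \<Omega>" "C1_on \<Omega> v" "A \<in> sets borel" "A \<subseteq> \<Omega>"
  shows "(\<lambda>x. indicator A x * ennreal ((v x - c)\<^sup>2)) \<in> borel_measurable borel"
proof -
  have "continuous_on \<Omega> v" using assms by (meson continuous_at_imp_continuous_on differentiable_imp_continuous_within)
  then have "continuous_on A (\<lambda>x. (v x - c)\<^sup>2)" using assms(4) by (intro continuous_intros) (rule continuous_on_subset)
  then have [measurable]: "(\<lambda>x. indicator A x *\<^sub>R (v x - c)\<^sup>2) \<in> borel_measurable borel"
    by (intro borel_measurable_continuous_on_indicator assms)
  have eq: "(\<lambda>x. indicator A x * ennreal ((v x - c)\<^sup>2)) = (\<lambda>x. ennreal (indicator A x *\<^sub>R (v x - c)\<^sup>2))"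
    by (auto simp: indicator_def)
  show ?thesis unfolding eq by measurable
qed

lemma controlled_self: "controlled \<Omega> D D"
  unfolding controlled_def by (intro exI[of _ 1]) auto

lemma controlled_mono:
  assumes "controlled \<Omega> D A" "B \<subseteq> A"
  shows "controlled \<Omega> D B"
proof -
  have "sqdev B v c \<le> sqdev A v c"
    for v :: "real^3 \<Rightarrow> real" and c
    using assms(2) by (intro nn_integral_mono) (auto simp: indicator_def)
  then show ?thesis using assms(1) unfolding controlled_def by (meson order_trans)
qed

lemma controlled_Un:
  assumes op: "open \<Omega>" and A: "A \<in> sets borel" "A \<subseteq> \<Omega>" "controlled \<Omega> D A"
    and B: "B \<in> sets borel" "B \<subseteq> \<Omega>" "controlled \<Omega> D B"
  shows "controlled \<Omega> D (A \<union> B)"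
proof -
  obtain C1 C2 where C: "C1 \<ge> 0" "C2 \<ge> 0"
    "\<And>v c. C1_on \<Omega> v \<Longrightarrow> sqdev A v c \<le>
     ennreal C1 * (dirichlet \<Omega> v + sqdev D v c)"
    "\<And>v c. C1_on \<Omega> v \<Longrightarrow> sqdev B v c \<le>
     ennreal C2 * (dirichlet \<Omega> v + sqdev D v c)"
    using A(3) B(3) unfolding controlled_def by blast
  have "sqdev (A \<union> B) v c \<le>
     ennreal (C1 + C2) * (dirichlet \<Omega> v + sqdev D v c)"
    if v: "C1_on \<Omega> v" for v c
  proof -
    have "sqdev (A \<union> B) v c \<le>
      (\<integral>\<^sup>+x. indicator A x * ennreal ((v x - c)\<^sup>2) + indicator B x * ennreal ((v x - c)\<^sup>2) \<partial>lborel)"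
      by (intro nn_integral_mono) (auto simp: indicator_def)
    also have "\<dots> = sqdev A v c + sqdev B v c"
      by (rule nn_integral_add) (use C1_on_measurable[OF op v] A B in auto)
    also have "\<dots> \<le> ennreal C1 * (dirichlet \<Omega> v + sqdev D v c)
      + ennreal C2 * (dirichlet \<Omega> v + sqdev D v c)"
      by (intro add_mono C v)
    also have "\<dots> = ennreal (C1 + C2) * (dirichlet \<Omega> v + sqdev D v c)"
      using C by (simp add: ennreal_plus distrib_right)
    finally show ?thesis .
  qed
  then show ?thesis unfolding controlled_def using C by (intro exI[of _ "C1 + C2"]) auto
qed

lemma controlled_Union:
  assumes op: "open \<Omega>" and "finite T" "\<And>A. A \<in> T \<Longrightarrow> A \<in> sets borel \<and> A \<subseteq> \<Omega> \<and> controlled \<Omega> D A"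
  shows "controlled \<Omega> D (\<Union>T)"
  using assms(2,3)
proof (induction T)
  case empty
  show ?case unfolding controlled_def by (intro exI[of _ 0]) auto
next
  case (insert A T)
  have "controlled \<Omega> D (A \<union> \<Union>T)"
    by (rule controlled_Un[OF op]) (use insert in \<open>auto intro!: sets.finite_Union\<close>)
  then show ?case by simp
qed

text \<open>Split \<open>v x - c\<close> into \<open>v x - v (x + w)\<close>, bounded by the
  Dirichlet energy, and \<open>v (x + w) - c\<close>, whose integral over \<open>A\<close> is part
  of the integral over \<open>B\<close>; squaring a sum of two terms costs the factor 2.\<close>

lemma controlled_translate:
  assumes op: "open \<Omega>" and A: "A \<in> sets borel" "A \<subseteq> \<Omega>"
    and B: "B \<in> sets borel" "B \<subseteq> \<Omega>" "controlled \<Omega> D B"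
    and seg: "\<And>x s. x \<in> A \<Longrightarrow> 0 \<le> s \<Longrightarrow> s \<le> 1 \<Longrightarrow> x + s *\<^sub>R w \<in> \<Omega>"
    and AB: "\<And>x. x \<in> A \<Longrightarrow> x + w \<in> B"
  shows "controlled \<Omega> D A"
proof -
  obtain C where C: "C \<ge> 0"
    "\<And>v c. C1_on \<Omega> v \<Longrightarrow> sqdev B v c \<le>
     ennreal C * (dirichlet \<Omega> v + sqdev D v c)"
    using B(3) unfolding controlled_def by blast
  have "sqdev A v c \<le>
     ennreal (2 * (norm w)\<^sup>2 + 2 * C) * (dirichlet \<Omega> v + sqdev D v c)"
    (is "_ \<le> _ * (?E + ?D)") if v: "C1_on \<Omega> v" for v c
  proof -
    have cv: "continuous_on \<Omega> v" using v by (meson continuous_at_imp_continuous_on differentiable_imp_continuous_within)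
    have cw: "continuous_on A (\<lambda>x. v (x + w))"
      by (rule continuous_on_compose2[OF cv]) (use AB B in \<open>auto intro!: continuous_intros\<close>)
    have "continuous_on A (\<lambda>x. (v (x + w) - v x)\<^sup>2)"
      using cw continuous_on_subset[OF cv A(2)] by (intro continuous_intros)
    then have [measurable]: "(\<lambda>x. indicator A x *\<^sub>R (v (x + w) - v x)\<^sup>2) \<in> borel_measurable borel"
      by (intro borel_measurable_continuous_on_indicator A)
    have eq: "(\<lambda>x. indicator A x * ennreal ((v (x + w) - v x)\<^sup>2)) = (\<lambda>x. ennreal (indicator A x *\<^sub>R (v (x + w) - v x)\<^sup>2))"
      by (auto simp: indicator_def)
    have m1 [measurable]: "(\<lambda>x. indicator A x * ennreal ((v (x + w) - v x)\<^sup>2)) \<in> borel_measurable borel"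
      unfolding eq by measurable
    have m2 [measurable]: "(\<lambda>x. indicator B x * ennreal ((v x - c)\<^sup>2)) \<in> borel_measurable borel"
      by (rule C1_on_measurable[OF op v B(1,2)])
    have m3 [measurable]: "(\<lambda>x. indicator B (x + w) * ennreal ((v (x + w) - c)\<^sup>2)) \<in> borel_measurable borel"
      using measurable_compose[OF _ m2, of "\<lambda>x. x + w" borel] by simp
    have "sqdev A v c \<le>
      (\<integral>\<^sup>+x. ennreal 2 * (indicator A x * ennreal ((v (x + w) - v x)\<^sup>2)) + ennreal 2 * (indicator B (x + w) * ennreal ((v (x + w) - c)\<^sup>2)) \<partial>lborel)"
    proof (intro nn_integral_mono)
      fix x
      have "(v x - c)\<^sup>2 \<le> 2 * (v (x + w) - v x)\<^sup>2 + 2 * (v (x + w) - c)\<^sup>2"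
        using zero_le_power2[of "(v (x + w) - v x) + (v (x + w) - c)"] by (simp add: power2_eq_square algebra_simps)
      from ennreal_leI[OF this] have "ennreal ((v x - c)\<^sup>2) \<le> ennreal 2 * ennreal ((v (x + w) - v x)\<^sup>2) + ennreal 2 * ennreal ((v (x + w) - c)\<^sup>2)"
        by (simp add: ennreal_plus ennreal_mult)
      then show "indicator A x * ennreal ((v x - c)\<^sup>2) \<le>
        ennreal 2 * (indicator A x * ennreal ((v (x + w) - v x)\<^sup>2)) + ennreal 2 * (indicator B (x + w) * ennreal ((v (x + w) - c)\<^sup>2))"
        using AB by (auto simp: indicator_def)
    qed
    also have "\<dots> = ennreal 2 * (\<integral>\<^sup>+x. indicator A x * ennreal ((v (x + w) - v x)\<^sup>2) \<partial>lborel) +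
        ennreal 2 * (\<integral>\<^sup>+x. indicator B (x + w) * ennreal ((v (x + w) - c)\<^sup>2) \<partial>lborel)"
      by (subst nn_integral_add) (auto simp: nn_integral_cmult)
    also have "(\<integral>\<^sup>+x. indicator B (x + w) * ennreal ((v (x + w) - c)\<^sup>2) \<partial>lborel) = sqdev B v c"
      by (rule nn_integral_lborel_translate) (rule m2)
    also have "ennreal 2 * (\<integral>\<^sup>+x. indicator A x * ennreal ((v (x + w) - v x)\<^sup>2) \<partial>lborel) + ennreal 2 * \<dots>
      \<le> ennreal 2 * (ennreal ((norm w)\<^sup>2) * ?E) + ennreal 2 * (ennreal C * (?E + ?D))"
      by (intro add_mono mult_left_mono translate_dirichlet[OF op v A(1)] C seg v) auto
    also have "\<dots> \<le> ennreal 2 * (ennreal ((norm w)\<^sup>2) * (?E + ?D)) + ennreal 2 * (ennreal C * (?E + ?D))"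
      by (intro add_mono mult_left_mono) auto
    also have "\<dots> = ennreal (2 * (norm w)\<^sup>2 + 2 * C) * (?E + ?D)"
      using C by (simp add: ennreal_plus ennreal_mult distrib_right mult.assoc)
    finally show ?thesis .
  qed
  then show ?thesis unfolding controlled_def using C by (intro exI[of _ "2 * (norm w)\<^sup>2 + 2 * C"]) auto
qed

text \<open>In \<open>ball q R\<close> all segments are admissible by convexity, so every small ball
  around a point of the half-radius ball can be moved into the controlled one, and finitely many of
  them cover. The resulting radius \<open>R / 2\<close> does not depend on \<open>r\<close>, which
  gives closedness in the connectedness argument.\<close>

lemma controlled_enlarge_ball:
  assumes op: "open \<Omega>" and R: "ball q R \<subseteq> \<Omega>" "R > 0" and r: "r > 0" "ball q' r \<subseteq> ball q R" "controlled \<Omega> D (ball q' r)"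
  shows "controlled \<Omega> D (ball q (R / 2))"
proof -
  \<comment> \<open>At most \<open>r\<close> to fit into the controlled ball after the move, at most
    \<open>R / 2\<close> to lie in \<open>ball q R\<close> before it.\<close>
  define \<rho> where "\<rho> = min r (R / 2)"
  have \<rho>: "\<rho> > 0" "\<rho> \<le> r" "\<rho> \<le> R / 2" using R r by (auto simp: \<rho>_def)
  have sub: "ball z \<rho> \<subseteq> ball q R" if "z \<in> cball q (R / 2)" for z
  proof
    fix y assume "y \<in> ball z \<rho>"
    then show "y \<in> ball q R" using that \<rho> dist_triangle[of q y z] by simp
  qed
  have ctr: "controlled \<Omega> D (ball z \<rho>)" if z: "z \<in> cball q (R / 2)" for z
  proof (rule controlled_translate[OF op _ _ _ _ r(3), where w = "q' - z"])
    fix x assume x: "x \<in> ball z \<rho>"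
    then show b: "x + (q' - z) \<in> ball q' r"
      using \<rho> by (simp add: dist_norm algebra_simps)
    fix s :: real assume s: "0 \<le> s" "s \<le> 1"
    have "x \<in> ball q R" "x + (q' - z) \<in> ball q R" using sub[OF z] x b r by auto
    then have "(1 - s) *\<^sub>R x + s *\<^sub>R (x + (q' - z)) \<in> ball q R"
      using convexD_alt[OF convex_ball, of x q R "x + (q' - z)" s] s by simp
    moreover have "(1 - s) *\<^sub>R x + s *\<^sub>R (x + (q' - z)) = x + s *\<^sub>R (q' - z)" by (simp add: algebra_simps)
    ultimately show "x + s *\<^sub>R (q' - z) \<in> \<Omega>" using R by auto
  qed (use sub[OF z] R r in auto)
  have "cball q (R / 2) \<subseteq> (\<Union>z\<in>cball q (R / 2). ball z \<rho>)" using \<rho> by force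
  then obtain T where T: "T \<subseteq> cball q (R / 2)" "finite T" "cball q (R / 2) \<subseteq> (\<Union>z\<in>T. ball z \<rho>)"
    using compactE_image[OF compact_cball, of "cball q (R / 2)" "\<lambda>z. ball z \<rho>" q "R/2"] by (metis open_ball)
  have "controlled \<Omega> D (\<Union>((\<lambda>z. ball z \<rho>) ` T))"
  proof (rule controlled_Union[OF op])
    fix A assume "A \<in> (\<lambda>z. ball z \<rho>) ` T"
    then obtain z where z: "z \<in> cball q (R / 2)" "A = ball z \<rho>" using T by blast
    then show "A \<in> sets borel \<and> A \<subseteq> \<Omega> \<and> controlled \<Omega> D A"
      using sub[OF z(1)] ctr[OF z(1)] R by auto
  qed (use T in simp)
  then show ?thesis by (rule controlled_mono) (use T ball_subset_cball in blast)
qed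

text \<open>The centres of controlled balls form a nonempty set that is open and closed relative to
  the connected \<Omega>.\<close>

lemma controlled_interior:
  assumes op: "open \<Omega>" and con: "connected \<Omega>" and D: "ball q0 R0 \<subseteq> \<Omega>" "R0 > 0" and q: "q \<in> \<Omega>"
  shows "\<exists>r>0. ball q r \<subseteq> \<Omega> \<and> controlled \<Omega> (ball q0 R0) (ball q r)"
proof -
  define S where "S = {q \<in> \<Omega>. \<exists>r>0. ball q r \<subseteq> \<Omega> \<and> controlled \<Omega> (ball q0 R0) (ball q r)}"
  have "q0 \<in> S" unfolding S_def using D controlled_self by auto
  have "open S"
    unfolding open_contains_ball
  proof
    fix q assume "q \<in> S"
    then obtain r where r: "r > 0" "ball q r \<subseteq> \<Omega>" "controlled \<Omega> (ball q0 R0) (ball q r)" by (auto simp: S_def)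
    have "z \<in> S" if z: "z \<in> ball q r" for z
    proof -
      have sub: "ball z (r - dist q z) \<subseteq> ball q r"
      proof
        fix y assume "y \<in> ball z (r - dist q z)"
        then show "y \<in> ball q r" using dist_triangle[of q y z] by simp
      qed
      moreover have "controlled \<Omega> (ball q0 R0) (ball z (r - dist q z))" using controlled_mono[OF r(3) sub] .
      ultimately show ?thesis using z r unfolding S_def
        by (intro CollectI conjI exI[of _ "r - dist q z"]) auto
    qed
    then show "\<exists>e>0. ball q e \<subseteq> S" using r by blast
  qed
  moreover have "open (\<Omega> - S)"
    unfolding open_contains_ball
  proof
    fix q assume q: "q \<in> \<Omega> - S"
    obtain R where R: "R > 0" "ball q R \<subseteq> \<Omega>" using q op open_contains_ball by blast
    \<comment> \<open>A point of \<open>S\<close> in \<open>ball q R\<close> would spread its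
      control to \<open>ball q (R / 2)\<close>, and then \<open>q\<close> would belong to
      \<open>S\<close>.\<close>
    have "z \<notin> S" if z: "z \<in> ball q R" for z
    proof
      assume "z \<in> S"
      then obtain r where r: "r > 0" "controlled \<Omega> (ball q0 R0) (ball z r)" by (auto simp: S_def)
      obtain r' where r': "r' > 0" "ball z r' \<subseteq> ball q R" using z open_contains_ball open_ball by metis
      have "controlled \<Omega> (ball q0 R0) (ball z (min r r'))"
        by (rule controlled_mono[OF r(2)]) auto
      then have "controlled \<Omega> (ball q0 R0) (ball q (R / 2))"
        by (intro controlled_enlarge_ball[OF op R(2,1), of "min r r'" z]) (use r r' in auto)
      moreover have "ball q (R / 2) \<subseteq> \<Omega>" using R by (meson ball_divide_subset_numeral order_trans)
      ultimately have "q \<in> S" using R q by (auto simp: S_def intro!: exI[of _ "R / 2"])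
      then show False using q by simp
    qed
    then show "\<exists>e>0. ball q e \<subseteq> \<Omega> - S" using R by blast
  qed
  ultimately have "S \<inter> \<Omega> = {} \<or> (\<Omega> - S) \<inter> \<Omega> = {}"
    by (intro connectedD[OF con]) auto
  then have "q \<in> S" using \<open>q0 \<in> S\<close> q by (auto simp: S_def)
  then show ?thesis by (auto simp: S_def)
qed

lemma controlled_domain:
  assumes dom: "bounded_lipschitz_domain \<Omega>" and D: "ball q0 R0 \<subseteq> \<Omega>" "R0 > 0"
  shows "controlled \<Omega> (ball q0 R0) \<Omega>"
proof -
  have op: "open \<Omega>" and con: "connected \<Omega>" and bd: "bounded \<Omega>" and lip: "lipschitz_boundary \<Omega>"
    using dom by (auto simp: bounded_lipschitz_domain_def)
  have "\<exists>r>0. controlled \<Omega> (ball q0 R0) (\<Omega> \<inter> ball p r)" if p: "p \<in> closure \<Omega>" for p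
  proof (cases "p \<in> \<Omega>")
    case True
    obtain r where "r > 0" "controlled \<Omega> (ball q0 R0) (ball p r)"
      using controlled_interior[OF op con D True] by auto
    then show ?thesis by (intro exI[of _ r]) (auto intro: controlled_mono)
  next
    case False
    then have pf: "p \<in> frontier \<Omega>" using p op by (simp add: frontier_def interior_open)
    obtain e H K r where c: "lip_chart \<Omega> p e H K r" using lip_chart_exists[OF lip pf] .
    have r: "r > 0" and e: "norm e = 1" and sh: "\<And>x t. H (x + t *\<^sub>R e) = H x - t"
      and \<Omega>: "\<And>x. x \<in> ball p r \<Longrightarrow> x \<in> \<Omega> \<longleftrightarrow> H x < 0"
      using c by (auto simp: lip_chart_def)
    have Hp: "H p = 0" using lip_chart_frontier[OF c op, of p] r pf by simp
    \<comment> \<open>Half of the chart radius is spent on the push along \<open>e\<close>, the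
      other half on \<open>\<rho>'\<close>, so the segments stay in the chart; there
      \<open>H\<close> only decreases, so they stay in \<Omega>.\<close>
    define \<tau> where "\<tau> = r / 2"
    have "p + \<tau> *\<^sub>R e \<in> ball p r" using r e by (simp add: \<tau>_def dist_norm)
    then have "p + \<tau> *\<^sub>R e \<in> \<Omega>" using \<Omega> sh Hp r by (simp add: \<tau>_def)
    then obtain \<rho> where \<rho>: "\<rho> > 0" "ball (p + \<tau> *\<^sub>R e) \<rho> \<subseteq> \<Omega>" "controlled \<Omega> (ball q0 R0) (ball (p + \<tau> *\<^sub>R e) \<rho>)"
      using controlled_interior[OF op con D] by blast
    define \<rho>' where "\<rho>' = min \<rho> (r / 2)"
    have \<rho>': "\<rho>' > 0" "\<rho>' \<le> \<rho>" "\<rho>' \<le> r / 2" using \<rho> r by (auto simp: \<rho>'_def)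
    have "controlled \<Omega> (ball q0 R0) (\<Omega> \<inter> ball p \<rho>')"
    proof (rule controlled_translate[OF op _ _ _ _ \<rho>(3), where w = "\<tau> *\<^sub>R e"])
      fix x assume x: "x \<in> \<Omega> \<inter> ball p \<rho>'"
      then show "x + \<tau> *\<^sub>R e \<in> ball (p + \<tau> *\<^sub>R e) \<rho>" using \<rho>' by (simp add: dist_norm)
      fix s :: real assume s: "0 \<le> s" "s \<le> 1"
      have "H x < 0" using x \<Omega> \<rho>' r by auto
      moreover have "x + (s * \<tau>) *\<^sub>R e \<in> ball p r"
      proof -
        have "dist p (x + (s * \<tau>) *\<^sub>R e) \<le> dist p x + norm ((s * \<tau>) *\<^sub>R e)"
          using dist_triangle[of p "x + (s * \<tau>) *\<^sub>R e" x] by (simp add: dist_norm)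
        also have "norm ((s * \<tau>) *\<^sub>R e) \<le> r / 2" using s e r by (simp add: \<tau>_def abs_mult mult_left_le_one_le)
        finally show ?thesis using x \<rho>' by simp
      qed
      moreover have "0 \<le> s * \<tau>" using s r by (simp add: \<tau>_def)
      ultimately have "x + (s * \<tau>) *\<^sub>R e \<in> \<Omega>" unfolding \<Omega>[OF \<open>x + (s * \<tau>) *\<^sub>R e \<in> ball p r\<close>] sh by linarith
      then show "x + s *\<^sub>R \<tau> *\<^sub>R e \<in> \<Omega>" by simp
    qed (use op \<rho> in auto)
    then show ?thesis using \<rho>' by blast
  qed
  then obtain r where r: "\<And>p. p \<in> closure \<Omega> \<Longrightarrow> r p > 0 \<and> controlled \<Omega> (ball q0 R0) (\<Omega> \<inter> ball p (r p))" by metis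
  have "compact (closure \<Omega>)" using bd by simp
  moreover have "closure \<Omega> \<subseteq> (\<Union>p\<in>closure \<Omega>. ball p (r p))" using r by force
  ultimately obtain T where T: "T \<subseteq> closure \<Omega>" "finite T" "closure \<Omega> \<subseteq> (\<Union>p\<in>T. ball p (r p))"
    using compactE_image[of "closure \<Omega>" "closure \<Omega>" "\<lambda>p. ball p (r p)"] by (metis open_ball)
  have "controlled \<Omega> (ball q0 R0) (\<Union>((\<lambda>p. \<Omega> \<inter> ball p (r p)) ` T))"
    by (rule controlled_Union[OF op]) (use T r op in auto)
  then show ?thesis by (rule controlled_mono) (use T closure_subset in blast)
qed


text \<open>The constant \<open>c\<close> is found by averaging: the double integral of
  \<open>(v x - v y)\<^sup>2\<close> over the ball is bounded by the energy after the substitution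
  \<open>w = x - y\<close>, so for some \<open>y\<close> the inner integral is small and
  \<open>c = v y\<close> works.\<close>

lemma poincare_ball:
  assumes op: "open \<Omega>" and D: "ball q R \<subseteq> \<Omega>" "R > 0"
  shows "\<exists>C::real. C \<ge> 0 \<and> (\<forall>v. C1_on \<Omega> v \<longrightarrow> (\<exists>c.
    sqdev (ball q R) v c \<le> ennreal C * dirichlet \<Omega> v))"
proof -
  define D where "D = ball q R"
  have Ds [measurable]: "D \<in> sets borel" and D\<Omega>: "D \<subseteq> \<Omega>" using D by (auto simp: D_def)
  define d where "d = measure lborel D"
  have dpos: "d > 0" unfolding d_def D_def using D content_ball_pos[of R q] by simp
  have dD: "emeasure lborel D = ennreal d"
    unfolding d_def D_def by (rule emeasure_eq_ennreal_measure) (use emeasure_bounded_finite[of "ball q R"] in simp)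
  \<comment> \<open>The volume of the ball of all differences \<open>w\<close>, times a bound for
    the square of their length.\<close>
  define C where "C = measure lborel (ball (0::real^3) (2 * R)) * (2 * R)\<^sup>2"
  have C0: "C \<ge> 0" by (simp add: C_def)
  have "\<exists>c. sqdev D v c \<le> ennreal (2 * C / d) * dirichlet \<Omega> v"
    if v: "C1_on \<Omega> v" for v
  proof -
    define I where "I y = (\<integral>\<^sup>+x. indicator D x * ennreal ((v x - v y)\<^sup>2) \<partial>lborel)" for y
    have cv: "continuous_on \<Omega> v" using v by (meson continuous_at_imp_continuous_on differentiable_imp_continuous_within)
    have "continuous_on D v" using continuous_on_subset[OF cv D\<Omega>] .
    then have "(\<lambda>x. indicator D x *\<^sub>R v x) \<in> borel_measurable borel"
      by (intro borel_measurable_continuous_on_indicator Ds)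
    then have [measurable]: "(\<lambda>x. indicator D x * v x) \<in> borel_measurable borel" by simp
    \<comment> \<open>With the indicators inside the square, only the globally measurable function
      \<open>indicator D x * v x\<close> occurs.\<close>
    have eq: "(\<lambda>(x, y). indicator D x * indicator D y * ennreal ((v x - v y)\<^sup>2)) =
      (\<lambda>(x, y). indicator D x * indicator D y * ennreal ((indicator D x * v x - indicator D y * v y)\<^sup>2))"
      by (auto simp: indicator_def fun_eq_iff)
    have m: "(\<lambda>(x, y). indicator D x * indicator D y * ennreal ((v x - v y)\<^sup>2)) \<in> borel_measurable (borel \<Otimes>\<^sub>M borel)"
      unfolding eq by measurable
    then have m2: "(\<lambda>(y, w). indicator D (y + w) * indicator D y * ennreal ((v (y + w) - v y)\<^sup>2)) \<in> borel_measurable (borel \<Otimes>\<^sub>M borel)"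
    proof -
      have "(\<lambda>(y, w). (y + w, y)) \<in> measurable (borel \<Otimes>\<^sub>M borel) (borel \<Otimes>\<^sub>M (borel :: (real^3) measure))" by measurable
      from measurable_compose[OF this m] show ?thesis by (simp add: split_beta)
    qed
    have "(\<integral>\<^sup>+y. indicator D y * I y \<partial>lborel) = (\<integral>\<^sup>+y. (\<integral>\<^sup>+x. indicator D x * indicator D y * ennreal ((v x - v y)\<^sup>2) \<partial>lborel) \<partial>lborel)"
      unfolding I_def
      by (intro nn_integral_cong) (auto simp: indicator_def)
    also have "\<dots> = (\<integral>\<^sup>+y. (\<integral>\<^sup>+w. indicator D (w + y) * indicator D y * ennreal ((v (w + y) - v y)\<^sup>2) \<partial>lborel) \<partial>lborel)"
    proof (rule nn_integral_cong)
      fix y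
      have "(\<lambda>x. indicator D x * indicator D y * ennreal ((v x - v y)\<^sup>2)) \<in> borel_measurable borel"
        using measurable_compose[OF _ m, of "\<lambda>x. (x, y)" borel] by simp
      from nn_integral_lborel_translate[OF this, of y]
      show "(\<integral>\<^sup>+x. indicator D x * indicator D y * ennreal ((v x - v y)\<^sup>2) \<partial>lborel)
        = (\<integral>\<^sup>+w. indicator D (w + y) * indicator D y * ennreal ((v (w + y) - v y)\<^sup>2) \<partial>lborel)" by simp
    qed
    also have "\<dots> = (\<integral>\<^sup>+w. (\<integral>\<^sup>+y. indicator D (y + w) * indicator D y * ennreal ((v (y + w) - v y)\<^sup>2) \<partial>lborel) \<partial>lborel)"
      by (subst lborel_pair.Fubini') (use m2 in \<open>auto simp: add.commute\<close>)
    also have "\<dots> \<le> (\<integral>\<^sup>+w. (ennreal ((2 * R)\<^sup>2) * dirichlet \<Omega> v) * indicator (ball (0::real^3) (2 * R)) w \<partial>lborel)"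
    proof (intro nn_integral_mono)
      fix w :: "real^3"
      \<comment> \<open>The starting points of segments with both ends in the ball; there are none
        unless \<open>w\<close> is shorter than the diameter.\<close>
      define A where "A = D \<inter> {y. y + w \<in> D}"
      have A: "A \<in> sets borel" 
        using open_vimage[of D "\<lambda>y. y + w"] unfolding A_def vimage_def by (intro sets.Int Ds) (auto simp: D_def intro!: continuous_intros)
      have "(\<integral>\<^sup>+y. indicator D (y + w) * indicator D y * ennreal ((v (y + w) - v y)\<^sup>2) \<partial>lborel)
        = (\<integral>\<^sup>+y. indicator A y * ennreal ((v (y + w) - v y)\<^sup>2) \<partial>lborel)"
        by (intro nn_integral_cong) (auto simp: A_def indicator_def)
      also have "\<dots> \<le> (ennreal ((2 * R)\<^sup>2) * dirichlet \<Omega> v) * indicator (ball (0::real^3) (2 * R)) w"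
      proof (cases "A = {}")
        case False
        then obtain y where y: "y \<in> D" "y + w \<in> D" by (auto simp: A_def)
        have "norm w \<le> dist q y + dist q (y + w)" using dist_triangle[of y "y + w" q] by (simp add: dist_norm norm_minus_commute)
        then have w: "norm w < 2 * R" using y by (simp add: D_def)
        have "(\<integral>\<^sup>+y. indicator A y * ennreal ((v (y + w) - v y)\<^sup>2) \<partial>lborel) \<le> ennreal ((norm w)\<^sup>2) * dirichlet \<Omega> v"
        proof (rule translate_dirichlet[OF op v A])
          fix x and s :: real assume x: "x \<in> A" and s: "0 \<le> s" "s \<le> 1"
          have "(1 - s) *\<^sub>R x + s *\<^sub>R (x + w) \<in> D"
            using x s convexD_alt[OF convex_ball, of x q R "x + w" s] by (simp add: A_def D_def)
          moreover have "(1 - s) *\<^sub>R x + s *\<^sub>R (x + w) = x + s *\<^sub>R w" by (simp add: algebra_simps)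
          ultimately show "x + s *\<^sub>R w \<in> \<Omega>" using D\<Omega> by auto
        qed
        also have "\<dots> \<le> ennreal ((2 * R)\<^sup>2) * dirichlet \<Omega> v"
          using w by (intro mult_right_mono ennreal_leI power_mono) auto
        finally show ?thesis using w by simp
      qed simp
      finally show "(\<integral>\<^sup>+y. indicator D (y + w) * indicator D y * ennreal ((v (y + w) - v y)\<^sup>2) \<partial>lborel)
        \<le> (ennreal ((2 * R)\<^sup>2) * dirichlet \<Omega> v) * indicator (ball (0::real^3) (2 * R)) w" .
    qed
    also have "\<dots> = (ennreal ((2 * R)\<^sup>2) * dirichlet \<Omega> v) * emeasure lborel (ball (0::real^3) (2 * R))"
      by (rule nn_integral_cmult_indicator) simp
    also have "\<dots> = ennreal C * dirichlet \<Omega> v"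
    proof -
      have "emeasure lborel (ball (0::real^3) (2 * R)) = ennreal (measure lborel (ball (0::real^3) (2 * R)))"
        by (rule emeasure_eq_ennreal_measure) (use emeasure_bounded_finite[of "ball (0::real^3) (2 * R)"] in simp)
      then show ?thesis by (simp add: C_def ennreal_mult mult_ac)
    qed
    finally have le: "(\<integral>\<^sup>+y. indicator D y * I y \<partial>lborel) \<le> ennreal C * dirichlet \<Omega> v" .
    show ?thesis
    proof (rule ccontr)
      assume neg: "\<not> ?thesis"
      \<comment> \<open>The factor 2 spares a discussion of strict inequalities. If every
        \<open>v y\<close> failed, twice \<open>C\<close> times the energy would be at most once the
        same finite quantity, which is therefore 0; then the double integral vanishes although
        \<open>I\<close> is positive everywhere.\<close>
      define K where "K = ennreal (2 * C / d) * dirichlet \<Omega> v"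
      have gt: "I y > K" for y using neg by (auto simp: I_def K_def not_le)
      have Kfin: "K < \<infinity>" using gt[of q] by (auto simp: less_top[symmetric])
      have "K * ennreal d = (\<integral>\<^sup>+y. K * indicator D y \<partial>lborel)" by (simp add: nn_integral_cmult_indicator dD)
      also have "\<dots> \<le> (\<integral>\<^sup>+y. indicator D y * I y \<partial>lborel)"
        by (intro nn_integral_mono) (use gt in \<open>auto simp: indicator_def less_imp_le\<close>)
      also note le
      finally have KC: "K * ennreal d \<le> ennreal C * dirichlet \<Omega> v" .
      have K2: "K * ennreal d = ennreal 2 * (ennreal C * dirichlet \<Omega> v)"
      proof -
        have "ennreal (2 * C / d) * ennreal d = ennreal 2 * ennreal C"
          using dpos C0 by (subst (1 2) ennreal_mult[symmetric]) auto
        moreover have "K * ennreal d = (ennreal (2 * C / d) * ennreal d) * dirichlet \<Omega> v"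
          unfolding K_def by (simp only: mult_ac)
        ultimately show ?thesis by (simp only: mult_ac)
      qed
      with KC have le2: "ennreal 2 * (ennreal C * dirichlet \<Omega> v) \<le> ennreal C * dirichlet \<Omega> v" by simp
      have fin: "ennreal C * dirichlet \<Omega> v < \<infinity>"
      proof -
        have "K * ennreal d < \<infinity>" using Kfin by (simp add: ennreal_mult_less_top)
        then show ?thesis unfolding K2 by (auto simp: ennreal_mult_less_top)
      qed
      then obtain a where a: "ennreal C * dirichlet \<Omega> v = ennreal a" "a \<ge> 0"
        by (cases "ennreal C * dirichlet \<Omega> v") auto
      have "ennreal (2 * a) \<le> ennreal a" using le2 a(2) unfolding a(1) by (subst ennreal_mult) auto
      then have "a = 0" using a(2) by (subst (asm) ennreal_le_iff) auto
      then have z: "(\<integral>\<^sup>+y. indicator D y * I y \<partial>lborel) = 0" using le unfolding a(1) by simp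
      have "(\<lambda>y. indicator D y * I y) \<in> borel_measurable lborel"
      proof -
        have "(\<lambda>y. \<integral>\<^sup>+x. (\<lambda>(y, x). indicator D x * indicator D y * ennreal ((v x - v y)\<^sup>2)) (y, x) \<partial>lborel) \<in> borel_measurable lborel"
        proof (rule lborel.borel_measurable_nn_integral)
          have "(\<lambda>(y, x). indicator D y * indicator D x * ennreal ((v y - v x)\<^sup>2)) = (\<lambda>(y, x). indicator D x * indicator D y * ennreal ((v x - v y)\<^sup>2))"
            by (auto simp: fun_eq_iff power2_commute mult_ac)
          then show "case_prod (\<lambda>y x. (\<lambda>(y, x). indicator D x * indicator D y * ennreal ((v x - v y)\<^sup>2)) (y, x)) \<in> borel_measurable (lborel \<Otimes>\<^sub>M lborel)"
            using m by (simp cong: measurable_cong_sets)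
        qed
        moreover have "(\<lambda>y. \<integral>\<^sup>+x. (\<lambda>(y, x). indicator D x * indicator D y * ennreal ((v x - v y)\<^sup>2)) (y, x) \<partial>lborel) = (\<lambda>y. indicator D y * I y)"
          unfolding I_def by (auto simp: indicator_def fun_eq_iff intro!: nn_integral_cong)
        ultimately show ?thesis by simp
      qed
      then have "AE y in lborel. indicator D y * I y = 0" using z by (simp add: nn_integral_0_iff_AE)
      then have "AE y in lborel. y \<notin> D"
      proof eventually_elim
        case (elim y)
        have "I y \<noteq> 0" using gt[of y] by auto
        then show ?case using elim by (auto simp: indicator_def)
      qed
      then have "emeasure lborel D = 0"
        using AE_iff_measurable[of D lborel "\<lambda>y. y \<notin> D"] by simp
      then show False using dD dpos by simp
    qed
  qed
  then show ?thesis unfolding D_def[symmetric] using C0 dpos by (intro exI[of _ "2 * C / d"]) auto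
qed

text \<open>The passage from the extended Borel integrals of the translation arguments to Bochner
  integrals for Lebesgue measure on \<Omega>.\<close>

lemma nn_integral_lebesgue_on:
  assumes "\<Omega> \<in> sets lebesgue" "integrable (lebesgue_on \<Omega>) f" "\<And>x. f x \<ge> (0::real)"
    "(\<lambda>x. indicator \<Omega> x * ennreal (f x)) \<in> borel_measurable lborel"
  shows "(\<integral>\<^sup>+x. indicator \<Omega> x * ennreal (f x) \<partial>lborel) = ennreal (LINT x|lebesgue_on \<Omega>. f x)"
proof -
  have "ennreal (LINT x|lebesgue_on \<Omega>. f x) = (\<integral>\<^sup>+x. ennreal (f x) \<partial>lebesgue_on \<Omega>)"
    using assms by (intro nn_integral_eq_integral[symmetric]) auto
  also have "\<dots> = (\<integral>\<^sup>+x. indicator \<Omega> x * ennreal (f x) \<partial>lebesgue)"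
    using assms by (subst nn_integral_restrict_space) (auto simp: mult.commute)
  also have "\<dots> = (\<integral>\<^sup>+x. indicator \<Omega> x * ennreal (f x) \<partial>lborel)"
    by (rule nn_integral_completion)
  finally show ?thesis by simp
qed

text \<open>The constant \<open>c\<close> obtained on the ball need not be the mean over \<Omega>;
  for mean-zero \<open>v\<close> this does no harm, since subtracting a constant can only increase
  the square norm.\<close>

theorem poincare:
  assumes dom: "bounded_lipschitz_domain \<Omega>"
  obtains C where "C \<ge> 0" "\<And>v. C1_on \<Omega> v \<Longrightarrow> L2 (lebesgue_on \<Omega>) v \<Longrightarrow> L2 (lebesgue_on \<Omega>) (grad v) \<Longrightarrow>
    (LINT x|lebesgue_on \<Omega>. v x) = 0 \<Longrightarrow>
    (LINT x|lebesgue_on \<Omega>. (v x)\<^sup>2) \<le> C * (LINT x|lebesgue_on \<Omega>. (norm (grad v x))\<^sup>2)"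
proof -
  have op: "open \<Omega>" and bd: "bounded \<Omega>" and ne: "\<Omega> \<noteq> {}"
    using dom by (auto simp: bounded_lipschitz_domain_def)
  have lm: "\<Omega> \<in> lmeasurable" using op bd by (simp add: lmeasurable_open)
  then have fin: "finite_measure (lebesgue_on \<Omega>)" by (rule finite_measure_lebesgue_on)
  obtain q where "q \<in> \<Omega>" using ne by auto
  then obtain R where R: "R > 0" "ball q R \<subseteq> \<Omega>" using op open_contains_ball by blast
  obtain C1 where C1: "C1 \<ge> 0" "\<And>v c. C1_on \<Omega> v \<Longrightarrow>
     sqdev \<Omega> v c \<le>
     ennreal C1 * (dirichlet \<Omega> v + sqdev (ball q R) v c)"
    using controlled_domain[OF dom R(2,1)] unfolding controlled_def by blast
  obtain C2 where C2: "C2 \<ge> 0" "\<And>v. C1_on \<Omega> v \<Longrightarrow> \<exists>c.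
    sqdev (ball q R) v c \<le> ennreal C2 * dirichlet \<Omega> v"
    using poincare_ball[OF op R(2,1)] by blast
  show ?thesis
  proof (rule that[of "C1 * (1 + C2)"])
    show "C1 * (1 + C2) \<ge> 0" using C1 C2 by simp
    fix v assume v: "C1_on \<Omega> v" and Lv: "L2 (lebesgue_on \<Omega>) v" "L2 (lebesgue_on \<Omega>) (grad v)"
      and mean: "(LINT x|lebesgue_on \<Omega>. v x) = 0"
    define E where "E = (LINT x|lebesgue_on \<Omega>. (norm (grad v x))\<^sup>2)"
    have E0: "E \<ge> 0" by (simp add: E_def)
    have "(\<lambda>x. indicator \<Omega> x *\<^sub>R (norm (grad v x))\<^sup>2) \<in> borel_measurable borel"
      by (rule borel_measurable_continuous_on_indicator) (use op v in \<open>auto intro!: continuous_intros\<close>)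
    then have [measurable]: "(\<lambda>x. indicator \<Omega> x * (norm (grad v x))\<^sup>2) \<in> borel_measurable borel" by simp
    have eq: "(\<lambda>x. ennreal (indicator \<Omega> x *\<^sub>R (norm (grad v x))\<^sup>2)) = (\<lambda>x. indicator \<Omega> x * ennreal ((norm (grad v x))\<^sup>2))"
      by (auto simp: indicator_def)
    have m: "(\<lambda>x. indicator \<Omega> x * ennreal ((norm (grad v x))\<^sup>2)) \<in> borel_measurable lborel"
      unfolding eq[symmetric] by simp
    have dE: "dirichlet \<Omega> v = ennreal E"
      unfolding eq E_def
      by (rule nn_integral_lebesgue_on) (use lm L2_integrable[OF Lv(2)] m in auto)
    obtain c where c: "sqdev (ball q R) v c \<le> ennreal C2 * dirichlet \<Omega> v"
      using C2(2)[OF v] by blast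
    have Lc: "L2 (lebesgue_on \<Omega>) (\<lambda>x. v x - c)" by (intro L2_diff Lv L2_const fin)
    have "ennreal (LINT x|lebesgue_on \<Omega>. (v x - c)\<^sup>2) = sqdev \<Omega> v c"
      by (rule nn_integral_lebesgue_on[symmetric])
        (use lm L2_integrable[OF Lc] C1_on_measurable[OF op v, of \<Omega> c] op in auto)
    also have "\<dots> \<le> ennreal C1 * (dirichlet \<Omega> v + ennreal C2 * dirichlet \<Omega> v)"
      by (rule order_trans[OF C1(2)[OF v, of c]]) (intro mult_left_mono add_left_mono c, simp)
    also have "\<dots> = ennreal (C1 * (1 + C2) * E)"
      unfolding dE using C1 C2 E0 by (simp add: algebra_simps flip: ennreal_mult ennreal_plus)
    finally have le: "(LINT x|lebesgue_on \<Omega>. (v x - c)\<^sup>2) \<le> C1 * (1 + C2) * E"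
      using C1 C2 E0 by (subst (asm) ennreal_le_iff) auto
    have "(LINT x|lebesgue_on \<Omega>. (v x - c)\<^sup>2) = (LINT x|lebesgue_on \<Omega>. (v x)\<^sup>2 - 2 * c * v x + c\<^sup>2)"
      by (intro Bochner_Integration.integral_cong) (auto simp: power2_eq_square algebra_simps)
    also have "\<dots> = (LINT x|lebesgue_on \<Omega>. (v x)\<^sup>2) + c\<^sup>2 * measure (lebesgue_on \<Omega>) \<Omega>"
      using L2_integrable[OF Lv(1)] L2_imp_integrable[OF fin Lv(1)] mean finite_measure.integrable_const[OF fin, of "c\<^sup>2"]
      by simp
    finally show "(LINT x|lebesgue_on \<Omega>. (v x)\<^sup>2) \<le> C1 * (1 + C2) * (LINT x|lebesgue_on \<Omega>. (norm (grad v x))\<^sup>2)"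
      using le by (simp add: E_def) (smt (verit) measure_nonneg mult_nonneg_nonneg zero_le_power2)
  qed
qed

section \<open>The weak Neumann problem\<close>

context
  fixes \<Omega> :: "(real^3) set"
  assumes dom: "bounded_lipschitz_domain \<Omega>"
begin

lemma domain_open: "open \<Omega>" and domain_bounded: "bounded \<Omega>"
  using dom by (auto simp: bounded_lipschitz_domain_def)

lemma domain_lmeasurable: "\<Omega> \<in> lmeasurable"
  using domain_open domain_bounded by (simp add: lmeasurable_open)

lemma domain_sets: "\<Omega> \<in> sets lebesgue"
  using domain_lmeasurable by blast

lemma domain_finite_measure: "finite_measure (lebesgue_on \<Omega>)"
  by (rule finite_measure_lebesgue_on[OF domain_lmeasurable])

lemma domain_measure_pos: "measure (lebesgue_on \<Omega>) \<Omega> > 0"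
proof -
  obtain q where "q \<in> \<Omega>" using dom by (auto simp: bounded_lipschitz_domain_def)
  then obtain R where "R > 0" "ball q R \<subseteq> \<Omega>" using domain_open open_contains_ball by blast
  then have "0 < measure lebesgue (ball q R)" "measure lebesgue (ball q R) \<le> measure lebesgue \<Omega>"
    using content_ball_pos[of R q] measure_mono_fmeasurable[OF _ _ domain_lmeasurable, of "ball q R"] by auto
  then have "0 < measure lebesgue \<Omega>" by linarith
  then show ?thesis using domain_sets by (simp add: measure_restrict_space)
qed

lemma set_LINT: "(LINT x:\<Omega>|lebesgue. f x) = (LINT x|lebesgue_on \<Omega>. f x)"
  for f :: "real^3 \<Rightarrow> 'b::euclidean_space"
  using domain_sets by (simp add: set_lebesgue_integral_def integral_restrict_space)

lemma square_integrable_L2: "square_integrable \<Omega> f \<longleftrightarrow> L2 (lebesgue_on \<Omega>) f"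
  using domain_sets by (simp add: square_integrable_def L2_def set_borel_measurable_def set_integrable_def
      borel_measurable_restrict_space_iff integrable_restrict_space)

lemma H1_gradient_iff: "H1_gradient \<Omega> f G \<longleftrightarrow> L2 (lebesgue_on \<Omega>) f \<and> L2 (lebesgue_on \<Omega>) G \<and>
    (\<exists>V. (\<forall>k. C_closure \<infinity> \<Omega> (V k)) \<and>
        (\<lambda>k. LINT x|lebesgue_on \<Omega>. (norm (V k x - f x))\<^sup>2) \<longlonglongrightarrow> 0 \<and>
        (\<lambda>k. LINT x|lebesgue_on \<Omega>. (norm (grad (V k) x - G x))\<^sup>2) \<longlonglongrightarrow> 0)"
  by (simp add: H1_gradient_def square_integrable_L2 set_LINT)

lemma L2_continuous:
  fixes X :: "real^3 \<Rightarrow> 'b::euclidean_space"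
  assumes "continuous_on (closure \<Omega>) X" "\<And>x. x \<in> \<Omega> \<Longrightarrow> X x = f x"
  shows "L2 (lebesgue_on \<Omega>) f"
proof -
  obtain B where B: "\<And>x. x \<in> closure \<Omega> \<Longrightarrow> norm (X x) \<le> B"
    using extends_to_closure_bounded[OF domain_bounded assms(1)] by blast
  have "X \<in> borel_measurable (lebesgue_on \<Omega>)"
    using continuous_on_subset[OF assms(1) closure_subset] domain_sets
    by (rule continuous_imp_measurable_on_sets_lebesgue)
  then have "f \<in> borel_measurable (lebesgue_on \<Omega>)"
    using assms(2) measurable_cong[of "lebesgue_on \<Omega>" X f borel] by auto
  moreover have "AE x in lebesgue_on \<Omega>. norm (f x) \<le> B"
    by (rule AE_I2) (use B assms(2) closure_subset in \<open>auto simp flip: assms(2)\<close>)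
  ultimately show ?thesis by (intro L2_bounded[OF domain_finite_measure])
qed

lemma L2_extends: "extends_to_closure \<Omega> f \<Longrightarrow> L2 (lebesgue_on \<Omega>) f"
  unfolding extends_to_closure_def using L2_continuous by blast

lemma Ck1_facts:
  assumes "Ck_up_to_boundary (Suc 0) \<Omega> v"
  shows "C1_on \<Omega> v" "L2 (lebesgue_on \<Omega>) v" "L2 (lebesgue_on \<Omega>) (grad v)"
proof -
  show "C1_on \<Omega> v" using Ck_1_D[OF domain_open assms] by blast
  show "L2 (lebesgue_on \<Omega>) v" using assms by (intro L2_extends Ck_extends)
  show "L2 (lebesgue_on \<Omega>) (grad v)" using Ck_1_D(5)[OF domain_open assms] L2_continuous by blast
qed

lemmas smooth_facts = Ck1_facts[OF C_closure_Suc0]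

lemma smooth_add: "C_closure \<infinity> \<Omega> v \<Longrightarrow> C_closure \<infinity> \<Omega> w \<Longrightarrow> C_closure \<infinity> \<Omega> (\<lambda>x. v x + c * w x)"
  by (intro C_closure_add C_closure_cmul domain_open)

lemma grad_lincomb:
  assumes "C1_on \<Omega> v" "C1_on \<Omega> w" "x \<in> \<Omega>"
  shows "grad (\<lambda>x. v x + c * w x) x = grad v x + c *\<^sub>R grad w x"
  using assms by (subst grad_add) (auto simp: grad_cmul)

lemma LINT_cong: "(\<And>x. x \<in> \<Omega> \<Longrightarrow> f x = g x) \<Longrightarrow> (LINT x|lebesgue_on \<Omega>. f x) = (LINT x|lebesgue_on \<Omega>. g x)"
  for f g :: "real^3 \<Rightarrow> 'b::euclidean_space"
  by (intro Bochner_Integration.integral_cong) auto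

lemma H1_smooth:
  assumes "C_closure \<infinity> \<Omega> v"
  shows "H1_gradient \<Omega> v (grad v)"
  unfolding H1_gradient_iff using smooth_facts[OF assms] assms by (auto intro!: exI[of _ "\<lambda>k. v"])

lemma weak_neumann_iff: "weak_neumann_solution \<Omega> u \<psi> \<longleftrightarrow> (LINT x|lebesgue_on \<Omega>. \<psi> x) = 0 \<and>
   (\<exists>G. H1_gradient \<Omega> \<psi> G \<and> (\<forall>v H. H1_gradient \<Omega> v H \<longrightarrow>
      (LINT x|lebesgue_on \<Omega>. G x \<bullet> H x) = (LINT x|lebesgue_on \<Omega>. u x * v x)))"
  by (simp add: weak_neumann_solution_def set_LINT)

text \<open>Existence by the direct method: a minimizing sequence of \<open>\<integral> \<bar>\<nabla>v\<bar>\<^sup>2 / 2 - u v\<close> is Cauchy by the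
  parallelogram law and the Poincare inequality.\<close>

lemma weak_neumann_exists:
  assumes u: "continuous_on (closure \<Omega>) u" and mean: "(LINT x|lebesgue_on \<Omega>. u x) = 0"
  shows "\<exists>\<psi>. weak_neumann_solution \<Omega> u \<psi>"
proof -
  let ?M = "lebesgue_on \<Omega>"
  have Lu: "L2 ?M u" by (rule L2_continuous[OF u]) simp
  obtain C where C: "C \<ge> 0" "\<And>v. C1_on \<Omega> v \<Longrightarrow> L2 ?M v \<Longrightarrow> L2 ?M (grad v) \<Longrightarrow> (LINT x|?M. v x) = 0 \<Longrightarrow>
    (LINT x|?M. (v x)\<^sup>2) \<le> C * (LINT x|?M. (norm (grad v x))\<^sup>2)"
    using poincare[OF dom] by blast
  \<comment> \<open>Only functions smooth up to the boundary compete, so the limit of a minimizing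
    sequence satisfies \<open>H1_gradient\<close> by definition.\<close>
  define V0 where "V0 = {v. C_closure \<infinity> \<Omega> v \<and> (LINT x|?M. v x) = 0}"
  define E where "E v = (LINT x|?M. (norm (grad v x))\<^sup>2)" for v
  define D where "D v w = (LINT x|?M. grad v x \<bullet> grad w x)" for v w
  define l where "l v = (LINT x|?M. u x * v x)" for v
  define J where "J v = E v / 2 - l v" for v
  have V0D: "C_closure \<infinity> \<Omega> v" "C1_on \<Omega> v" "L2 ?M v" "L2 ?M (grad v)" "(LINT x|?M. v x) = 0"
    if "v \<in> V0" for v using that smooth_facts by (auto simp: V0_def)
  have V0_add: "(\<lambda>x. v x + c * w x) \<in> V0" if "v \<in> V0" "w \<in> V0" for v w c
    using V0D[OF that(1)] V0D[OF that(2)] unfolding V0_def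
    by (simp add: smooth_add L2_imp_integrable[OF domain_finite_measure])
  have E_add: "E (\<lambda>x. v x + c * w x) = E v + 2 * c * D v w + c\<^sup>2 * E w" if "v \<in> V0" "w \<in> V0" for v w c
  proof -
    have "E (\<lambda>x. v x + c * w x) = (LINT x|?M. (norm (grad v x + c *\<^sub>R grad w x))\<^sup>2)"
      unfolding E_def by (intro LINT_cong) (simp add: grad_lincomb V0D that)
    also have "\<dots> = E v + 2 * c * D v w + c\<^sup>2 * E w"
      unfolding E_def D_def by (intro L2_expand V0D that)
    finally show ?thesis .
  qed
  have l_add: "l (\<lambda>x. v x + c * w x) = l v + c * l w" if "L2 ?M v" "L2 ?M w" for v w c
  proof -
    have "l (\<lambda>x. v x + c * w x) = (LINT x|?M. u x * v x + c * (u x * w x))"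
      unfolding l_def by (simp add: algebra_simps)
    then show ?thesis using L2_mult[OF Lu that(1)] L2_mult[OF Lu that(2)] by (simp add: l_def)
  qed
  have J_add: "J (\<lambda>x. v x + c * w x) = J v + c * (D v w - l w) + c\<^sup>2 / 2 * E w" if "v \<in> V0" "w \<in> V0" for v w c
    unfolding J_def by (simp add: E_add l_add that V0D field_simps)
  have E0: "E v \<ge> 0" for v by (simp add: E_def)
  \<comment> \<open>Cauchy-Schwarz and Poincare give \<open>(l v)\<^sup>2 \<le> A * E v\<close>; the
    inequality of arithmetic and geometric means then absorbs the linear term into
    \<open>E v / 2\<close>.\<close>
  define A where "A = (LINT x|?M. (u x)\<^sup>2) * C"
  have J_ge: "J v \<ge> - A / 2" if "v \<in> V0" for v
  proof -
    have "(l v)\<^sup>2 \<le> (LINT x|?M. (u x)\<^sup>2) * (LINT x|?M. (v x)\<^sup>2)"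
      using L2_Cauchy_Schwarz[OF Lu V0D(3)[OF that]] by (simp add: l_def)
    also have "\<dots> \<le> (LINT x|?M. (u x)\<^sup>2) * (C * E v)"
      unfolding E_def by (intro mult_left_mono C V0D that) auto
    finally have "(l v)\<^sup>2 \<le> A * E v" by (simp add: A_def mult.assoc)
    moreover have "A \<ge> 0" unfolding A_def using C by simp
    ultimately have "\<bar>l v\<bar> \<le> sqrt (A * E v)" by (simp add: real_le_rsqrt)
    also have "\<dots> \<le> (A + E v) / 2" using \<open>A \<ge> 0\<close> E0 by (rule arith_geo_mean_sqrt)
    finally show ?thesis unfolding J_def by (simp add: abs_le_iff field_simps)
  qed
  define I where "I = Inf (J ` V0)"
  have "(\<lambda>x. 0) \<in> V0" by (simp add: V0_def C_closure_const)
  then have ne: "J ` V0 \<noteq> {}" by blast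
  have bb: "bdd_below (J ` V0)" using J_ge by (auto intro!: bdd_belowI[of _ "- A / 2"])
  have I_le: "I \<le> J v" if "v \<in> V0" for v unfolding I_def using bb that by (intro cInf_lower) auto
  have "\<exists>v\<in>V0. J v < I + 1 / real (Suc k)" for k
  proof -
    have "Inf (J ` V0) < I + 1 / real (Suc k)" by (simp add: I_def)
    then show ?thesis using cInf_less_iff[OF ne bb] by auto
  qed
  then obtain V where V: "\<And>k. V k \<in> V0" "\<And>k. J (V k) < I + 1 / real (Suc k)" by metis
  have diff: "(\<lambda>x. v x - w x) \<in> V0" if "v \<in> V0" "w \<in> V0" for v w
    using V0_add[OF that, of "-1"] by simp
  \<comment> \<open>Compare \<open>J\<close> at \<open>V m\<close>, at \<open>V n\<close> and at
    their midpoint: the last value is at least \<open>I\<close> and equals the mean of the other two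
    minus an eighth of the energy of the difference.\<close>
  have par: "E (\<lambda>x. V m x - V n x) \<le> 4 * (1 / real (Suc m) + 1 / real (Suc n))" for m n
  proof -
    let ?d = "\<lambda>x. V m x - V n x"
    have d: "?d \<in> V0" by (intro diff V)
    have "J (V m) = J (\<lambda>x. V n x + 1 * ?d x)" by simp
    then have 1: "J (V m) = J (V n) + (D (V n) ?d - l ?d) + E ?d / 2"
      unfolding J_add[OF V(1)[of n] d] by simp
    have "I \<le> J (\<lambda>x. V n x + (1/2) * ?d x)" by (intro I_le V0_add V d)
    then have "I \<le> J (V n) + (1/2) * (D (V n) ?d - l ?d) + E ?d / 8"
      unfolding J_add[OF V(1)[of n] d] by (simp add: power2_eq_square)
    moreover define a b where "a = 1 / real (Suc m)" "b = 1 / real (Suc n)"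
    ultimately show ?thesis using 1 V(2)[of m] V(2)[of n] unfolding a_b_def[symmetric] by argo
  qed
  have small: "\<exists>N. \<forall>m\<ge>N. \<forall>n\<ge>N. 4 * (1 / real (Suc m) + 1 / real (Suc n)) < e" if e: "e > 0" for e :: real
  proof -
    obtain N where N: "1 / real (Suc N) < e / 8" using e nat_approx_posE[of "e/8"] by auto
    have "1 / real (Suc m) < e / 8" if "m \<ge> N" for m
    proof -
      have "1 / real (Suc m) \<le> 1 / real (Suc N)" using that by (simp add: frac_le)
      then show ?thesis using N by linarith
    qed
    then have "4 * (1 / real (Suc m) + 1 / real (Suc n)) < 4 * (e / 8 + e / 8)" if "m \<ge> N" "n \<ge> N" for m n
      using that by (intro mult_strict_left_mono add_strict_mono) auto
    then show ?thesis by (intro exI[of _ N]) auto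
  qed
  obtain G where G: "L2 ?M G" "(\<lambda>k. LINT x|?M. (norm (grad (V k) x - G x))\<^sup>2) \<longlonglongrightarrow> 0"
  proof (rule L2_complete[of ?M "\<lambda>k. grad (V k)"])
    show "L2 ?M (grad (V k))" for k by (intro V0D V)
    fix e :: real assume "e > 0"
    from small[OF this] obtain N where N: "\<And>m n. m \<ge> N \<Longrightarrow> n \<ge> N \<Longrightarrow> 4 * (1 / real (Suc m) + 1 / real (Suc n)) < e" by blast
    have E: "(LINT x|?M. (norm (grad (V m) x - grad (V n) x))\<^sup>2) = E (\<lambda>x. V m x - V n x)" for m n
      unfolding E_def using grad_lincomb[OF V0D(2)[OF V(1)[of m]] V0D(2)[OF V(1)[of n]], of _ "-1"]
      by (intro LINT_cong) simp
    have "E (\<lambda>x. V m x - V n x) < e" if "m \<ge> N" "n \<ge> N" for m n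
      using par[of m n] N[OF that] by (rule le_less_trans)
    then show "\<exists>N. \<forall>m\<ge>N. \<forall>n\<ge>N. (LINT x|?M. (norm (grad (V m) x - grad (V n) x))\<^sup>2) < e"
      unfolding E by blast
  qed
  obtain \<psi> where \<psi>: "L2 ?M \<psi>" "(\<lambda>k. LINT x|?M. (norm (V k x - \<psi> x))\<^sup>2) \<longlonglongrightarrow> 0"
  proof (rule L2_complete[of ?M V])
    show "L2 ?M (V k)" for k by (intro V0D V)
    fix e :: real assume "e > 0"
    \<comment> \<open>\<open>C\<close> may be 0, hence \<open>C + 1\<close>.\<close>
    then have "e / (C + 1) > 0" using C by simp
    from small[OF this] obtain N where N: "\<And>m n. m \<ge> N \<Longrightarrow> n \<ge> N \<Longrightarrow> 4 * (1 / real (Suc m) + 1 / real (Suc n)) < e / (C + 1)" by blast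
    have "(LINT x|?M. (norm (V m x - V n x))\<^sup>2) < e" if "m \<ge> N" "n \<ge> N" for m n
    proof -
      have d: "(\<lambda>x. V m x - V n x) \<in> V0" by (intro diff V)
      have "(LINT x|?M. (norm (V m x - V n x))\<^sup>2) \<le> C * E (\<lambda>x. V m x - V n x)"
        using C(2)[OF V0D(2-5)[OF d]] by (simp add: E_def)
      also have "\<dots> \<le> (C + 1) * E (\<lambda>x. V m x - V n x)" using E0 by (intro mult_right_mono) auto
      also have "\<dots> < (C + 1) * (e / (C + 1))"
        using par[of m n] N[OF that] C by (intro mult_strict_left_mono) auto
      also have "\<dots> = e" using C by simp
      finally show ?thesis .
    qed
    then show "\<exists>N. \<forall>m\<ge>N. \<forall>n\<ge>N. (LINT x|?M. (norm (V m x - V n x))\<^sup>2) < e" by blast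
  qed
  have H1: "H1_gradient \<Omega> \<psi> G"
    unfolding H1_gradient_iff using \<psi> G V V0D by (intro conjI exI[of _ V]) auto
  have psi0: "(LINT x|?M. \<psi> x) = 0"
  proof -
    have "(\<lambda>k. LINT x|?M. V k x \<bullet> 1) \<longlonglongrightarrow> (LINT x|?M. \<psi> x \<bullet> 1)"
      by (rule L2_tendsto_inner) (use \<psi> V V0D L2_const[OF domain_finite_measure] in auto)
    then have "(\<lambda>k. 0::real) \<longlonglongrightarrow> (LINT x|?M. \<psi> x)" using V0D(5)[OF V(1)] by simp
    then show ?thesis using LIMSEQ_unique tendsto_const by blast
  qed
  have EL0: "(LINT x|?M. G x \<bullet> grad v x) = l v" if v: "v \<in> V0" for v
  proof -
    define c where "c = (LINT x|?M. G x \<bullet> grad v x) - l v"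
    have Dl: "(\<lambda>k. D (V k) v) \<longlonglongrightarrow> (LINT x|?M. G x \<bullet> grad v x)"
      unfolding D_def by (rule L2_tendsto_inner) (use G V V0D v in auto)
    \<comment> \<open>No minimizer in \<open>V0\<close> is at hand, so the first-order condition is
      taken from almost minimizers: \<open>J\<close> at \<open>V k + t v\<close> is at least
      \<open>I\<close>, while \<open>J (V k)\<close> is below \<open>I + 1 / (k + 1)\<close>, and
      this error vanishes in the limit.\<close>
    have q: "0 \<le> t * c + t\<^sup>2 / 2 * E v" for t
    proof (rule LIMSEQ_le[OF tendsto_const])
      show "(\<lambda>k. 1 / real (Suc k) + t * (D (V k) v - l v) + t\<^sup>2 / 2 * E v) \<longlonglongrightarrow> t * c + t\<^sup>2 / 2 * E v"
        unfolding c_def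
        using tendsto_add[OF tendsto_add[OF LIMSEQ_Suc[OF lim_1_over_n[where 'a = real]]
            tendsto_mult[OF tendsto_const tendsto_diff[OF Dl tendsto_const]]] tendsto_const]
        by (simp del: of_nat_Suc)
      have "0 \<le> 1 / real (Suc k) + t * (D (V k) v - l v) + t\<^sup>2 / 2 * E v" for k
        using I_le[OF V0_add[OF V(1)[of k] v, of t]] V(2)[of k] unfolding J_add[OF V(1)[of k] v] by linarith
      then show "\<exists>N. \<forall>n\<ge>N. 0 \<le> 1 / real (Suc n) + t * (D (V n) v - l v) + t\<^sup>2 / 2 * E v" by blast
    qed
    have "c = 0"
    proof (rule ccontr)
      assume c: "c \<noteq> 0"
      \<comment> \<open>Makes the quadratic expression negative; 1 is added because
        \<open>E v\<close> may be 0.\<close>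
      define t where "t = - c / (E v + 1)"
      have "t * c + t\<^sup>2 / 2 * E v = - c\<^sup>2 * (E v + 2) / (2 * (E v + 1)\<^sup>2)"
        using E0[of v] by (simp add: t_def divide_simps power2_eq_square) (simp add: algebra_simps)
      also have "\<dots> < 0" using c E0[of v] by (intro divide_neg_pos) (auto simp: mult_neg_pos)
      finally show False using q[of t] by simp
    qed
    then show ?thesis by (simp add: c_def)
  qed
  have EL: "(LINT x|?M. G x \<bullet> grad v x) = l v" if v: "C_closure \<infinity> \<Omega> v" for v
  proof -
    \<comment> \<open>Subtracting the mean leads back to \<open>V0\<close>. Neither side sees the
      constant, the right side because \<open>u\<close> has mean zero: this is the solvability
      condition of the Neumann problem.\<close>
    define a where "a = (LINT x|?M. v x) / measure ?M \<Omega>"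
    have Lv: "L2 ?M v" using smooth_facts[OF v] by simp
    note mpos = domain_measure_pos
    let ?w = "\<lambda>x. v x + (- a) * 1"
    have "?w \<in> V0"
      unfolding V0_def
    proof (intro CollectI conjI)
      show "C_closure \<infinity> \<Omega> ?w" by (rule smooth_add[OF v C_closure_const])
      show "(LINT x|?M. ?w x) = 0"
        using mpos L2_imp_integrable[OF domain_finite_measure Lv] finite_measure.integrable_const[OF domain_finite_measure, of a]
        by (simp add: a_def)
    qed
    from EL0[OF this] have "(LINT x|?M. G x \<bullet> grad ?w x) = l ?w" .
    moreover have "(LINT x|?M. G x \<bullet> grad ?w x) = (LINT x|?M. G x \<bullet> grad v x)"
      using grad_lincomb[OF smooth_facts(1)[OF v] smooth_facts(1)[OF C_closure_const], of _ "- a" 1]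
      by (intro LINT_cong) simp
    moreover have "l ?w = l v + (- a) * l (\<lambda>x. 1)" by (rule l_add[OF Lv L2_const[OF domain_finite_measure]])
    ultimately show ?thesis using mean by (simp add: l_def)
  qed
  \<comment> \<open>Both sides are continuous along the smooth sequence that defines the weak
    gradient \<open>H\<close>.\<close>
  have "(LINT x|?M. G x \<bullet> H x) = (LINT x|?M. u x * v x)" if vH: "H1_gradient \<Omega> v H" for v H
  proof -
    obtain W where L: "L2 ?M v" "L2 ?M H"
      and W: "\<And>k. C_closure \<infinity> \<Omega> (W k)" "(\<lambda>k. LINT x|?M. (norm (W k x - v x))\<^sup>2) \<longlonglongrightarrow> 0"
        "(\<lambda>k. LINT x|?M. (norm (grad (W k) x - H x))\<^sup>2) \<longlonglongrightarrow> 0"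
      using vH unfolding H1_gradient_iff by blast
    have "(\<lambda>k. LINT x|?M. grad (W k) x \<bullet> G x) \<longlonglongrightarrow> (LINT x|?M. H x \<bullet> G x)"
      by (rule L2_tendsto_inner) (use L W G smooth_facts in auto)
    moreover have "(\<lambda>k. LINT x|?M. W k x \<bullet> u x) \<longlonglongrightarrow> (LINT x|?M. v x \<bullet> u x)"
      by (rule L2_tendsto_inner) (use L W Lu smooth_facts in auto)
    moreover have "(LINT x|?M. grad (W k) x \<bullet> G x) = (LINT x|?M. W k x \<bullet> u x)" for k
      using EL[OF W(1)[of k]] by (simp add: l_def inner_commute mult.commute)
    ultimately have "(LINT x|?M. H x \<bullet> G x) = (LINT x|?M. v x \<bullet> u x)"
      using LIMSEQ_unique by fastforce
    then show ?thesis by (simp add: inner_commute mult.commute)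
  qed
  with H1 psi0 show ?thesis unfolding weak_neumann_iff by blast
qed

lemma inv_neumann_laplacian_works:
  assumes "continuous_on (closure \<Omega>) u" "mean_zero \<Omega> u"
  shows "weak_neumann_solution \<Omega> u (inv_neumann_laplacian \<Omega> u)"
proof -
  have "\<exists>\<psi>. weak_neumann_solution \<Omega> u \<psi>"
    using weak_neumann_exists[OF assms(1)] assms(2) by (simp add: mean_zero_def set_LINT)
  then show ?thesis unfolding inv_neumann_laplacian_def by (rule someI_ex)
qed

text \<open>Testing the equation of \<open>u + t v\<close> with the solutions for \<open>u\<close> and \<open>v\<close> and vice versa avoids
  the uniqueness of weak solutions.\<close>

lemma dissipation_expand:
  assumes u: "L2 (lebesgue_on \<Omega>) u" "weak_neumann_solution \<Omega> u \<psi>"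
    and v: "L2 (lebesgue_on \<Omega>) v" "weak_neumann_solution \<Omega> v \<eta>"
    and w: "weak_neumann_solution \<Omega> (\<lambda>x. u x + t * v x) \<omega>"
  shows "(LINT x|lebesgue_on \<Omega>. (u x + t * v x) * \<omega> x) =
    (LINT x|lebesgue_on \<Omega>. u x * \<psi> x) + 2 * t * (LINT x|lebesgue_on \<Omega>. \<psi> x * v x)
      + t\<^sup>2 * (LINT x|lebesgue_on \<Omega>. v x * \<eta> x)"
proof -
  let ?M = "lebesgue_on \<Omega>"
  obtain Gu where Gu: "H1_gradient \<Omega> \<psi> Gu" "\<And>v H. H1_gradient \<Omega> v H \<Longrightarrow> (LINT x|?M. Gu x \<bullet> H x) = (LINT x|?M. u x * v x)"
    using u unfolding weak_neumann_iff by blast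
  obtain Gv where Gv: "H1_gradient \<Omega> \<eta> Gv" "\<And>w H. H1_gradient \<Omega> w H \<Longrightarrow> (LINT x|?M. Gv x \<bullet> H x) = (LINT x|?M. v x * w x)"
    using v unfolding weak_neumann_iff by blast
  obtain Gw where Gw: "H1_gradient \<Omega> \<omega> Gw" "\<And>w H. H1_gradient \<Omega> w H \<Longrightarrow> (LINT x|?M. Gw x \<bullet> H x) = (LINT x|?M. (u x + t * v x) * w x)"
    using w unfolding weak_neumann_iff by blast
  have L: "L2 ?M \<psi>" "L2 ?M \<eta>" "L2 ?M \<omega>" "L2 ?M Gu" "L2 ?M Gv" "L2 ?M Gw"
    using Gu(1) Gv(1) Gw(1) unfolding H1_gradient_iff by auto
  note I = L2_mult[OF u(1)] L2_mult[OF v(1)]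
  have split: "(LINT x|?M. (u x + t * v x) * g x) = (LINT x|?M. u x * g x) + t * (LINT x|?M. v x * g x)"
    if "L2 ?M g" for g
    using I[OF that] by (simp add: algebra_simps)
  have "(LINT x|?M. (u x + t * v x) * \<omega> x) = (LINT x|?M. Gu x \<bullet> Gw x) + t * (LINT x|?M. Gv x \<bullet> Gw x)"
    unfolding split[OF L(3)] Gu(2)[OF Gw(1)] Gv(2)[OF Gw(1)] ..
  also have "\<dots> = (LINT x|?M. (u x + t * v x) * \<psi> x) + t * (LINT x|?M. (u x + t * v x) * \<eta> x)"
    using Gw(2)[OF Gu(1)] Gw(2)[OF Gv(1)] by (simp add: inner_commute)
  also have "\<dots> = (LINT x|?M. u x * \<psi> x) + t * (LINT x|?M. v x * \<psi> x) + t * (LINT x|?M. u x * \<eta> x) + t\<^sup>2 * (LINT x|?M. v x * \<eta> x)"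
    unfolding split[OF L(1)] split[OF L(2)] by (simp add: algebra_simps power2_eq_square)
  \<comment> \<open>Symmetry of the inverse Neumann Laplacian: both integrals equal that of the
    product of the two weak gradients. It merges the mixed terms into one with the factor 2.\<close>
  also have "(LINT x|?M. u x * \<eta> x) = (LINT x|?M. v x * \<psi> x)"
    using Gu(2)[OF Gv(1)] Gv(2)[OF Gu(1)] by (simp add: inner_commute)
  finally show ?thesis by (simp add: mult.commute)
qed

end

section \<open>Polynomials as test functions\<close>

lemma LINT_uniform_approx:
  assumes h: "integrable M h" and f: "f \<in> borel_measurable M" "g \<in> borel_measurable M"
    and bd: "\<And>x. x \<in> space M \<Longrightarrow> \<bar>f x\<bar> \<le> B" and e: "\<And>x. x \<in> space M \<Longrightarrow> \<bar>f x - g x\<bar> \<le> e"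
  shows "integrable M (\<lambda>x. h x * f x)" "integrable M (\<lambda>x. h x * g x)"
    "\<bar>(LINT x|M. h x * f x) - (LINT x|M. h x * g x)\<bar> \<le> e * (LINT x|M. \<bar>h x :: real\<bar>)"
proof -
  have [measurable]: "h \<in> borel_measurable M" using h by blast
  note [measurable] = f
  show 1: "integrable M (\<lambda>x. h x * f x)"
  proof (rule Bochner_Integration.integrable_bound[of M "\<lambda>x. B * h x"])
    show "AE x in M. norm (h x * f x) \<le> norm (B * h x)"
    proof (rule AE_I2)
      fix x assume x: "x \<in> space M"
      have "\<bar>h x\<bar> * \<bar>f x\<bar> \<le> \<bar>h x\<bar> * \<bar>B\<bar>" using bd[OF x] by (intro mult_left_mono) auto
      then show "norm (h x * f x) \<le> norm (B * h x)" by (simp add: abs_mult mult.commute)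
    qed
  qed (use h in auto)
  have dle: "\<bar>h x * (f x - g x)\<bar> \<le> e * \<bar>h x\<bar>" if "x \<in> space M" for x
    using mult_left_mono[OF e[OF that], of "\<bar>h x\<bar>"] by (simp add: abs_mult mult.commute)
  have d: "integrable M (\<lambda>x. h x * (f x - g x))"
  proof (rule Bochner_Integration.integrable_bound[of M "\<lambda>x. e * h x"])
    show "AE x in M. norm (h x * (f x - g x)) \<le> norm (e * h x)"
    proof (rule AE_I2)
      fix x assume x: "x \<in> space M"
      have "e * \<bar>h x\<bar> \<le> \<bar>e\<bar> * \<bar>h x\<bar>" by (intro mult_right_mono) auto
      with dle[OF x] show "norm (h x * (f x - g x)) \<le> norm (e * h x)" by (simp add: abs_mult)
    qed
  qed (use h in auto)
  show 2: "integrable M (\<lambda>x. h x * g x)"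
    using Bochner_Integration.integrable_diff[OF 1 d] by (simp add: algebra_simps)
  have "(LINT x|M. h x * f x) - (LINT x|M. h x * g x) = (LINT x|M. h x * (f x - g x))"
    using 1 2 by (simp add: algebra_simps)
  also have "\<bar>\<dots>\<bar> \<le> (LINT x|M. \<bar>h x * (f x - g x)\<bar>)" by (rule integral_abs_bound)
  also have "\<dots> \<le> (LINT x|M. e * \<bar>h x\<bar>)"
    using d h dle by (intro integral_mono) auto
  finally show "\<bar>(LINT x|M. h x * f x) - (LINT x|M. h x * g x)\<bar> \<le> e * (LINT x|M. \<bar>h x\<bar>)" by simp
qed

lemma continuous_on_real_polynomial: "real_polynomial_function P \<Longrightarrow> continuous_on S P"
  by (simp add: continuous_on_polymonial_function real_polynomial_function_eq)

text \<open>Polynomials approximate \<open>c\<close> uniformly on the compact closure of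
  \<open>S\<close>, and integrability of \<open>h\<close> turns the uniform error into a small error
  of the integral.\<close>

lemma orthogonal_polynomials_imp_continuous:
  fixes h :: "'a::euclidean_space \<Rightarrow> real"
  assumes S: "S \<in> sets lebesgue" "bounded S" and h: "integrable (lebesgue_on S) h"
    and P: "\<And>P. real_polynomial_function P \<Longrightarrow> (LINT x|lebesgue_on S. h x * P x) = 0"
    and c: "continuous_on (closure S) c"
  shows "(LINT x|lebesgue_on S. h x * c x) = 0"
proof -
  let ?M = "lebesgue_on S"
  define I where "I = (LINT x|?M. \<bar>h x\<bar>)"
  have I0: "I \<ge> 0" unfolding I_def by simp
  have co: "compact (closure S)" using S by simp
  then have "bounded (c ` closure S)" using c compact_continuous_image compact_imp_bounded by blast
  then obtain B where B: "\<And>x. x \<in> closure S \<Longrightarrow> \<bar>c x\<bar> \<le> B" by (auto simp: bounded_iff)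
  have cm: "c \<in> borel_measurable ?M"
    using continuous_on_subset[OF c closure_subset] S(1) by (rule continuous_imp_measurable_on_sets_lebesgue)
  have "\<bar>LINT x|?M. h x * c x\<bar> \<le> e * (I + 1)" if e: "e > 0" for e
  proof -
    obtain P where P': "real_polynomial_function P" "\<And>x. x \<in> closure S \<Longrightarrow> \<bar>c x - P x\<bar> < e"
      using Stone_Weierstrass_real_polynomial_function[OF co c e] by blast
    have "P \<in> borel_measurable ?M"
      using continuous_on_real_polynomial[OF P'(1)] S(1) by (rule continuous_imp_measurable_on_sets_lebesgue)
    then have "\<bar>(LINT x|?M. h x * c x) - (LINT x|?M. h x * P x)\<bar> \<le> e * I"
      unfolding I_def
      by (intro LINT_uniform_approx(3)[OF h cm, of P B e]) (use B P' closure_subset in \<open>force intro: less_imp_le\<close>)+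
    then show ?thesis using P[OF P'(1)] e I0 by (simp add: algebra_simps)
  qed
  note le = this
  show ?thesis
  proof (rule ccontr)
    assume "(LINT x|?M. h x * c x) \<noteq> 0"
    then have d: "\<bar>LINT x|?M. h x * c x\<bar> > 0" by simp
    have "\<bar>LINT x|?M. h x * c x\<bar> \<le> \<bar>LINT x|?M. h x * c x\<bar> / (2 * (I + 1)) * (I + 1)"
      using d I0 by (intro le) simp
    also have "\<dots> = \<bar>LINT x|?M. h x * c x\<bar> / 2" using I0 by (simp add: field_simps)
    finally show False using d by linarith
  qed
qed

text \<open>The fundamental lemma of the calculus of variations with polynomials as the only test
  functions: continuous functions decrease to the indicator of a box, so the integrals of
  \<open>h\<close> over boxes vanish, and Lebesgue differentiation concludes.\<close>

lemma orthogonal_polynomials_imp_zero: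
  fixes h :: "'a::euclidean_space \<Rightarrow> real"
  assumes S: "S \<in> sets lebesgue" "bounded S" and h: "integrable (lebesgue_on S) h"
    and P: "\<And>P. real_polynomial_function P \<Longrightarrow> (LINT x|lebesgue_on S. h x * P x) = 0"
  shows "AE x in lebesgue_on S. h x = 0"
proof -
  let ?M = "lebesgue_on S"
  have [measurable]: "h \<in> borel_measurable ?M" using h by blast
  define f where "f x = (if x \<in> S then h x else 0)" for x
  have aint: "f absolutely_integrable_on UNIV"
    using h S unfolding f_def absolutely_integrable_restrict_UNIV
    by (simp add: set_integrable_def integrable_restrict_space)
  then have aintA: "f absolutely_integrable_on cbox a b" for a b
    by (rule set_integrable_subset) auto
  have box0: "integral (cbox a b) f = 0" for a b
  proof (cases "cbox a b = {}")
    case False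
    let ?K = "cbox a b"
    \<comment> \<open>Equal to 1 on the box and to 0 from distance \<open>1 / n\<close> on.\<close>
    define c where "c n x = max 0 (1 - real n * infdist x ?K)" for n x
    have cc: "continuous_on A (c n)" for A n unfolding c_def by (intro continuous_intros)
    have "(\<lambda>n. LINT x|?M. h x * c n x) \<longlonglongrightarrow> (LINT x|?M. h x * indicator ?K x)"
    proof (rule integral_dominated_convergence[where w = "\<lambda>x. \<bar>h x\<bar>"])
      show "(\<lambda>x. h x * indicator ?K x) \<in> borel_measurable ?M"
      proof -
        have "indicator ?K \<in> borel_measurable ?M"
          by (intro measurable_restrict_space1 borel_measurable_indicator) auto
        then show ?thesis by (intro borel_measurable_times) auto
      qed
      have "c n \<in> borel_measurable ?M" for n
        using cc S(1) by (rule continuous_imp_measurable_on_sets_lebesgue)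
      then show "(\<lambda>x. h x * c n x) \<in> borel_measurable ?M" for n by measurable
      show "AE x in ?M. (\<lambda>n. h x * c n x) \<longlonglongrightarrow> h x * indicator ?K x"
      proof (rule AE_I2)
        fix x
        have "(\<lambda>n. c n x) \<longlonglongrightarrow> indicator ?K x"
        proof (cases "x \<in> ?K")
          case True
          then show ?thesis by (simp add: c_def)
        next
          case F: False
          then have pos: "infdist x ?K > 0"
            using \<open>?K \<noteq> {}\<close> infdist_pos_not_in_closed[of ?K x] by auto
          then obtain N where N: "real N * infdist x ?K > 1" using reals_Archimedean3 by blast
          have "c n x = 0" if "n \<ge> N" for n
          proof -
            have "real N * infdist x ?K \<le> real n * infdist x ?K" using that pos by (intro mult_right_mono) auto
            then show ?thesis using N by (simp add: c_def)
          qed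
          then have "(\<lambda>n. c n x) \<longlonglongrightarrow> 0" by (intro tendsto_eventually) (auto simp: eventually_sequentially)
          then show ?thesis using F by simp
        qed
        then show "(\<lambda>n. h x * c n x) \<longlonglongrightarrow> h x * indicator ?K x" by (intro tendsto_intros)
      qed
      have "0 \<le> c n x" "c n x \<le> 1" for n x by (auto simp: c_def infdist_nonneg)
      then show "AE x in ?M. norm (h x * c n x) \<le> \<bar>h x\<bar>" for n
        by (auto simp: abs_mult intro!: AE_I2 mult_left_le)
    qed (use h in auto)
    then have "(LINT x|?M. h x * indicator ?K x) = 0"
      using orthogonal_polynomials_imp_continuous[OF S h P cc] by (simp add: LIMSEQ_const_iff)
    moreover have "integral ?K f = (LINT x:?K|lebesgue. f x)"
      using set_lebesgue_integral_eq_integral(2)[OF aintA] by simp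
    moreover have "(LINT x:?K|lebesgue. f x) = (LINT x|?M. h x * indicator ?K x)"
      unfolding set_lebesgue_integral_def using S
      by (subst integral_restrict_space) (auto simp: f_def indicator_def intro!: Bochner_Integration.integral_cong)
    ultimately show ?thesis by simp
  qed simp
  \<comment> \<open>Differentiation along cubes with lower corner \<open>x\<close>; all these
    averages are 0 by \<open>box0\<close>.\<close>
  obtain N where N: "negligible N" "\<And>x e. x \<notin> N \<Longrightarrow> 0 < e \<Longrightarrow> \<exists>d>0. \<forall>k. 0 < k \<and> k < d \<longrightarrow>
      norm (integral (cbox x (x + k *\<^sub>R One)) f /\<^sub>R k ^ DIM('a) - f x) < e"
    using integrable_ccontinuous_explicit[of f] set_lebesgue_integral_eq_integral(1)[OF aintA] by metis
  have "f x = 0" if xN: "x \<notin> N" for x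
  proof (rule ccontr)
    assume "f x \<noteq> 0"
    then have "\<bar>f x\<bar> > 0" by simp
    from N(2)[OF xN this] obtain d where d: "d > 0"
      "\<forall>k. 0 < k \<and> k < d \<longrightarrow> norm (integral (cbox x (x + k *\<^sub>R One)) f /\<^sub>R k ^ DIM('a) - f x) < \<bar>f x\<bar>" by blast
    show False using d(1) d(2)[rule_format, of "d / 2"] unfolding box0 by simp
  qed
  moreover have "N \<in> null_sets lebesgue" using N negligible_iff_null_sets by blast
  ultimately have "AE x in lebesgue. f x = 0" by (intro AE_I'[of N]) auto
  then show ?thesis using S by (simp add: AE_restrict_space_iff f_def)
    (auto elim!: eventually_mono)
qed

section \<open>Radial bump functions\<close>

text \<open>The square of the positive part is continuously differentiable across the sphere, and it
  depends on \<open>x\<close> only through \<open>(norm (x - p))\<^sup>2\<close>, so polynomials in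
  this one variable suffice to approximate it.\<close>

definition bump :: "real^3 \<Rightarrow> real \<Rightarrow> real^3 \<Rightarrow> real" where
  "bump p \<epsilon> x = (max 0 (1 - (norm (x - p))\<^sup>2 / \<epsilon>\<^sup>2))\<^sup>2"

lemma has_real_derivative_max_sq: "((\<lambda>s. (max 0 s)\<^sup>2) has_real_derivative 2 * max 0 s) (at (s::real))"
proof -
  consider "s > 0" | "s < 0" | "s = 0" by linarith
  then show ?thesis
  proof cases
    case 1
    have "((\<lambda>s. s\<^sup>2) has_real_derivative 2 * s) (at s)" by (auto intro!: derivative_eq_intros)
    then have "((\<lambda>s. (max 0 s)\<^sup>2) has_real_derivative 2 * s) (at s)"
      by (rule has_field_derivative_transform_within_open[of _ _ _ "{0<..}"]) (use 1 in auto)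
    then show ?thesis using 1 by simp
  next
    case 2
    have "((\<lambda>s::real. 0::real) has_real_derivative 0) (at s)" by simp
    then have "((\<lambda>s. (max 0 s)\<^sup>2) has_real_derivative 0) (at s)"
      by (rule has_field_derivative_transform_within_open[of _ _ _ "{..<0}"]) (use 2 in auto)
    then show ?thesis using 2 by simp
  next
    case 3
    have "((\<lambda>h. ((max 0 (0 + h))\<^sup>2 - (max 0 0)\<^sup>2) / h) \<longlongrightarrow> 0) (at (0::real))"
    proof (rule Lim_null_comparison[where g = "\<lambda>h. \<bar>h\<bar>"])
      show "\<forall>\<^sub>F h::real in at 0. norm (((max 0 (0 + h))\<^sup>2 - (max 0 0)\<^sup>2) / h) \<le> \<bar>h\<bar>"
        by (rule always_eventually) (auto simp: max_def power2_eq_square)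
      show "((\<lambda>h. \<bar>h\<bar>) \<longlongrightarrow> 0) (at (0::real))" by (intro tendsto_eq_intros) auto
    qed
    then show ?thesis using 3 by (simp add: DERIV_def)
  qed
qed

lemma affine_derivative: "((\<lambda>s. 1 - s / a) has_real_derivative - 1 / a) (at (s::real))"
  by (rule DERIV_cong, rule DERIV_diff[OF DERIV_const DERIV_cdivide[OF DERIV_ident]]) simp

lemma radial_derivative:
  assumes "(b has_real_derivative b') (at ((norm (x - p))\<^sup>2))"
  shows "((\<lambda>x. b ((norm (x - p))\<^sup>2)) has_derivative (\<lambda>h. ((2 * b') *\<^sub>R (x - p)) \<bullet> h)) (at (x::real^3))"
proof -
  have "((\<lambda>x. (norm (x - p))\<^sup>2) has_derivative (\<lambda>h. 2 * ((x - p) \<bullet> h))) (at x)"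
    unfolding power2_norm_eq_inner by (auto intro!: derivative_eq_intros simp: inner_commute)
  from has_derivative_compose[OF this assms[THEN has_field_derivative_imp_has_derivative]]
  show ?thesis by (simp add: mult_ac)
qed

lemma bump_derivative:
  "((bump p \<epsilon>) has_derivative (\<lambda>h. ((- 4 / \<epsilon>\<^sup>2 * max 0 (1 - (norm (x - p))\<^sup>2 / \<epsilon>\<^sup>2)) *\<^sub>R (x - p)) \<bullet> h)) (at x)"
proof -
  have "((\<lambda>s. (max 0 (1 - s / \<epsilon>\<^sup>2))\<^sup>2) has_real_derivative (2 * max 0 (1 - (norm (x - p))\<^sup>2 / \<epsilon>\<^sup>2)) * (- 1 / \<epsilon>\<^sup>2))
    (at ((norm (x - p))\<^sup>2))"
    by (rule DERIV_chain2[OF has_real_derivative_max_sq affine_derivative])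
  from radial_derivative[OF this] show ?thesis by (simp add: bump_def[abs_def])
qed

lemma bump_differentiable [simp]: "bump p \<epsilon> differentiable at x"
  using bump_derivative by (auto simp: differentiable_def)

lemma grad_bump: "grad (bump p \<epsilon>) x = (- 4 / \<epsilon>\<^sup>2 * max 0 (1 - (norm (x - p))\<^sup>2 / \<epsilon>\<^sup>2)) *\<^sub>R (x - p)"
  by (rule grad_eq[OF bump_derivative])

lemma continuous_bump: "continuous_on S (bump p \<epsilon>)" "continuous_on S (grad (bump p \<epsilon>))"
proof -
  show "continuous_on S (bump p \<epsilon>)"
    unfolding bump_def[abs_def] divide_inverse by (intro continuous_intros)
  have *: "grad (bump p \<epsilon>) = (\<lambda>x. (- 4 / \<epsilon>\<^sup>2 * max 0 (1 - (norm (x - p))\<^sup>2 * inverse (\<epsilon>\<^sup>2))) *\<^sub>R (x - p))"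
    by (simp add: fun_eq_iff grad_bump divide_inverse)
  show "continuous_on S (grad (bump p \<epsilon>))" unfolding * by (intro continuous_intros)
qed

lemma bump_outside: "\<epsilon> > 0 \<Longrightarrow> x \<notin> ball p \<epsilon> \<Longrightarrow> bump p \<epsilon> x = 0"
proof -
  assume "\<epsilon> > 0" "x \<notin> ball p \<epsilon>"
  then have "\<epsilon>\<^sup>2 \<le> (norm (x - p))\<^sup>2" by (intro power_mono) (auto simp: dist_norm norm_minus_commute)
  then show ?thesis using \<open>\<epsilon> > 0\<close> by (simp add: bump_def field_simps)
qed

lemma bump_pos: "x \<in> ball p \<epsilon> \<Longrightarrow> bump p \<epsilon> x > 0"
proof -
  assume x: "x \<in> ball p \<epsilon>"
  then have e: "\<epsilon> > 0" by (metis ball_eq_empty empty_iff not_le)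
  have "(norm (x - p))\<^sup>2 < \<epsilon>\<^sup>2" using x by (intro power_strict_mono) (auto simp: dist_norm norm_minus_commute)
  then have "(norm (x - p))\<^sup>2 / \<epsilon>\<^sup>2 < 1" using e by (subst divide_less_eq_1_pos) auto
  then show ?thesis unfolding bump_def by (intro zero_less_power) simp
qed

lemma bump_nonneg: "bump p \<epsilon> x \<ge> 0"
  by (simp add: bump_def)

text \<open>Approximating the derivative of the profile by polynomials gives polynomials converging to the
  bump together with their gradients.\<close>

lemma bump_C1_approx:
  assumes "\<epsilon> > 0" "R > 0" "e > 0"
  obtains P where "real_polynomial_function P"
    "\<And>x. x \<in> cball p R \<Longrightarrow> \<bar>bump p \<epsilon> x - P x\<bar> \<le> e"
    "\<And>x. x \<in> cball p R \<Longrightarrow> norm (grad (bump p \<epsilon>) x - grad P x) \<le> e"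
proof -
  define b where "b s = (max 0 (1 - s / \<epsilon>\<^sup>2))\<^sup>2" for s :: real
  define b' where "b' s = - 2 / \<epsilon>\<^sup>2 * max 0 (1 - s / \<epsilon>\<^sup>2)" for s :: real
  have bd: "(b has_real_derivative b' s) (at s)" for s
  proof -
    have "((\<lambda>s. (max 0 (1 - s / \<epsilon>\<^sup>2))\<^sup>2) has_real_derivative (2 * max 0 (1 - s / \<epsilon>\<^sup>2)) * (- 1 / \<epsilon>\<^sup>2)) (at s)"
      by (rule DERIV_chain2[OF has_real_derivative_max_sq affine_derivative])
    then show ?thesis by (simp add: b_def[abs_def] b'_def)
  qed
  \<comment> \<open>If the derivative of the profile is off by \<open>e'\<close>, the value is off
    by at most \<open>e' * R\<^sup>2\<close> and the gradient by at most \<open>2 * e' * R\<close>;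
    this choice keeps both below \<open>e\<close>.\<close>
  define e' where "e' = e / (R\<^sup>2 + 2 * R)"
  have Rp: "R\<^sup>2 + 2 * R > 0" using assms by (simp add: add_pos_pos)
  have e': "e' > 0" using assms Rp by (simp add: e'_def)
  have "continuous_on {0..R\<^sup>2} b'" unfolding b'_def by (intro continuous_intros) (use assms in auto)
  then obtain q where q: "real_polynomial_function q" "\<And>s. s \<in> {0..R\<^sup>2} \<Longrightarrow> \<bar>b' s - q s\<bar> < e'"
    using Stone_Weierstrass_real_polynomial_function[OF compact_Icc _ e'] by blast
  then obtain a n where a: "q = (\<lambda>s. \<Sum>i\<le>n. a i * s ^ i)" using real_polynomial_function_imp_sum by blast
  \<comment> \<open>The antiderivative of \<open>q\<close> that starts at the value of the profile,
    so that the error of the derivative controls the error of the value.\<close>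
  define Q where "Q s = b 0 + (\<Sum>i\<le>n. a i / real (Suc i) * s ^ Suc i)" for s
  have Qd: "(Q has_real_derivative q s) (at s)" for s
    unfolding Q_def[abs_def] a
    by (rule derivative_eq_intros refl | simp add: mult.commute del: power_Suc of_nat_Suc)+
  have Q0: "Q 0 = b 0" by (simp add: Q_def)
  have bQ: "\<bar>b s - Q s\<bar> \<le> e' * R\<^sup>2" if s: "s \<in> {0..R\<^sup>2}" for s
  proof -
    have "norm ((b s - Q s) - (b 0 - Q 0)) \<le> e' * norm (s - 0)"
    proof (rule field_differentiable_bound[of "{0..R\<^sup>2}" "\<lambda>s. b s - Q s" "\<lambda>s. b' s - q s" e' s 0])
      show "((\<lambda>s. b s - Q s) has_real_derivative b' s - q s) (at s within {0..R\<^sup>2})" for s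
        by (intro DERIV_diff has_field_derivative_at_within[OF bd] has_field_derivative_at_within[OF Qd])
      show "norm (b' s - q s) \<le> e'" if "s \<in> {0..R\<^sup>2}" for s using q(2)[OF that] by simp
    qed (use s in auto)
    also have "\<dots> \<le> e' * R\<^sup>2" using s e' by (intro mult_left_mono) auto
    finally show ?thesis by (simp add: Q0)
  qed
  let ?P = "\<lambda>x. Q ((norm (x - p))\<^sup>2)"
  have inR: "(norm (x - p))\<^sup>2 \<in> {0..R\<^sup>2}" "norm (x - p) \<le> R" if "x \<in> cball p R" for x
    using that assms by (auto simp: dist_norm norm_minus_commute intro!: power_mono)
  show ?thesis
  proof (rule that[of ?P])
    have "real_polynomial_function Q" unfolding Q_def[abs_def]
      by (intro real_polynomial_function.intros(2) real_polynomial_function.intros(3) real_polynomial_function_sum real_polynomial_function.intros(4) real_polynomial_function_power)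
        (auto intro: real_polynomial_function.intros bounded_linear_ident)
    moreover have "real_polynomial_function (\<lambda>x::real^3. (norm (x - p))\<^sup>2)"
    proof -
      have "(\<lambda>x::real^3. (norm (x - p))\<^sup>2) = (\<lambda>x. \<Sum>i\<in>UNIV. (x $ i - p $ i)\<^sup>2)"
        unfolding power2_norm_eq_inner by (simp add: inner_vec_def power2_eq_square)
      then show ?thesis
        by (auto intro!: real_polynomial_function_sum real_polynomial_function_power real_polynomial_function_diff
            intro: real_polynomial_function.intros bounded_linear_vec_nth)
    qed
    ultimately have "real_polynomial_function (Q \<circ> (\<lambda>x::real^3. (norm (x - p))\<^sup>2))"
      by (intro real_polynomial_function_compose) (simp_all add: real_polynomial_function_eq)
    then show "real_polynomial_function ?P" by (simp add: o_def)
    show "\<bar>bump p \<epsilon> x - ?P x\<bar> \<le> e" if "x \<in> cball p R" for x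
    proof -
      have "\<bar>bump p \<epsilon> x - ?P x\<bar> \<le> e' * R\<^sup>2" using bQ[OF inR(1)[OF that]] by (simp add: bump_def b_def)
      also have "\<dots> \<le> e' * (R\<^sup>2 + 2 * R)" using e' assms by (intro mult_left_mono) auto
      also have "\<dots> = e" using Rp by (simp add: e'_def)
      finally show ?thesis .
    qed
    show "norm (grad (bump p \<epsilon>) x - grad ?P x) \<le> e" if x: "x \<in> cball p R" for x
    proof -
      let ?s = "(norm (x - p))\<^sup>2"
      have "grad ?P x = (2 * q ?s) *\<^sub>R (x - p)" by (rule grad_eq[OF radial_derivative[OF Qd]])
      moreover have "grad (bump p \<epsilon>) x = (2 * b' ?s) *\<^sub>R (x - p)" by (simp add: grad_bump b'_def)
      ultimately have "grad (bump p \<epsilon>) x - grad ?P x = (2 * (b' ?s - q ?s)) *\<^sub>R (x - p)"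
        by (simp only: scaleR_diff_left right_diff_distrib)
      then have "norm (grad (bump p \<epsilon>) x - grad ?P x) = 2 * \<bar>b' ?s - q ?s\<bar> * norm (x - p)"
        by (simp only: norm_scaleR abs_mult abs_numeral)
      also have "\<dots> \<le> 2 * e' * R"
        using q(2)[OF inR(1)[OF x]] inR(2)[OF x] e' by (intro mult_mono) auto
      also have "\<dots> \<le> e' * (R\<^sup>2 + 2 * R)" using e' by (simp add: algebra_simps)
      also have "\<dots> = e" using Rp by (simp add: e'_def)
      finally show ?thesis .
    qed
  qed
qed

section \<open>Integration by parts against compactly supported functions\<close>

text \<open>The difference quotients of \<open>g\<close> have integral 0 by translation invariance
  and converge to the partial derivative; the gradient bound makes \<open>g\<close> Lipschitz, which
  dominates them.\<close>

lemma integral_partial_zero: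
  assumes d: "\<And>x. g differentiable at x" and B: "\<And>x. norm (grad g x) \<le> B"
    and z: "\<And>x. x \<notin> cball p \<rho> \<Longrightarrow> g x = 0"
  shows "partial i g \<in> borel_measurable borel" "(LINT x|lborel. partial i g x) = 0"
proof -
  have cg: "continuous_on UNIV g"
    using d by (meson continuous_at_imp_continuous_on differentiable_imp_continuous_within)
  then have [measurable]: "g \<in> borel_measurable borel" by (rule borel_measurable_continuous_onI)
  have B0: "B \<ge> 0" using B[of 0] norm_ge_zero order_trans by blast
  have lip: "\<bar>g x - g y\<bar> \<le> B * norm (x - y)" for x y
  proof -
    have "norm (g x - g y) \<le> B * norm (x - y)"
    proof (rule differentiable_bound[of UNIV g "\<lambda>x h. grad g x \<bullet> h"])
      show "(g has_derivative (\<lambda>h. grad g x \<bullet> h)) (at x within UNIV)" for x using has_derivative_grad[OF d] by simp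
      show "onorm (\<lambda>h. grad g x \<bullet> h) \<le> B" for x
      proof (rule onorm_le)
        fix h
        have "norm (grad g x \<bullet> h) \<le> norm (grad g x) * norm h" using Cauchy_Schwarz_ineq2 by auto
        also have "\<dots> \<le> B * norm h" using B by (intro mult_right_mono) auto
        finally show "norm (grad g x \<bullet> h) \<le> B * norm h" .
      qed
    qed auto
    then show ?thesis by simp
  qed
  define s where "s n = 1 / real (Suc n)" for n
  have s: "s n > 0" "s n \<le> 1" for n by (auto simp: s_def)
  have s0: "s \<longlonglongrightarrow> 0" unfolding s_def using LIMSEQ_Suc[OF lim_1_over_n[where 'a = real]] by simp
  define D where "D n x = (g (x + s n *\<^sub>R axis i 1) - g x) / s n" for n x
  have Dlim: "(\<lambda>n. D n x) \<longlonglongrightarrow> partial i g x" for x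
  proof -
    have "(g has_derivative (\<lambda>h. grad g x \<bullet> h)) (at x)" by (rule has_derivative_grad[OF d])
    moreover have "((\<lambda>t. x + t *\<^sub>R axis i 1) has_derivative (\<lambda>t. t *\<^sub>R axis i 1)) (at 0)"
      by (auto intro!: derivative_eq_intros)
    ultimately have "((\<lambda>t. g (x + t *\<^sub>R axis i 1)) has_derivative (\<lambda>t. grad g x \<bullet> (t *\<^sub>R axis i 1))) (at (0::real))"
      by (intro has_derivative_compose[where f = "\<lambda>t. x + t *\<^sub>R axis i 1" and g = g]) auto
    then have "((\<lambda>t. g (x + t *\<^sub>R axis i 1)) has_real_derivative partial i g x) (at 0)"
      by (simp add: has_field_derivative_def inner_axis mult.commute cong: if_cong) (simp add: fun_eq_iff mult_commute_abs)
    then have "((\<lambda>t. (g (x + t *\<^sub>R axis i 1) - g x) / t) \<longlongrightarrow> partial i g x) (at 0)"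
      by (simp add: DERIV_def)
    then show ?thesis unfolding D_def
      by (rule filterlim_compose) (use s s0 in \<open>auto simp: filterlim_at intro!: always_eventually less_imp_neq[symmetric]\<close>)
  qed
  have [measurable]: "D n \<in> borel_measurable borel" for n unfolding D_def by measurable
  show m [measurable]: "partial i g \<in> borel_measurable borel"
    using Dlim by (rule borel_measurable_LIMSEQ_metric[rotated]) measurable
  have "(\<lambda>n. LINT x|lborel. D n x) \<longlonglongrightarrow> (LINT x|lborel. partial i g x)"
  \<comment> \<open>The steps \<open>s n\<close> are at most 1, so all difference quotients vanish
    off the ball of radius \<open>\<rho> + 1\<close>.\<close>
  proof (rule integral_dominated_convergence[where w = "\<lambda>x. B * indicator (cball p (\<rho> + 1)) x"])
    show "integrable lborel (\<lambda>x. B * indicator (cball p (\<rho> + 1)) x)"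
      using emeasure_bounded_finite[of "cball p (\<rho> + 1)"]
      by (intro integrable_mult_right integrable_real_indicator) auto
    show "AE x in lborel. norm (D n x) \<le> B * indicator (cball p (\<rho> + 1)) x" for n
    proof (rule AE_I2)
      fix x
      show "norm (D n x) \<le> B * indicator (cball p (\<rho> + 1)) x"
      proof (cases "x \<in> cball p (\<rho> + 1)")
        case True
        have "\<bar>g (x + s n *\<^sub>R axis i 1) - g x\<bar> \<le> B * s n"
          using lip[of "x + s n *\<^sub>R axis i 1" x] s[of n] by simp
        then show ?thesis using True s[of n] by (simp add: D_def field_simps)
      next
        case False
        have "norm (s n *\<^sub>R axis i 1 :: real^3) \<le> 1" using s[of n] by simp
        then have "x + s n *\<^sub>R axis i 1 \<notin> cball p \<rho>" "x \<notin> cball p \<rho>"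
          using False dist_triangle[of p x "x + s n *\<^sub>R axis i 1"] by (auto simp: dist_norm)
        then show ?thesis using False by (simp add: D_def z)
      qed
    qed
  qed (use Dlim in auto)
  moreover have "(LINT x|lborel. D n x) = 0" for n
  proof -
    have ig: "integrable lborel g"
    proof -
      have "integrable lborel (\<lambda>x. indicator (cball p \<rho>) x *\<^sub>R g x)"
        using continuous_on_subset[OF cg] by (intro borel_integrable_compact) auto
      moreover have "(\<lambda>x. indicator (cball p \<rho>) x *\<^sub>R g x) = g" using z by (auto simp: fun_eq_iff indicator_def)
      ultimately show ?thesis by simp
    qed
    have sh: "integrable lborel (\<lambda>x. g (c + x))" "(LINT x|lborel. g (c + x)) = (LINT x|lborel. g x)" for c
    proof -
      have "integrable (distr lborel borel ((+) c)) g" using ig by (simp add: lborel_distr_plus)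
      then show "integrable lborel (\<lambda>x. g (c + x))" by (simp add: integrable_distr_eq)
      have "(LINT x|lborel. g x) = (LINT x|distr lborel borel ((+) c). g x)" by (simp add: lborel_distr_plus)
      then show "(LINT x|lborel. g (c + x)) = (LINT x|lborel. g x)" by (simp add: integral_distr)
    qed
    show ?thesis using sh[of "s n *\<^sub>R axis i 1"] ig unfolding D_def by (simp add: add.commute)
  qed
  ultimately show "(LINT x|lborel. partial i g x) = 0" by (simp add: LIMSEQ_const_iff)
qed

text \<open>The product, continued by 0, is differentiable everywhere because \<Omega> and the
  complement of the closed ball are open and cover the space; its partial derivative is the
  integrand on \<Omega> and 0 elsewhere.\<close>

lemma integration_by_parts:
  assumes op: "open \<Omega>" and sub: "cball p \<rho> \<subseteq> \<Omega>" and w: "C1_on \<Omega> w"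
    and \<eta>: "\<And>x. \<eta> differentiable at x" "continuous_on UNIV (grad \<eta>)"
    and z: "\<And>x. x \<notin> cball p \<rho> \<Longrightarrow> \<eta> x = 0"
  shows "(LINT x|lebesgue_on \<Omega>. w x * partial i \<eta> x + partial i w x * \<eta> x) = 0"
proof -
  define g where "g x = (if x \<in> \<Omega> then w x * \<eta> x else 0)" for x
  have oc: "open (- cball p \<rho>)" by (rule open_Compl[OF closed_cball])
  have g1: "(g has_derivative (\<lambda>h. (w x *\<^sub>R grad \<eta> x + \<eta> x *\<^sub>R grad w x) \<bullet> h)) (at x)" if "x \<in> \<Omega>" for x
  proof -
    have "((\<lambda>x. w x * \<eta> x) has_derivative (\<lambda>h. (w x *\<^sub>R grad \<eta> x + \<eta> x *\<^sub>R grad w x) \<bullet> h)) (at x)"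
      by (rule has_derivative_eq_rhs, rule has_derivative_mult[OF has_derivative_grad has_derivative_grad])
        (use w \<eta> that in \<open>auto simp: inner_add_left algebra_simps\<close>)
    then show ?thesis
      by (rule has_derivative_transform_within_open[OF _ op that]) (simp add: g_def)
  qed
  have g2: "(g has_derivative (\<lambda>h. 0 \<bullet> h)) (at x)" if "x \<notin> cball p \<rho>" for x
  proof -
    have "((\<lambda>x. 0) has_derivative (\<lambda>h. 0 \<bullet> h)) (at x)" by simp
    then show ?thesis
      by (rule has_derivative_transform_within_open[OF _ oc]) (use that z in \<open>auto simp: g_def\<close>)
  qed
  have diff: "g differentiable at x" for x
    using g1[of x] g2[of x] sub unfolding differentiable_def by blast
  have gr1: "grad g x = w x *\<^sub>R grad \<eta> x + \<eta> x *\<^sub>R grad w x" if "x \<in> \<Omega>" for x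
    by (rule grad_eq[OF g1[OF that]])
  have gr2: "grad g x = 0" if "x \<notin> cball p \<rho>" for x
    by (rule grad_eq[OF g2[OF that]])
  have cw: "continuous_on \<Omega> w" using w by (meson continuous_at_imp_continuous_on differentiable_imp_continuous_within)
  have c\<eta>: "continuous_on \<Omega> \<eta>" using \<eta>(1) by (meson continuous_at_imp_continuous_on differentiable_imp_continuous_within)
  have "continuous_on (cball p \<rho>) (\<lambda>x. w x *\<^sub>R grad \<eta> x + \<eta> x *\<^sub>R grad w x)"
    by (rule continuous_on_subset[OF _ sub])
      (intro continuous_intros cw c\<eta>, use w continuous_on_subset[OF \<eta>(2)] in auto)
  then have "bounded ((\<lambda>x. w x *\<^sub>R grad \<eta> x + \<eta> x *\<^sub>R grad w x) ` cball p \<rho>)"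
    using compact_continuous_image compact_imp_bounded compact_cball by blast
  then obtain B where B: "\<And>x. x \<in> cball p \<rho> \<Longrightarrow> norm (w x *\<^sub>R grad \<eta> x + \<eta> x *\<^sub>R grad w x) \<le> B"
    unfolding bounded_iff by blast
  have Bg: "norm (grad g x) \<le> max 0 B" for x
    using B[of x] gr1[of x] gr2[of x] sub by (cases "x \<in> cball p \<rho>") (auto simp: le_max_iff_disj)
  note * = integral_partial_zero[OF diff Bg, of p \<rho> i]
  have gz: "g x = 0" if "x \<notin> cball p \<rho>" for x using z[OF that] by (simp add: g_def)
  have "(LINT x|lebesgue_on \<Omega>. w x * partial i \<eta> x + partial i w x * \<eta> x)
    = (LINT x|lebesgue_on \<Omega>. partial i g x)"
  proof (intro Bochner_Integration.integral_cong refl)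
    fix x assume "x \<in> space (lebesgue_on \<Omega>)"
    then have "x \<in> \<Omega>" by simp
    from arg_cong[OF gr1[OF this], of "\<lambda>v. v $ i"]
    show "w x * partial i \<eta> x + partial i w x * \<eta> x = partial i g x" by (simp add: mult.commute)
  qed
  also have "\<dots> = (LINT x|lebesgue. (if x \<in> \<Omega> then partial i g x else 0))"
    using op by (intro Lebesgue_Measure.integral_restrict_UNIV[symmetric]) (simp add: borel_open)
  also have "\<dots> = (LINT x|lebesgue. partial i g x)"
  proof (intro Bochner_Integration.integral_cong refl)
    fix x show "(if x \<in> \<Omega> then partial i g x else 0) = partial i g x"
    proof (cases "x \<in> \<Omega>")
      case False
      then have "x \<notin> cball p \<rho>" using sub by blast
      from arg_cong[OF gr2[OF this], of "\<lambda>v. v $ i"] show ?thesis by simp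
    qed simp
  qed
  also have "\<dots> = (LINT x|lborel. partial i g x)"
    using *(1) gz by (intro integral_completion) auto
  also have "\<dots> = 0" using *(2) gz by blast
  finally show ?thesis .
qed

section \<open>Substitution by dilations and half-turns\<close>

lemma lborel_integral_affine:
  fixes f :: "real^3 \<Rightarrow> real"
  assumes f: "f \<in> borel_measurable borel" and e: "\<epsilon> > 0"
  shows "(LINT x|lborel. f x) = \<epsilon> ^ 3 * (LINT y|lborel. f (p + \<epsilon> *\<^sub>R y))"
proof -
  note [measurable] = f
  have "(LINT x|lborel. f x) = (LINT x|density (distr lborel borel (\<lambda>x. p + \<epsilon> *\<^sub>R x)) (\<lambda>_. \<bar>\<epsilon>\<bar> ^ DIM(real^3)). f x)"
    using e by (subst lborel_affine[of \<epsilon> p]) auto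
  also have "\<dots> = (LINT x|distr lborel borel (\<lambda>x. p + \<epsilon> *\<^sub>R x). \<bar>\<epsilon>\<bar> ^ DIM(real^3) *\<^sub>R f x)"
    using e by (subst integral_density) (auto simp: ennreal_power)
  also have "\<dots> = (LINT y|lborel. \<bar>\<epsilon>\<bar> ^ DIM(real^3) *\<^sub>R f (p + \<epsilon> *\<^sub>R y))"
    by (rule integral_distr) measurable
  also have "\<dots> = \<epsilon> ^ 3 * (LINT y|lborel. f (p + \<epsilon> *\<^sub>R y))"
    using e by simp
  finally show ?thesis .
qed

text \<open>The half-turn about the axis \<open>n\<close> is orthogonal and its own inverse, so
  preimages of boxes are images under an isometry.\<close>

lemma lborel_integral_rotation:
  fixes f :: "real^3 \<Rightarrow> real"
  assumes n: "norm n = 1" and f: "f \<in> borel_measurable borel"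
  shows "(LINT y|lborel. f (2 *\<^sub>R ((y \<bullet> n) *\<^sub>R n) - y)) = (LINT y|lborel. f y)"
proof -
  define R where "R y = 2 *\<^sub>R ((y \<bullet> n) *\<^sub>R n) - y" for y :: "real^3"
  have nn: "n \<bullet> n = 1" using n by (simp add: norm_eq_1)
  have lin: "linear R" unfolding R_def
    by (intro linearI) (simp_all add: inner_add_left algebra_simps)
  have orth: "orthogonal_transformation R"
    unfolding orthogonal_transformation_def using lin
    by (simp add: R_def inner_diff_left inner_diff_right nn inner_commute)
  have RR: "R (R y) = y" for y
    by (simp add: R_def inner_diff_left nn algebra_simps)
  have [measurable]: "R \<in> borel_measurable borel"
    by (intro borel_measurable_continuous_onI linear_continuous_on linear_conv_bounded_linear[THEN iffD1] lin)
  have im: "R -` A = R ` A" for A using RR by (metis (no_types, lifting) image_iff subsetI subset_antisym vimageE vimageI)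
  have "lborel = distr lborel borel R"
  proof (rule lborel_eqI)
    fix l u :: "real^3" assume lu: "\<And>b. b \<in> Basis \<Longrightarrow> l \<bullet> b \<le> u \<bullet> b"
    have m: "R ` box l u \<in> lmeasurable" "measure lebesgue (R ` box l u) = measure lebesgue (box l u)"
      using measurable_orthogonal_image[OF orth] measure_orthogonal_image[OF orth] by auto
    have "R -` box l u \<in> sets borel" using measurable_sets[of R borel borel "box l u"] by simp
    then have "emeasure (distr lborel borel R) (box l u) = emeasure lebesgue (R ` box l u)"
      by (subst emeasure_distr) (auto simp: im)
    also have "\<dots> = ennreal (measure lebesgue (box l u))"
      by (simp only: emeasure_eq_measure2[OF m(1)] m(2))
    also have "\<dots> = emeasure lebesgue (box l u)" by (rule emeasure_eq_measure2[symmetric]) simp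
    also have "\<dots> = emeasure lborel (box l u)" by simp
    finally show "emeasure (distr lborel borel R) (box l u) = ennreal (\<Prod>b\<in>Basis. (u - l) \<bullet> b)"
      using lu by (simp add: emeasure_lborel_box)
  qed simp
  then have "(LINT y|lborel. f y) = (LINT y|distr lborel borel R. f y)" by simp
  also have "\<dots> = (LINT y|lborel. f (R y))" by (rule integral_distr) (use f in auto)
  finally show ?thesis by (simp add: R_def)
qed

text \<open>One-sided, to be applied to a function and to its negative: if \<open>f\<close> is
  positive at \<open>p\<close>, then it is so on the support of a small bump, and the integral is
  positive.\<close>

lemma bump_integral_zero_imp_zero:
  assumes op: "open \<Omega>" and f: "continuous_on \<Omega> f" and p: "p \<in> \<Omega>"
    and z: "\<And>\<epsilon>. \<epsilon> > 0 \<Longrightarrow> cball p \<epsilon> \<subseteq> \<Omega> \<Longrightarrow> (LINT x|lebesgue_on \<Omega>. f x * bump p \<epsilon> x) = 0"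
  shows "f p \<le> 0"
proof (rule ccontr)
  assume "\<not> f p \<le> 0"
  then have fp: "f p > 0" by simp
  have sl: "\<Omega> \<in> sets lebesgue" using op by (simp add: borel_open)
  have "open (\<Omega> \<inter> f -` {0<..})" using f op by (rule continuous_open_preimage) simp
  then obtain \<epsilon> where \<epsilon>: "\<epsilon> > 0" "cball p \<epsilon> \<subseteq> \<Omega> \<inter> f -` {0<..}" using p fp open_contains_cball by blast
  have nn: "f x * bump p \<epsilon> x \<ge> 0" for x
  proof (cases "x \<in> ball p \<epsilon>")
    case True
    then have "x \<in> cball p \<epsilon>" by simp
    then have "f x > 0" using \<epsilon>(2) by blast
    then show ?thesis using bump_nonneg by simp
  qed (use bump_outside \<epsilon> in auto)
  have int: "integrable (lebesgue_on \<Omega>) (\<lambda>x. f x * bump p \<epsilon> x)"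
  proof -
    have "integrable lborel (\<lambda>x. indicator (cball p \<epsilon>) x *\<^sub>R (f x * bump p \<epsilon> x))"
      by (intro borel_integrable_compact continuous_intros continuous_on_subset[OF f] continuous_bump) (use \<epsilon> in auto)
    moreover have "(\<lambda>x. indicator (cball p \<epsilon>) x *\<^sub>R (f x * bump p \<epsilon> x)) = (\<lambda>x. indicator \<Omega> x *\<^sub>R (f x * bump p \<epsilon> x))"
      using \<epsilon> bump_outside[OF \<epsilon>(1), of _ p] by (auto simp: fun_eq_iff indicator_def) 
    ultimately have "integrable lebesgue (\<lambda>x. indicator \<Omega> x *\<^sub>R (f x * bump p \<epsilon> x))"
      by (metis integrable_completion borel_measurable_integrable)
    then show ?thesis using sl by (simp add: integrable_restrict_space)
  qed
  have "AE x in lebesgue_on \<Omega>. f x * bump p \<epsilon> x = 0"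
    using z[OF \<epsilon>(1)] \<epsilon>(2) int nn by (subst integral_nonneg_eq_0_iff_AE[symmetric]) auto
  then have "AE x in lebesgue. x \<in> \<Omega> \<longrightarrow> f x * bump p \<epsilon> x = 0" using sl by (simp add: AE_restrict_space_iff)
  then have "AE x in lebesgue. x \<notin> ball p \<epsilon>"
  proof (rule AE_mp, intro AE_I2 impI notI)
    fix x assume "x \<in> \<Omega> \<longrightarrow> f x * bump p \<epsilon> x = 0" and x: "x \<in> ball p \<epsilon>"
    moreover have "x \<in> cball p \<epsilon>" using x by simp
    then have "x \<in> \<Omega>" "f x > 0" using \<epsilon>(2) by blast+
    ultimately show False using bump_pos[OF x] by auto
  qed
  then have "emeasure lebesgue (ball p \<epsilon>) = 0"
    by (subst (asm) AE_iff_measurable[of "ball p \<epsilon>"]) auto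
  then have "measure lebesgue (ball p \<epsilon>) = 0" by (simp add: measure_def)
  then show False using content_ball_pos[OF \<epsilon>(1), of p] by simp
qed

section \<open>Closability of the gradient and localization of the weak equation\<close>

context
  fixes \<Omega> :: "(real^3) set"
  assumes dom: "bounded_lipschitz_domain \<Omega>"
begin

lemmas domain_facts = domain_open[OF dom] domain_bounded[OF dom] domain_lmeasurable[OF dom] domain_sets[OF dom] domain_finite_measure[OF dom]

lemma L2_continuous_UNIV:
  "continuous_on UNIV (X :: real^3 \<Rightarrow> 'b::euclidean_space) \<Longrightarrow> L2 (lebesgue_on \<Omega>) X"
  by (rule L2_continuous[OF dom]) (auto intro: continuous_on_subset)

text \<open>This is the closability of the gradient.\<close>

lemma H1_gradient_unique:
  assumes H: "H1_gradient \<Omega> f G" and w: "Ck_up_to_boundary (Suc 0) \<Omega> w"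
    and eq: "AE x in lebesgue_on \<Omega>. f x = w x"
  shows "AE x in lebesgue_on \<Omega>. G x = grad w x"
proof -
  let ?M = "lebesgue_on \<Omega>"
  obtain V where L: "L2 ?M f" "L2 ?M G" and V: "\<And>k. C_closure \<infinity> \<Omega> (V k)"
     "(\<lambda>k. LINT x|?M. (norm (V k x - f x))\<^sup>2) \<longlonglongrightarrow> 0" "(\<lambda>k. LINT x|?M. (norm (grad (V k) x - G x))\<^sup>2) \<longlonglongrightarrow> 0"
    using H unfolding H1_gradient_iff[OF dom] by blast
  note w' = Ck1_facts[OF dom w] and V' = smooth_facts[OF dom V(1)]
  \<comment> \<open>Both gradients have the same pairing with \<open>P * bump\<close>, because
    integration by parts moves the derivative to this product and survives the limit in
    \<open>V\<close>. Since \<open>P\<close> is arbitrary, their difference times the bump is 0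
    almost everywhere.\<close>
  have key: "AE x in ?M. x \<in> ball p \<epsilon> \<longrightarrow> G x $ i = partial i w x" if \<epsilon>: "\<epsilon> > 0" "cball p \<epsilon> \<subseteq> \<Omega>" for p \<epsilon> i
  proof -
    have Gi: "L2 ?M (\<lambda>x. G x $ i - partial i w x)"
    proof -
      have [measurable]: "(\<lambda>x. G x - grad w x) \<in> borel_measurable ?M" and 
        1: "integrable ?M (\<lambda>x. (norm (G x - grad w x))\<^sup>2)"
        using L2_diff[OF L(2) w'(3)] by (auto simp: L2_def)
      have m: "(\<lambda>x. (G x - grad w x) \<bullet> axis i 1) \<in> borel_measurable ?M" by measurable
      have "integrable ?M (\<lambda>x. (norm ((G x - grad w x) \<bullet> axis i 1))\<^sup>2)"
      proof (rule Bochner_Integration.integrable_bound[OF 1])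
        show "AE x in ?M. norm ((norm ((G x - grad w x) \<bullet> axis i 1))\<^sup>2) \<le> norm ((norm (G x - grad w x))\<^sup>2)"
        proof (rule AE_I2)
          fix x
          have "\<bar>(G x - grad w x) \<bullet> axis i 1\<bar> \<le> norm (G x - grad w x)"
            using Cauchy_Schwarz_ineq2[of "G x - grad w x" "axis i 1"] by simp
          then show "norm ((norm ((G x - grad w x) \<bullet> axis i 1))\<^sup>2) \<le> norm ((norm (G x - grad w x))\<^sup>2)"
            using power_mono[OF _ abs_ge_zero, of _ "norm (G x - grad w x)" 2] by simp
        qed
      qed (use m in measurable)
      with m show ?thesis by (simp add: L2_def inner_axis)
    qed
    have "AE x in ?M. (G x $ i - partial i w x) * bump p \<epsilon> x = 0"
    proof (rule orthogonal_polynomials_imp_zero[OF domain_facts(4,2)])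
      show "integrable ?M (\<lambda>x. (G x $ i - partial i w x) * bump p \<epsilon> x)"
        by (intro L2_mult Gi L2_continuous_UNIV continuous_bump)
      fix P :: "real^3 \<Rightarrow> real" assume P: "real_polynomial_function P"
      define \<eta> where "\<eta> x = P x * bump p \<epsilon> x" for x
      have Pd: "P differentiable at x" for x
        by (rule differentiable_at_real_polynomial_function[OF P])
      have PC: "C_closure \<infinity> UNIV P" by (rule C_closure_polynomial[OF open_UNIV P])
      have cP: "continuous_on UNIV P" "continuous_on UNIV (grad P)"
        using Ck_1_D(3,4)[OF open_UNIV C_closure_Suc0[OF PC]] by auto
      have \<eta>d: "\<eta> differentiable at x" for x unfolding \<eta>_def[abs_def] by (intro differentiable_mult Pd bump_differentiable)
      have g\<eta>: "grad \<eta> = (\<lambda>x. P x *\<^sub>R grad (bump p \<epsilon>) x + bump p \<epsilon> x *\<^sub>R grad P x)"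
        unfolding \<eta>_def[abs_def] by (intro ext grad_mult Pd bump_differentiable)
      have c\<eta>: "continuous_on UNIV \<eta>" "continuous_on UNIV (grad \<eta>)"
        unfolding g\<eta> unfolding \<eta>_def[abs_def] by (intro continuous_intros cP continuous_bump)+
      have c\<eta>i: "continuous_on UNIV (partial i \<eta>)"
      proof -
        have "continuous_on UNIV (\<lambda>x. grad \<eta> x $ i)" by (intro continuous_intros c\<eta>)
        then show ?thesis by simp
      qed
      have L\<eta>: "L2 ?M \<eta>" "L2 ?M (partial i \<eta>)" "L2 ?M (\<lambda>x. \<eta> x *\<^sub>R axis i 1 :: real^3)"
        by (intro L2_continuous_UNIV c\<eta> c\<eta>i continuous_intros)+
      have sz: "\<eta> x = 0" if "x \<notin> cball p \<epsilon>" for x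
        using bump_outside[OF \<epsilon>(1), of x p] that by (simp add: \<eta>_def)
      have ibp: "(LINT x|?M. v x * partial i \<eta> x) = - (LINT x|?M. grad v x \<bullet> (\<eta> x *\<^sub>R axis i 1))"
        if v: "C1_on \<Omega> v" "L2 ?M v" "L2 ?M (grad v)" for v
      proof -
        have "(LINT x|?M. v x * partial i \<eta> x + grad v x \<bullet> (\<eta> x *\<^sub>R axis i 1)) = 0"
          using integration_by_parts[OF domain_facts(1) \<epsilon>(2) v(1) \<eta>d c\<eta>(2) sz, of i]
          by (simp add: inner_axis mult.commute)
        then show ?thesis using L2_mult[OF v(2) L\<eta>(2)] L2_inner[OF v(3) L\<eta>(3)] by simp
      qed
      have "(\<lambda>k. LINT x|?M. grad (V k) x \<bullet> (\<eta> x *\<^sub>R axis i 1)) \<longlonglongrightarrow> (LINT x|?M. G x \<bullet> (\<eta> x *\<^sub>R axis i 1))"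
        by (rule L2_tendsto_inner) (use V' L L\<eta> V in auto)
      moreover have "(\<lambda>k. - (LINT x|?M. V k x \<bullet> partial i \<eta> x)) \<longlonglongrightarrow> - (LINT x|?M. f x \<bullet> partial i \<eta> x)"
        by (intro tendsto_minus L2_tendsto_inner) (use V' L L\<eta> V in auto)
      moreover have "- (LINT x|?M. V k x \<bullet> partial i \<eta> x) = (LINT x|?M. grad (V k) x \<bullet> (\<eta> x *\<^sub>R axis i 1))" for k
        using ibp[OF V'] by simp
      ultimately have "(LINT x|?M. G x \<bullet> (\<eta> x *\<^sub>R axis i 1)) = - (LINT x|?M. f x \<bullet> partial i \<eta> x)"
        by (simp only:) (rule LIMSEQ_unique)
      also have "(LINT x|?M. f x \<bullet> partial i \<eta> x) = (LINT x|?M. w x * partial i \<eta> x)"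
        by (rule integral_cong_AE) (use eq L w' L\<eta> in \<open>auto simp: L2_def elim!: eventually_mono intro!: borel_measurable_times\<close>)
      finally have "(LINT x|?M. G x \<bullet> (\<eta> x *\<^sub>R axis i 1)) = (LINT x|?M. grad w x \<bullet> (\<eta> x *\<^sub>R axis i 1))"
        using ibp[OF w'] by simp
      moreover have "(LINT x|?M. (G x $ i - partial i w x) * bump p \<epsilon> x * P x)
        = (LINT x|?M. G x \<bullet> (\<eta> x *\<^sub>R axis i 1) - grad w x \<bullet> (\<eta> x *\<^sub>R axis i 1))"
        by (simp add: inner_axis \<eta>_def algebra_simps)
      ultimately show "(LINT x|?M. (G x $ i - partial i w x) * bump p \<epsilon> x * P x) = 0"
        using L2_inner[OF L(2) L\<eta>(3)] L2_inner[OF w'(3) L\<eta>(3)] by simp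
    qed
    then show ?thesis
    proof eventually_elim
      case (elim x)
      then show ?case using bump_pos[of x p \<epsilon>] by auto
    qed
  qed
  \<comment> \<open>The exceptional null set depends on the ball, so Lindelof's theorem is used to
    cover \<Omega> by countably many of them.\<close>
  define BB where "BB = {ball p \<epsilon> |p \<epsilon>. \<epsilon> > 0 \<and> cball p \<epsilon> \<subseteq> \<Omega>}"
  have BB\<Omega>: "\<Union>BB = \<Omega>"
  proof
    show "\<Union>BB \<subseteq> \<Omega>" unfolding BB_def using ball_subset_cball by blast
    show "\<Omega> \<subseteq> \<Union>BB"
    proof
      fix x assume "x \<in> \<Omega>"
      then obtain \<epsilon> where "\<epsilon> > 0" "cball x \<epsilon> \<subseteq> \<Omega>" using domain_facts(1) open_contains_cball by blast
      then show "x \<in> \<Union>BB" unfolding BB_def by (intro UnionI[of "ball x \<epsilon>"]) auto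
    qed
  qed
  obtain BB' where BB': "BB' \<subseteq> BB" "countable BB'" "\<Union>BB' = \<Union>BB"
    using Lindelof[of BB] by (auto simp: BB_def)
  have "AE x in ?M. \<forall>B\<in>BB'. \<forall>i. x \<in> B \<longrightarrow> G x $ i = partial i w x"
  proof (subst AE_ball_countable[OF BB'(2)], intro ballI)
    fix B assume "B \<in> BB'"
    then obtain p \<epsilon> where B: "B = ball p \<epsilon>" "\<epsilon> > 0" "cball p \<epsilon> \<subseteq> \<Omega>" using BB' by (auto simp: BB_def)
    show "AE x in ?M. \<forall>i. x \<in> B \<longrightarrow> G x $ i = partial i w x"
      unfolding B(1) by (subst AE_all_countable) (use key[OF B(2,3)] in blast)
  qed
  moreover have "AE x in ?M. x \<in> \<Omega>" by (rule AE_I2) simp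
  ultimately show ?thesis
  proof eventually_elim
    case (elim x)
    then obtain B where "B \<in> BB'" "x \<in> B" using BB'(3) BB\<Omega> by blast
    then have "\<forall>i. G x $ i = partial i w x" using elim(1) by blast
    then show ?case by (simp add: vec_eq_iff)
  qed
qed

text \<open>The approximation by polynomials is uniform on a ball that contains \<Omega>, so the
  centre and the radius are arbitrary and the bump may be cut by the boundary.\<close>

lemma weak_form_bump:
  assumes X: "L2 (lebesgue_on \<Omega>) X" and U: "L2 (lebesgue_on \<Omega>) U"
    and weak: "\<And>P. real_polynomial_function P \<Longrightarrow>
      (LINT x|lebesgue_on \<Omega>. X x \<bullet> grad P x) + (LINT x|lebesgue_on \<Omega>. U x * P x) = 0"
    and \<epsilon>: "\<epsilon> > 0"
  shows "(LINT x|lebesgue_on \<Omega>. X x \<bullet> grad (bump p \<epsilon>) x) + (LINT x|lebesgue_on \<Omega>. U x * bump p \<epsilon> x) = 0"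
proof -
  let ?M = "lebesgue_on \<Omega>"
  obtain R where R: "R > 0" "\<Omega> \<subseteq> cball p R"
  proof -
    obtain a where "\<forall>x\<in>\<Omega>. dist p x \<le> a" using domain_bounded[OF dom] bounded_any_center[of \<Omega> p] by blast
    then show ?thesis by (intro that[of "max 1 a"]) (auto simp: le_max_iff_disj)
  qed
  have "\<exists>P. real_polynomial_function P \<and> (\<forall>x\<in>cball p R. \<bar>bump p \<epsilon> x - P x\<bar> \<le> 1 / real (Suc k)) \<and>
     (\<forall>x\<in>cball p R. norm (grad (bump p \<epsilon>) x - grad P x) \<le> 1 / real (Suc k))" for k
    using bump_C1_approx[OF \<epsilon> R(1), of "1 / real (Suc k)" p] by (metis of_nat_0_less_iff zero_less_Suc zero_less_divide_1_iff)
  then obtain P where P: "\<And>k. real_polynomial_function (P k)"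
    and P1: "\<And>k x. x \<in> cball p R \<Longrightarrow> \<bar>bump p \<epsilon> x - P k x\<bar> \<le> 1 / real (Suc k)"
    and P2: "\<And>k x. x \<in> cball p R \<Longrightarrow> norm (grad (bump p \<epsilon>) x - grad (P k) x) \<le> 1 / real (Suc k)" by metis
  have Pf: "L2 ?M (P k)" "L2 ?M (grad (P k))" for k
    using smooth_facts[OF dom C_closure_polynomial[OF domain_facts(1) P]] by auto
  have bf: "L2 ?M (bump p \<epsilon>)" "L2 ?M (grad (bump p \<epsilon>))"
    by (intro L2_continuous_UNIV continuous_bump)+
  have conv: "(\<lambda>k. LINT x|?M. (norm (f k x - g x))\<^sup>2) \<longlonglongrightarrow> 0"
    if f: "\<And>k. L2 ?M (f k)" "L2 ?M g" and le: "\<And>k x. x \<in> cball p R \<Longrightarrow> norm (g x - f k x) \<le> 1 / real (Suc k)"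
    for f :: "nat \<Rightarrow> real^3 \<Rightarrow> 'b::euclidean_space" and g
  proof (rule tendsto_sandwich[OF _ _ tendsto_const])
    show "(\<lambda>k. 1 / real (Suc k) * measure ?M \<Omega>) \<longlonglongrightarrow> 0"
      using tendsto_mult[OF LIMSEQ_Suc[OF lim_1_over_n[where 'a = real]] tendsto_const[of "measure ?M \<Omega>"]] by simp
    have "(LINT x|?M. (norm (f k x - g x))\<^sup>2) \<le> (LINT x|?M. 1 / real (Suc k))" for k
    proof (rule integral_mono)
      show "integrable ?M (\<lambda>x. (norm (f k x - g x))\<^sup>2)" using L2_diff[OF f] by (rule L2_integrable)
      show "integrable ?M (\<lambda>x. 1 / real (Suc k))" by (rule finite_measure.integrable_const[OF domain_facts(5)])
      fix x assume "x \<in> space ?M"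
      then have n: "norm (f k x - g x) \<le> 1 / real (Suc k)" using le[of x k] R by (auto simp: norm_minus_commute)
      then have "(norm (f k x - g x))\<^sup>2 \<le> (1 / real (Suc k))\<^sup>2" by (intro power_mono) auto
      also have "\<dots> \<le> 1 / real (Suc k)"
        using power_decreasing[of 1 2 "1 / real (Suc k)"] by (simp del: of_nat_Suc)
      finally show "(norm (f k x - g x))\<^sup>2 \<le> 1 / real (Suc k)" .
    qed
    then show "\<forall>\<^sub>F k in sequentially. (LINT x|?M. (norm (f k x - g x))\<^sup>2) \<le> 1 / real (Suc k) * measure ?M \<Omega>"
      by (simp add: mult.commute)
  qed simp
  have "(\<lambda>k. (LINT x|?M. grad (P k) x \<bullet> X x) + (LINT x|?M. P k x \<bullet> U x)) \<longlonglongrightarrow>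
     (LINT x|?M. grad (bump p \<epsilon>) x \<bullet> X x) + (LINT x|?M. bump p \<epsilon> x \<bullet> U x)"
    by (intro tendsto_add L2_tendsto_inner conv Pf bf X U) (use P1 P2 in auto)
  moreover have "(LINT x|?M. grad (P k) x \<bullet> X x) + (LINT x|?M. P k x \<bullet> U x) = 0" for k
    using weak[OF P[of k]] by (simp add: inner_commute mult.commute)
  ultimately show ?thesis by (simp add: LIMSEQ_const_iff inner_commute mult.commute)
qed

text \<open>Bumps supported in \<Omega> allow integration by parts without a boundary term;
  continuity of \<open>U\<close> and of the Laplacian turns the vanishing integrals into an equation
  at every point.\<close>

lemma weak_form_interior:
  assumes w: "Ck_up_to_boundary 2 \<Omega> w" and U: "continuous_on (closure \<Omega>) U"
    and weak: "\<And>P. real_polynomial_function P \<Longrightarrow>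
      (LINT x|lebesgue_on \<Omega>. grad w x \<bullet> grad P x) + (LINT x|lebesgue_on \<Omega>. U x * P x) = 0"
    and p: "p \<in> \<Omega>"
  shows "U p = laplacian w p"
proof -
  let ?M = "lebesgue_on \<Omega>"
  have w1: "Ck_up_to_boundary (Suc 0) \<Omega> w" and wi: "\<And>i. Ck_up_to_boundary (Suc 0) \<Omega> (partial i w)"
    using w Ck_Suc_imp[of 1 \<Omega> w] by (simp_all add: numeral_2_eq_2)
  note f = Ck1_facts[OF dom w1] and fi = Ck1_facts[OF dom wi]
  have LU: "L2 ?M U" by (rule L2_continuous[OF dom U]) simp
  have cU: "continuous_on \<Omega> U" using continuous_on_subset[OF U closure_subset] .
  have ci: "continuous_on \<Omega> (partial i (partial i w))" and Li: "L2 ?M (partial i (partial i w))" for i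
  proof -
    have "continuous_on \<Omega> (\<lambda>x. grad (partial i w) x $ i)" using fi(1)[of i] by (intro continuous_intros) simp
    then show "continuous_on \<Omega> (partial i (partial i w))" by simp
    have "Ck_up_to_boundary 0 \<Omega> (partial i (partial i w))" using wi[of i] by simp
    then show "L2 ?M (partial i (partial i w))" by (intro L2_extends[OF dom]) simp
  qed
  have cl: "continuous_on \<Omega> (laplacian w)" unfolding laplacian_def[abs_def] by (intro continuous_intros ci)
  have Ll: "L2 ?M (laplacian w)"
    unfolding laplacian_def[abs_def] UNIV_3 using Li by (auto intro!: L2_add)
  have z: "(LINT x|?M. (U x - laplacian w x) * bump p \<epsilon> x) = 0" if \<epsilon>: "\<epsilon> > 0" "cball p \<epsilon> \<subseteq> \<Omega>" for \<epsilon>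
  proof -
    have b: "L2 ?M (bump p \<epsilon>)" "L2 ?M (partial i (bump p \<epsilon>))" for i
    proof -
      show "L2 ?M (bump p \<epsilon>)" by (intro L2_continuous_UNIV continuous_bump)
      have "continuous_on UNIV (\<lambda>x. grad (bump p \<epsilon>) x $ i)" by (intro continuous_intros continuous_bump)
      then show "L2 ?M (partial i (bump p \<epsilon>))" by (intro L2_continuous_UNIV) simp
    qed
    have sz: "bump p \<epsilon> x = 0" if "x \<notin> cball p \<epsilon>" for x using bump_outside[OF \<epsilon>(1), of x p] that by simp
    have "(LINT x|?M. partial i w x * partial i (bump p \<epsilon>) x) = - (LINT x|?M. partial i (partial i w) x * bump p \<epsilon> x)" for i
      using integration_by_parts[OF domain_facts(1) \<epsilon>(2) fi(1)[of i] bump_differentiable continuous_bump(2) sz, of i]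
        L2_mult[OF fi(2) b(2)] L2_mult[OF Li b(1)] by simp
    then have "(LINT x|?M. (\<Sum>i\<in>UNIV. partial i w x * partial i (bump p \<epsilon>) x)) = - (LINT x|?M. (\<Sum>i\<in>UNIV. partial i (partial i w) x * bump p \<epsilon> x))"
      using L2_mult[OF fi(2) b(2)] L2_mult[OF Li b(1)] by (simp add: sum_negf)
    then have "(LINT x|?M. grad w x \<bullet> grad (bump p \<epsilon>) x) = - (LINT x|?M. laplacian w x * bump p \<epsilon> x)"
      by (simp add: inner_vec_def laplacian_def sum_distrib_right)
    moreover have "(LINT x|?M. grad w x \<bullet> grad (bump p \<epsilon>) x) + (LINT x|?M. U x * bump p \<epsilon> x) = 0"
      by (rule weak_form_bump[OF f(3) LU weak \<epsilon>(1)])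
    ultimately show ?thesis using L2_mult[OF LU b(1)] L2_mult[OF Ll b(1)] by (simp add: left_diff_distrib)
  qed
  have "U p - laplacian w p \<le> 0"
    by (rule bump_integral_zero_imp_zero[OF domain_facts(1) _ p]) (use z cU cl in \<open>auto intro!: continuous_intros\<close>)
  moreover have "- (U p - laplacian w p) \<le> 0"
  proof (rule bump_integral_zero_imp_zero[OF domain_facts(1) _ p, where f = "\<lambda>x. - (U x - laplacian w x)"])
    show "(LINT x|?M. - (U x - laplacian w x) * bump p \<epsilon> x) = 0" if "\<epsilon> > 0" "cball p \<epsilon> \<subseteq> \<Omega>" for \<epsilon>
      using z[OF that] by (simp only: mult_minus_left Bochner_Integration.integral_minus)
  qed (use cU cl in \<open>auto intro!: continuous_intros\<close>)
  ultimately show ?thesis by simp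
qed

text \<open>Blow-up at a boundary point: testing with the bump of radius \<open>\<epsilon>\<close>, substituting \<open>x = p + \<epsilon> y\<close> and
  letting \<open>\<epsilon>\<close> tend to zero turns the domain into a half-space; the rotation by \<open>\<pi>\<close> about \<open>n\<close> removes the
  tangential part of \<open>X p\<close>.\<close>

lemma weak_form_boundary:
  assumes X: "continuous_on (closure \<Omega>) X" and U: "continuous_on (closure \<Omega>) U"
    and weak: "\<And>P. real_polynomial_function P \<Longrightarrow>
      (LINT x|lebesgue_on \<Omega>. X x \<bullet> grad P x) + (LINT x|lebesgue_on \<Omega>. U x * P x) = 0"
    and n: "outward_normal \<Omega> p n"
  shows "X p \<bullet> n = 0"
proof -
  let ?M = "lebesgue_on \<Omega>"
  have pf: "p \<in> frontier \<Omega>" and nn: "norm n = 1" using n by (auto simp: outward_normal_def)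
  have LX: "L2 ?M X" and LU: "L2 ?M U" using L2_continuous[OF dom X] L2_continuous[OF dom U] by auto
  obtain B1 where B1: "\<And>x. x \<in> closure \<Omega> \<Longrightarrow> norm (X x) \<le> B1" using extends_to_closure_bounded[OF domain_facts(2) X] by blast
  obtain B2 where B2: "\<And>x. x \<in> closure \<Omega> \<Longrightarrow> norm (U x) \<le> B2" using extends_to_closure_bounded[OF domain_facts(2) U] by blast
  have pc: "p \<in> closure \<Omega>" using pf by (simp add: frontier_def)
  have B0: "B1 \<ge> 0" "B2 \<ge> 0" using B1[OF pc] B2[OF pc] norm_ge_zero order_trans by blast+
  \<comment> \<open>The profile before squaring: in the rescaled variable the bump is the square of
    \<open>\<phi>\<close>, and its gradient is \<open>y\<close> times
    \<open>- 4 / \<epsilon> * \<phi> y\<close>.\<close>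
  define \<phi> where "\<phi> y = max 0 (1 - (norm y)\<^sup>2)" for y :: "real^3"
  have c\<phi>: "continuous_on S \<phi>" for S unfolding \<phi>_def by (intro continuous_intros)
  have [measurable]: "\<phi> \<in> borel_measurable borel" by (rule borel_measurable_continuous_onI[OF c\<phi>])
  have \<phi>01: "0 \<le> \<phi> y" "\<phi> y \<le> 1" for y by (auto simp: \<phi>_def)
  have \<phi>0: "\<phi> y = 0" if "y \<notin> ball 0 1" for y
    using that power_mono[of 1 "norm y" 2] by (simp add: \<phi>_def)
  define s where "s k = 1 / real (Suc k)" for k
  have s: "s k > 0" "s k \<le> 1" for k by (auto simp: s_def)
  have s0: "s \<longlonglongrightarrow> 0" unfolding s_def using LIMSEQ_Suc[OF lim_1_over_n[where 'a = real]] by simp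
  define X' where "X' x = indicator \<Omega> x *\<^sub>R X x" for x
  define U' where "U' x = indicator \<Omega> x *\<^sub>R U x" for x
  have X'm [measurable]: "X' \<in> borel_measurable borel"
    unfolding X'_def[abs_def] using continuous_on_subset[OF X closure_subset] domain_facts(1)
    by (intro borel_measurable_continuous_on_indicator) (auto simp: borel_open)
  have U'm [measurable]: "U' \<in> borel_measurable borel"
    unfolding U'_def[abs_def] using continuous_on_subset[OF U closure_subset] domain_facts(1)
    by (intro borel_measurable_continuous_on_indicator) (auto simp: borel_open)
  have X'B: "norm (X' x) \<le> B1" and U'B: "norm (U' x) \<le> B2" for x
    using B1[of x] B2[of x] B0 closure_subset[of \<Omega>] by (auto simp: X'_def U'_def indicator_def)
  \<comment> \<open>The rescaled integrand divided by \<open>- 4 / s k\<close>: the gradient term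
    loses its singular factor, and the term with \<open>U'\<close> acquires the factor
    \<open>s k / 4\<close> that removes it in the limit.\<close>
  define g where "g k y = (X' (p + s k *\<^sub>R y) \<bullet> y) * \<phi> y - s k / 4 * (U' (p + s k *\<^sub>R y) * (\<phi> y)\<^sup>2)" for k y
  have [measurable]: "g k \<in> borel_measurable borel" for k unfolding g_def by measurable
  have int0: "(LINT y|lborel. g k y) = 0" for k
  proof -
    let ?\<epsilon> = "s k"
    define f where "f x = X' x \<bullet> grad (bump p ?\<epsilon>) x + U' x * bump p ?\<epsilon> x" for x
    have [measurable]: "grad (bump p ?\<epsilon>) \<in> borel_measurable borel" "bump p ?\<epsilon> \<in> borel_measurable borel"
      by (intro borel_measurable_continuous_onI continuous_bump)+
    have fm: "f \<in> borel_measurable borel" unfolding f_def by measurable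
    have b: "L2 ?M (bump p ?\<epsilon>)" "L2 ?M (grad (bump p ?\<epsilon>))"
      by (intro L2_continuous_UNIV continuous_bump)+
    have "(LINT x|lborel. f x) = (LINT x|lebesgue. f x)" using fm by (intro integral_completion[symmetric]) simp
    also have "\<dots> = (LINT x|lebesgue. (if x \<in> \<Omega> then X x \<bullet> grad (bump p ?\<epsilon>) x + U x * bump p ?\<epsilon> x else 0))"
      by (intro Bochner_Integration.integral_cong) (auto simp: f_def X'_def U'_def)
    also have "\<dots> = (LINT x|?M. X x \<bullet> grad (bump p ?\<epsilon>) x + U x * bump p ?\<epsilon> x)"
      by (rule Lebesgue_Measure.integral_restrict_UNIV[OF domain_facts(4)])
    also have "\<dots> = 0"
      using weak_form_bump[OF LX LU weak s(1), of p k] L2_inner[OF LX b(2)] L2_mult[OF LU b(1)] by simp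
    finally have "0 = ?\<epsilon> ^ 3 * (LINT y|lborel. f (p + ?\<epsilon> *\<^sub>R y))"
      using lborel_integral_affine[OF fm s(1), of k p] by simp
    moreover have "f (p + ?\<epsilon> *\<^sub>R y) = - 4 / ?\<epsilon> * g k y" for y
    proof -
      have ratio: "(norm (p + ?\<epsilon> *\<^sub>R y - p))\<^sup>2 / ?\<epsilon>\<^sup>2 = (norm y)\<^sup>2"
        using s(1)[of k] by (simp add: power_mult_distrib)
      have 1: "bump p ?\<epsilon> (p + ?\<epsilon> *\<^sub>R y) = (\<phi> y)\<^sup>2"
        unfolding bump_def ratio \<phi>_def ..
      have 2: "grad (bump p ?\<epsilon>) (p + ?\<epsilon> *\<^sub>R y) = (- 4 / ?\<epsilon> * \<phi> y) *\<^sub>R y"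
        unfolding grad_bump ratio using s(1)[of k] by (simp add: \<phi>_def power2_eq_square)
      show ?thesis unfolding f_def g_def 1 2 using s(1)[of k] by (simp add: field_simps)
    qed
    ultimately show ?thesis using s(1)[of k] by simp
  qed
  define h where "h y = indicator {y. y \<bullet> n < 0} y * ((X p \<bullet> y) * \<phi> y)" for y
  have [measurable]: "h \<in> borel_measurable borel" unfolding h_def by measurable
  \<comment> \<open>For directions in the tangent plane \<open>outward_normal\<close> does not
    decide membership in \<Omega>; they form a null set.\<close>
  have hyper: "AE y in lborel. y \<bullet> n \<noteq> 0"
  proof -
    have "n \<noteq> 0" using nn by auto
    then have "negligible {y. n \<bullet> y = 0}" by (intro negligible_hyperplane) simp
    then have "AE y in lebesgue. y \<notin> {y. n \<bullet> y = 0}" by (intro AE_not_in) (simp add: negligible_iff_null_sets)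
    then have "AE y in lebesgue. y \<bullet> n \<noteq> 0" by (simp add: inner_commute)
    then show ?thesis by (simp add: AE_completion_iff)
  qed
  have "(\<lambda>k. LINT y|lborel. g k y) \<longlonglongrightarrow> (LINT y|lborel. h y)"
  proof (rule integral_dominated_convergence[where w = "\<lambda>y. (B1 + B2) * indicator (ball 0 1) y"])
    show "integrable lborel (\<lambda>y. (B1 + B2) * indicator (ball (0::real^3) 1) y)"
      using emeasure_bounded_finite[of "ball (0::real^3) 1"]
      by (intro integrable_mult_right integrable_real_indicator) auto
    show "AE y in lborel. norm (g k y) \<le> (B1 + B2) * indicator (ball 0 1) y" for k
    proof (rule AE_I2)
      fix y
      show "norm (g k y) \<le> (B1 + B2) * indicator (ball 0 1) y"
      proof (cases "y \<in> ball 0 1")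
        case True
        have "\<bar>X' (p + s k *\<^sub>R y) \<bullet> y\<bar> \<le> B1 * 1"
          by (rule order_trans[OF Cauchy_Schwarz_ineq2 mult_mono]) (use True X'B B0 in auto)
        then have 1: "\<bar>(X' (p + s k *\<^sub>R y) \<bullet> y) * \<phi> y\<bar> \<le> B1 * 1"
          unfolding abs_mult using \<phi>01[of y] B0 by (intro mult_mono) auto
        have "(\<phi> y)\<^sup>2 \<le> 1" using \<phi>01[of y] by (intro power_le_one)
        then have "\<bar>U' (p + s k *\<^sub>R y) * (\<phi> y)\<^sup>2\<bar> \<le> B2 * 1"
          unfolding abs_mult using U'B[of "p + s k *\<^sub>R y"] B0 by (intro mult_mono) auto
        then have "\<bar>s k / 4 * (U' (p + s k *\<^sub>R y) * (\<phi> y)\<^sup>2)\<bar> \<le> 1 * (B2 * 1)"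
          unfolding abs_mult[of "s k / 4"] using s[of k] B0 by (intro mult_mono) auto
        with 1 show ?thesis using True by (simp add: g_def)
      qed (simp add: g_def \<phi>0)
    qed
    show "AE y in lborel. (\<lambda>k. g k y) \<longlonglongrightarrow> h y"
      using hyper
    proof eventually_elim
      case (elim y)
      \<comment> \<open>Now \<open>e * norm y\<close> is half of
        \<open>\<bar>y \<bullet> n\<bar>\<close>, so the ray in direction \<open>y\<close> satisfies
        one of the strict inequalities in \<open>outward_normal\<close>.\<close>
      define e where "e = \<bar>y \<bullet> n\<bar> / (2 * norm y)"
      have y0: "norm y > 0" using elim by auto
      have e0: "e > 0" using elim y0 by (simp add: e_def)
      obtain r where r: "r > 0" and rn: "\<And>x. x \<in> ball p r \<Longrightarrow>
        ((x - p) \<bullet> n < - e * norm (x - p) \<longrightarrow> x \<in> \<Omega>) \<and> ((x - p) \<bullet> n > e * norm (x - p) \<longrightarrow> x \<notin> \<Omega>)"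
        using n e0 unfolding outward_normal_def by blast
      have lim: "(\<lambda>k. p + s k *\<^sub>R y) \<longlonglongrightarrow> p"
        using tendsto_add[OF tendsto_const[of p] tendsto_scaleR[OF s0 tendsto_const[of y]]] by simp
      then have ev: "\<forall>\<^sub>F k in sequentially. p + s k *\<^sub>R y \<in> ball p r"
        by (rule topological_tendstoD) (use r in auto)
      have en: "e * norm y = \<bar>y \<bullet> n\<bar> / 2" using y0 by (simp add: e_def)
      show ?case
      proof (cases "y \<bullet> n < 0")
        case True
        have in\<Omega>: "\<forall>\<^sub>F k in sequentially. p + s k *\<^sub>R y \<in> \<Omega>"
          using ev
        proof eventually_elim
          case (elim k)
          have "s k * (y \<bullet> n) < s k * (- (e * norm y))"
            unfolding en using True s(1)[of k] by (intro mult_strict_left_mono) auto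
          then show ?case using rn[OF elim] s(1)[of k] by (simp add: mult_ac)
        qed
        have "(\<lambda>k. X (p + s k *\<^sub>R y)) \<longlonglongrightarrow> X p"
          by (rule continuous_on_tendsto_compose[OF X lim pc])
            (use in\<Omega> closure_subset[of \<Omega>] in \<open>auto elim!: eventually_mono\<close>)
        moreover have "\<forall>\<^sub>F k in sequentially. X (p + s k *\<^sub>R y) = X' (p + s k *\<^sub>R y)"
          using in\<Omega> by eventually_elim (simp add: X'_def)
        ultimately have X'l: "(\<lambda>k. X' (p + s k *\<^sub>R y)) \<longlonglongrightarrow> X p" by (rule Lim_transform_eventually)
        have U'l: "(\<lambda>k. s k / 4 * (U' (p + s k *\<^sub>R y) * (\<phi> y)\<^sup>2)) \<longlonglongrightarrow> 0"
        proof (rule Lim_null_comparison[where g = "\<lambda>k. s k * B2"])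
          show "(\<lambda>k. s k * B2) \<longlonglongrightarrow> 0" using tendsto_mult[OF s0 tendsto_const[of B2]] by simp
          show "\<forall>\<^sub>F k in sequentially. norm (s k / 4 * (U' (p + s k *\<^sub>R y) * (\<phi> y)\<^sup>2)) \<le> s k * B2"
          proof (rule always_eventually, intro allI)
            fix k
            have "(\<phi> y)\<^sup>2 \<le> 1" using \<phi>01[of y] by (intro power_le_one)
            then have "\<bar>U' (p + s k *\<^sub>R y) * (\<phi> y)\<^sup>2\<bar> \<le> B2 * 1"
              unfolding abs_mult using U'B[of "p + s k *\<^sub>R y"] B0 by (intro mult_mono) auto
            then have "\<bar>s k / 4 * (U' (p + s k *\<^sub>R y) * (\<phi> y)\<^sup>2)\<bar> \<le> s k * (B2 * 1)"
              unfolding abs_mult[of "s k / 4"] using s[of k] B0 by (intro mult_mono) auto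
            then show "norm (s k / 4 * (U' (p + s k *\<^sub>R y) * (\<phi> y)\<^sup>2)) \<le> s k * B2" by simp
          qed
        qed
        have "(\<lambda>k. g k y) \<longlonglongrightarrow> (X p \<bullet> y) * \<phi> y - 0"
          unfolding g_def by (intro tendsto_diff U'l tendsto_mult tendsto_inner X'l tendsto_const)
        then show ?thesis using True by (simp add: h_def)
      next
        case False
        have "\<forall>\<^sub>F k in sequentially. p + s k *\<^sub>R y \<notin> \<Omega>"
          using ev
        proof eventually_elim
          case (elim k)
          have "s k * (y \<bullet> n) > s k * (e * norm y)"
            unfolding en using False \<open>y \<bullet> n \<noteq> 0\<close> s(1)[of k] by (intro mult_strict_left_mono) auto
          then show ?case using rn[OF elim] s(1)[of k] by (simp add: mult_ac)
        qed
        then have "\<forall>\<^sub>F k in sequentially. g k y = 0" by eventually_elim (simp add: g_def X'_def U'_def)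
        then have "(\<lambda>k. g k y) \<longlonglongrightarrow> 0" by (rule tendsto_eventually)
        then show ?thesis using False by (simp add: h_def)
      qed
    qed
  qed auto
  then have h0: "(LINT y|lborel. h y) = 0" by (simp add: int0 LIMSEQ_const_iff)
  define R where "R y = 2 *\<^sub>R ((y \<bullet> n) *\<^sub>R n) - y" for y :: "real^3"
  have n2: "n \<bullet> n = 1" using nn by (simp add: norm_eq_1)
  have Rn: "R y \<bullet> n = y \<bullet> n" for y by (simp add: R_def inner_diff_left n2)
  have "R y \<bullet> R y = y \<bullet> y" for y by (simp add: R_def inner_diff_left inner_diff_right n2 inner_commute)
  then have normR: "norm (R y) = norm y" for y by (simp add: norm_eq_sqrt_inner)
  have \<phi>R: "\<phi> (R y) = \<phi> y" for y by (simp add: \<phi>_def normR)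
  have hB: "norm (h y) \<le> B1 * indicator (ball 0 1) y" for y
  proof (cases "y \<in> ball 0 1")
    case True
    have "\<bar>X p \<bullet> y\<bar> \<le> B1 * 1"
      by (rule order_trans[OF Cauchy_Schwarz_ineq2 mult_mono]) (use True B1[OF pc] B0 in auto)
    then have "\<bar>(X p \<bullet> y) * \<phi> y\<bar> \<le> B1 * 1"
      unfolding abs_mult using \<phi>01[of y] B0 by (intro mult_mono) auto
    then show ?thesis using B0 True by (simp add: h_def indicator_def)
  qed (simp add: h_def \<phi>0)
  have hint': "integrable lborel (\<lambda>y. h (T y))" if "\<And>y. norm (T y) = norm y" "T \<in> borel_measurable borel" for T :: "real^3 \<Rightarrow> real^3"
  proof (rule Bochner_Integration.integrable_bound)
    show "integrable lborel (\<lambda>y. B1 * indicator (ball (0::real^3) 1) y)"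
      using emeasure_bounded_finite[of "ball (0::real^3) 1"]
      by (intro integrable_mult_right integrable_real_indicator) auto
    show "(\<lambda>y. h (T y)) \<in> borel_measurable lborel"
      using measurable_compose[OF that(2), of h borel] by simp
    show "AE y in lborel. norm (h (T y)) \<le> norm (B1 * indicator (ball (0::real^3) 1) y)"
    proof (rule AE_I2)
      fix y
      show "norm (h (T y)) \<le> norm (B1 * indicator (ball (0::real^3) 1) y)"
        using hB[of "T y"] that(1)[of y] B0 by (simp add: indicator_def split: if_splits)
    qed
  qed
  have hint: "integrable lborel h" using hint'[of "\<lambda>y. y"] by simp
  have hR: "(LINT y|lborel. h (R y)) = 0"
    using lborel_integral_rotation[OF nn, of h] h0 by (simp add: R_def)
  have "R \<in> borel_measurable borel" unfolding R_def by measurable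
  then have hRint: "integrable lborel (\<lambda>y. h (R y))" by (intro hint' normR)
  define k where "k y = indicator {y. y \<bullet> n < 0} y * (- (y \<bullet> n) * \<phi> y)" for y
  \<comment> \<open>\<open>y + R y\<close> is twice the normal part of \<open>y\<close>, so adding
    the two integrals leaves the normal component of \<open>X p\<close> times a nonnegative
    weight.\<close>
  have sumh: "h y + h (R y) = (- 2 * (X p \<bullet> n)) * k y" for y
  proof -
    have "X p \<bullet> y + X p \<bullet> R y = 2 * (y \<bullet> n) * (X p \<bullet> n)" by (simp add: R_def inner_diff_right)
    moreover have "h y + h (R y) = indicator {y. y \<bullet> n < 0} y * ((X p \<bullet> y + X p \<bullet> R y) * \<phi> y)"
      by (simp add: h_def Rn \<phi>R indicator_def algebra_simps)
    ultimately show ?thesis by (simp add: k_def)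
  qed
  show ?thesis
  proof (rule ccontr)
    assume a: "X p \<bullet> n \<noteq> 0"
    have "integrable lborel (\<lambda>y. (- 2 * (X p \<bullet> n)) * k y)" "(LINT y|lborel. (- 2 * (X p \<bullet> n)) * k y) = 0"
      unfolding sumh[symmetric] using hint hRint h0 hR by auto
    then have kint: "integrable lborel k" "(LINT y|lborel. k y) = 0" using a by auto
    have k0: "k y \<ge> 0" for y using \<phi>01[of y] by (simp add: k_def indicator_def mult_nonpos_nonneg)
    have "AE y in lborel. k y = 0" using kint k0 by (subst integral_nonneg_eq_0_iff_AE[symmetric]) auto
    \<comment> \<open>A ball inside both the half-space and the unit ball, where the weight
      \<open>k\<close> is positive.\<close>
    then have "AE y in lborel. y \<notin> ball (- (1/2) *\<^sub>R n) (1/2)"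
    proof (rule AE_mp, intro AE_I2 impI notI)
      fix y assume ky: "k y = 0" and y: "y \<in> ball (- (1/2) *\<^sub>R n) (1/2)"
      define z where "z = y + (1/2) *\<^sub>R n"
      have z: "norm z < 1/2" using y by (simp add: z_def dist_norm norm_minus_commute add.commute)
      have yz: "y = z - (1/2) *\<^sub>R n" by (simp add: z_def)
      have "\<bar>z \<bullet> n\<bar> \<le> norm z" using Cauchy_Schwarz_ineq2[of z n] nn by simp
      then have "y \<bullet> n < 0" using z unfolding yz by (simp add: inner_diff_left n2)
      moreover have "norm y < 1" using norm_triangle_ineq4[of z "(1/2) *\<^sub>R n"] z nn unfolding yz by simp
      then have "\<phi> y > 0" using power_strict_mono[of "norm y" 1 2] by (simp add: \<phi>_def)
      ultimately show False using ky by (simp add: k_def)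
    qed
    then have "emeasure lborel (ball (- (1/2) *\<^sub>R n) (1/2)) = 0"
      by (subst (asm) AE_iff_measurable[of "ball (- (1/2) *\<^sub>R n) (1/2)"]) auto
    then have "measure lborel (ball (- (1/2) *\<^sub>R n) (1/2)) = 0" by (simp add: measure_def)
    then show False using content_ball_pos[of "1/2" "- (1/2) *\<^sub>R n"] by simp
  qed
qed

end

section \<open>Thick points of a set\<close>

text \<open>The opposite of porosity of \<open>S\<close> at \<open>q\<close>, in the directions
  allowed by \<open>C\<close>. In this form Lebesgue density can be exploited by a Lipschitz
  function that vanishes on \<open>S\<close>.\<close>

definition thick_in :: "('a::euclidean_space \<Rightarrow> bool) \<Rightarrow> 'a set \<Rightarrow> 'a \<Rightarrow> bool" where
  "thick_in C S q \<longleftrightarrow> (\<forall>\<epsilon>>0. \<exists>\<rho>>0. \<forall>q'\<in>ball q \<rho>. C (q' - q) \<longrightarrow> (\<exists>q''\<in>S. norm (q' - q'') \<le> \<epsilon> * norm (q' - q)))"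

abbreviation thick :: "'a::euclidean_space set \<Rightarrow> 'a \<Rightarrow> bool" where
  "thick \<equiv> thick_in (\<lambda>_. True)"

text \<open>A cube of side \<open>c * r\<close> free of \<open>S\<close>, next to a point at
  distance \<open>r\<close> from a density point, would occupy the fraction
  \<open>(c / 2) ^ DIM('a)\<close> of the cube of side \<open>2 * r\<close>, against density
  1.\<close>

lemma thick_positive_AE:
  fixes S :: "'a::euclidean_space set"
  assumes S: "S \<in> lmeasurable"
  shows "\<exists>N. negligible N \<and> (\<forall>q\<in>S - N. thick_in (\<lambda>w. \<forall>b\<in>Basis. 0 \<le> w \<bullet> b) S q)"
proof -
  have SI: "S \<inter> cbox a b \<in> lmeasurable" for a b using S by (intro fmeasurable_Int_fmeasurable) auto
  have eq: "integral (cbox a b) (indicator S) = measure lebesgue (S \<inter> cbox a b)" for a b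
    using integral_indicator[OF SI[of a b]] by simp
  have "(indicator S :: 'a \<Rightarrow> real) integrable_on cbox a b" for a b
    using SI[of a b] by (simp add: integrable_on_indicator)
  then obtain N where N: "negligible N" "\<And>x e. x \<notin> N \<Longrightarrow> 0 < e \<Longrightarrow> \<exists>d>0. \<forall>h. 0 < h \<and> h < d \<longrightarrow>
      norm (integral (cbox x (x + h *\<^sub>R One)) (indicator S :: 'a \<Rightarrow> real) /\<^sub>R h ^ DIM('a) - indicator S x) < e"
    using integrable_ccontinuous_explicit[of "indicator S :: 'a \<Rightarrow> real"] by metis
  have "thick_in (\<lambda>w. \<forall>b\<in>Basis. 0 \<le> w \<bullet> b) S q" if q: "q \<in> S - N" for q
    unfolding thick_in_def
  proof (intro allI impI)
    fix \<epsilon> :: real assume "\<epsilon> > 0"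
    define D where "D = real DIM('a)"
    have D1: "D \<ge> 1" by (simp add: D_def Suc_leI)
    \<comment> \<open>The sum of the edges of the small cube, \<open>D * c * r\<close>, must be at
      most \<open>\<epsilon> * r\<close>; the bound 1 lets the small cube fit into the big
      one.\<close>
    define c where "c = min 1 (\<epsilon> / D)"
    have c: "c > 0" "c \<le> 1" "c * D \<le> \<epsilon>" using \<open>\<epsilon> > 0\<close> D1 by (auto simp: c_def min_def field_simps)
    have c2: "(c / 2) ^ DIM('a) > 0" using c by simp
    have "q \<notin> N" using q by simp
    from N(2)[OF this c2] obtain d where d: "d > 0" "\<And>h. 0 < h \<Longrightarrow> h < d \<Longrightarrow>
      norm (integral (cbox q (q + h *\<^sub>R One)) (indicator S :: 'a \<Rightarrow> real) /\<^sub>R h ^ DIM('a) - indicator S q) < (c / 2) ^ DIM('a)"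
      by blast
    show "\<exists>\<rho>>0. \<forall>q'\<in>ball q \<rho>. (\<forall>b\<in>Basis. 0 \<le> (q' - q) \<bullet> b) \<longrightarrow> (\<exists>q''\<in>S. norm (q' - q'') \<le> \<epsilon> * norm (q' - q))"
    proof (intro exI[of _ "d / 2"] conjI ballI impI)
      show "d / 2 > 0" using d by simp
      fix q' assume q': "q' \<in> ball q (d / 2)" and pos: "\<forall>b\<in>Basis. 0 \<le> (q' - q) \<bullet> b"
      define r where "r = norm (q' - q)"
      show "\<exists>q''\<in>S. norm (q' - q'') \<le> \<epsilon> * norm (q' - q)"
      proof (cases "r = 0")
        case True
        then show ?thesis using q by (intro bexI[of _ q]) (auto simp: r_def)
      next
        case False
        then have r: "r > 0" "2 * r < d" using q' by (auto simp: r_def dist_norm norm_minus_commute)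
        define big where "big = cbox q (q + (2 * r) *\<^sub>R One)"
        define small where "small = cbox q' (q' + (c * r) *\<^sub>R One)"
        have sub: "small \<subseteq> big"
        proof
          fix x assume x: "x \<in> small"
          have "q \<bullet> b \<le> x \<bullet> b \<and> x \<bullet> b \<le> q \<bullet> b + 2 * r" if b: "b \<in> Basis" for b
          proof -
            have 1: "q' \<bullet> b \<le> x \<bullet> b" "x \<bullet> b \<le> q' \<bullet> b + c * r"
              using x b by (auto simp: small_def mem_box inner_add_left)
            have 2: "0 \<le> q' \<bullet> b - q \<bullet> b" using pos b by (simp add: inner_diff_left)
            have 3: "q' \<bullet> b - q \<bullet> b \<le> r" using Basis_le_norm[OF b, of "q' - q"] by (simp add: inner_diff_left r_def)
            have "c * r \<le> 1 * r" using c r by (intro mult_right_mono) auto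
            then show ?thesis using 1 2 3 by linarith
          qed
          then show "x \<in> big" by (simp add: big_def mem_box inner_add_left)
        qed
        have cube: "measure lebesgue (cbox x (x + a *\<^sub>R One)) = a ^ DIM('a)" if "a \<ge> 0" for x :: 'a and a
        proof -
          have "measure lborel (cbox x (x + a *\<^sub>R One)) = a ^ DIM('a)"
            using that by (subst content_cbox) (auto simp: inner_add_left)
          then show ?thesis by simp
        qed
        have mbig: "measure lebesgue big = (2 * r) ^ DIM('a)" unfolding big_def using r by (intro cube) simp
        have msmall: "measure lebesgue small = (c * r) ^ DIM('a)" unfolding small_def using r c by (intro cube) simp
        have "S \<inter> small \<noteq> {}"
        proof
          assume e: "S \<inter> small = {}"
          have "measure lebesgue (S \<inter> big) \<le> measure lebesgue (big - small)"
            using e SI by (intro measure_mono_fmeasurable) (auto simp: big_def small_def fmeasurable_Diff)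
          also have "\<dots> = measure lebesgue big - measure lebesgue small"
            using sub by (intro measurable_measure_Diff) (auto simp: big_def small_def)
          finally have le: "measure lebesgue (S \<inter> big) \<le> (2 * r) ^ DIM('a) - (c * r) ^ DIM('a)" by (simp add: mbig msmall)
          have "norm (measure lebesgue (S \<inter> big) /\<^sub>R (2 * r) ^ DIM('a) - 1) < (c / 2) ^ DIM('a)"
            using d(2)[of "2 * r"] r q unfolding eq big_def by simp
          moreover have "m /\<^sub>R k = m / k" for m k :: real by (simp add: divide_inverse mult.commute)
          ultimately have "1 - (c / 2) ^ DIM('a) < measure lebesgue (S \<inter> big) / (2 * r) ^ DIM('a)"
            by (simp only: real_norm_def)
          also have "\<dots> \<le> ((2 * r) ^ DIM('a) - (c * r) ^ DIM('a)) / (2 * r) ^ DIM('a)"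
            using le r by (intro divide_right_mono) auto
          also have "\<dots> = 1 - (c / 2) ^ DIM('a)"
            using r by (simp add: diff_divide_distrib power_mult_distrib power_divide)
          finally show False by simp
        qed
        then obtain q'' where q'': "q'' \<in> S" "q'' \<in> small" by blast
        have "norm (q' - q'') \<le> (\<Sum>b\<in>Basis. \<bar>(q' - q'') \<bullet> b\<bar>)" by (rule norm_le_l1)
        also have "\<dots> \<le> (\<Sum>b\<in>(Basis::'a set). c * r)"
          using q''(2) by (intro sum_mono) (auto simp: small_def mem_box inner_add_left inner_diff_left abs_le_iff)
        also have "\<dots> = (c * D) * r" by (simp add: D_def)
        also have "\<dots> \<le> \<epsilon> * r" using c r by (intro mult_right_mono) auto
        finally show ?thesis using q'' by (auto simp: r_def)
      qed
    qed
  qed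
  with N(1) show ?thesis by blast
qed

text \<open>The density theorem of the library uses boxes with the point as lower corner; reflecting the
  coordinate axes covers the other orthants.\<close>

lemma thick_AE:
  fixes S :: "(real^'n) set"
  assumes S: "compact S"
  shows "\<exists>N. negligible N \<and> (\<forall>q\<in>S - N. thick S q)"
proof -
  define T where "T s x = (\<chi> i. (if s i then 1 else -1) * x $ i)" for s :: "'n \<Rightarrow> bool" and x :: "real^'n"
  have lin: "linear (T s)" for s by (intro linearI) (auto simp: T_def vec_eq_iff algebra_simps)
  have TT: "T s (T s x) = x" for s x by (simp add: T_def vec_eq_iff)
  have nT: "norm (T s x) = norm x" for s x
    by (simp add: norm_eq_sqrt_inner inner_vec_def T_def) (auto intro!: sum.cong)
  have Td: "T s x - T s y = T s (x - y)" for s x y using lin by (simp add: linear_diff)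
  have ex: "\<exists>N. negligible N \<and> (\<forall>q\<in>T s ` S - N. thick_in (\<lambda>w. \<forall>b\<in>Basis. 0 \<le> w \<bullet> b) (T s ` S) q)" for s
    by (intro thick_positive_AE lmeasurable_compact compact_continuous_image S linear_continuous_on
        linear_conv_bounded_linear[THEN iffD1] lin)
  then have "\<forall>s. \<exists>N. negligible N \<and> (\<forall>q\<in>T s ` S - N. thick_in (\<lambda>w. \<forall>b\<in>Basis. 0 \<le> w \<bullet> b) (T s ` S) q)"
    by (intro allI)
  from choice[OF this] obtain N where N: "\<And>s. negligible (N s)"
    "\<And>s q. q \<in> T s ` S - N s \<Longrightarrow> thick_in (\<lambda>w. \<forall>b\<in>Basis. 0 \<le> w \<bullet> b) (T s ` S) q" by blast
  define N' where "N' = (\<Union>s. T s ` N s)"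
  have "negligible N'" unfolding N'_def
    using N(1) lin by (intro negligible_Union) (auto intro!: negligible_differentiable_image_negligible linear_imp_differentiable_on)
  moreover have "thick S q" if q: "q \<in> S - N'" for q
    unfolding thick_in_def
  proof (intro allI impI)
    fix \<epsilon> :: real assume \<epsilon>: "\<epsilon> > 0"
    have "\<exists>\<rho>>0. \<forall>q'\<in>ball (T s q) \<rho>. (\<forall>b\<in>Basis. 0 \<le> (q' - T s q) \<bullet> b) \<longrightarrow> (\<exists>q''\<in>T s ` S. norm (q' - q'') \<le> \<epsilon> * norm (q' - T s q))" for s
    proof -
      have "T s q \<notin> N s"
      proof
        assume "T s q \<in> N s"
        then have "T s (T s q) \<in> N'" unfolding N'_def by blast
        then show False using q TT by simp
      qed
      then have "thick_in (\<lambda>w. \<forall>b\<in>Basis. 0 \<le> w \<bullet> b) (T s ` S) (T s q)" using N(2) q by blast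
      then show ?thesis using \<epsilon> unfolding thick_in_def by blast
    qed
    then have "\<forall>s. \<exists>\<rho>>0. \<forall>q'\<in>ball (T s q) \<rho>. (\<forall>b\<in>Basis. 0 \<le> (q' - T s q) \<bullet> b) \<longrightarrow> (\<exists>q''\<in>T s ` S. norm (q' - q'') \<le> \<epsilon> * norm (q' - T s q))"
      by (intro allI)
    from choice[OF this] obtain \<rho> where \<rho>: "\<And>s. \<rho> s > 0" "\<And>s q'. q' \<in> ball (T s q) (\<rho> s) \<Longrightarrow> (\<forall>b\<in>Basis. 0 \<le> (q' - T s q) \<bullet> b) \<Longrightarrow>
      (\<exists>q''\<in>T s ` S. norm (q' - q'') \<le> \<epsilon> * norm (q' - T s q))" by blast
    show "\<exists>\<rho>>0. \<forall>q'\<in>ball q \<rho>. True \<longrightarrow> (\<exists>q''\<in>S. norm (q' - q'') \<le> \<epsilon> * norm (q' - q))"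
    proof (intro exI[of _ "Min (range \<rho>)"] conjI ballI impI)
      \<comment> \<open>There are finitely many sign patterns, so a common radius exists.\<close>
      show "Min (range \<rho>) > 0" using \<rho>(1) by (subst Min_gr_iff) auto
      fix q' assume q': "q' \<in> ball q (Min (range \<rho>))"
      \<comment> \<open>The reflection that takes \<open>q' - q\<close> to the nonnegative
        orthant.\<close>
      define s where "s i \<longleftrightarrow> q $ i \<le> q' $ i" for i
      have "Min (range \<rho>) \<le> \<rho> s" by (intro Min_le) auto
      then have "T s q' \<in> ball (T s q) (\<rho> s)" using q' by (simp add: dist_norm Td nT)
      moreover have "\<forall>b\<in>Basis. 0 \<le> (T s q' - T s q) \<bullet> b"
        by (auto simp: Basis_vec_def inner_axis T_def s_def)
      ultimately obtain q'' where "q'' \<in> S" "norm (T s q' - T s q'') \<le> \<epsilon> * norm (T s q' - T s q)" using \<rho>(2) by blast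
      then show "\<exists>q''\<in>S. norm (q' - q'') \<le> \<epsilon> * norm (q' - q)" unfolding Td nT by blast
    qed
  qed
  ultimately show ?thesis by blast
qed

section \<open>The normal on the flat part\<close>

text \<open>In the direction \<open>n' - n\<close> the two half-spaces contradict each other: points
  close to \<open>p\<close> are inside according to \<open>n\<close> and outside according to
  \<open>n'\<close>.\<close>

lemma outward_normal_unique:
  assumes n: "outward_normal \<Omega> p n" and n': "outward_normal \<Omega> p n'"
  shows "n = n'"
proof (rule ccontr)
  assume ne: "n \<noteq> n'"
  have nn: "norm n = 1" "norm n' = 1" using n n' by (auto simp: outward_normal_def)
  then have i1: "n \<bullet> n = 1" "n' \<bullet> n' = 1" by (auto simp: norm_eq_1)
  define w where "w = n' - n"
  have "(norm w)\<^sup>2 = 2 - 2 * (n \<bullet> n')"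
    unfolding w_def power2_norm_eq_inner by (simp add: inner_diff_left inner_diff_right i1 inner_commute)
  moreover have wpos: "norm w > 0" using ne by (simp add: w_def)
  ultimately have c: "n \<bullet> n' < 1" by (smt (verit) zero_less_power)
  have "w \<bullet> n = n \<bullet> n' - 1" "w \<bullet> n' = 1 - n \<bullet> n'"
    by (simp_all add: w_def inner_diff_left i1 inner_commute[of n' n])
  then have wn: "w \<bullet> n < 0" "w \<bullet> n' > 0" using c by linarith+
  define e where "e = min (- (w \<bullet> n)) (w \<bullet> n') / (2 * norm w)"
  have e: "e > 0" "e * norm w < - (w \<bullet> n)" "e * norm w < w \<bullet> n'" using wn wpos by (auto simp: e_def min_def)
  obtain r where r: "r > 0" "\<And>x. x \<in> ball p r \<Longrightarrow> (x - p) \<bullet> n < - e * norm (x - p) \<Longrightarrow> x \<in> \<Omega>"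
    using n e(1) unfolding outward_normal_def by metis
  obtain r' where r': "r' > 0" "\<And>x. x \<in> ball p r' \<Longrightarrow> (x - p) \<bullet> n' > e * norm (x - p) \<Longrightarrow> x \<notin> \<Omega>"
    using n' e(1) unfolding outward_normal_def by metis
  define t where "t = min r r' / (2 * norm w)"
  have t: "t > 0" "t * norm w < r" "t * norm w < r'" using r(1) r'(1) wpos by (auto simp: t_def min_def)
  have "p + t *\<^sub>R w \<in> \<Omega>"
  proof (rule r(2))
    show "p + t *\<^sub>R w \<in> ball p r" using t by (simp add: dist_norm)
    have "t * (w \<bullet> n) < t * (- (e * norm w))" using e t by (intro mult_strict_left_mono) auto
    then show "(p + t *\<^sub>R w - p) \<bullet> n < - e * norm (p + t *\<^sub>R w - p)" using t by (simp add: mult_ac)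
  qed
  moreover have "p + t *\<^sub>R w \<notin> \<Omega>"
  proof (rule r'(2))
    show "p + t *\<^sub>R w \<in> ball p r'" using t by (simp add: dist_norm)
    have "t * (w \<bullet> n') > t * (e * norm w)" using e t by (intro mult_strict_left_mono) auto
    then show "(p + t *\<^sub>R w - p) \<bullet> n' > e * norm (p + t *\<^sub>R w - p)" using t by (simp add: mult_ac)
  qed
  ultimately show False by blast
qed

lemma unit_normal_eq: "outward_normal \<Omega> p n \<Longrightarrow> unit_normal \<Omega> p = n"
  unfolding unit_normal_def using outward_normal_unique by blast

section \<open>Coordinates in the plane of the flat portion\<close>

definition plane_coord :: "real^3 \<Rightarrow> real^2" where
  "plane_coord x = vector [x $ 1, x $ 2]"

lemma on_plane_nth [simp]: "on_plane q $ 1 = q $ 1" "on_plane q $ 2 = q $ 2" "on_plane q $ 3 = 0"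
  by (simp_all add: on_plane_def)

lemma plane_coord_nth [simp]: "plane_coord x $ 1 = x $ 1" "plane_coord x $ 2 = x $ 2"
  by (simp_all add: plane_coord_def)

lemma on_plane_coord: "x $ 3 = 0 \<Longrightarrow> on_plane (plane_coord x) = x"
  by (simp add: vec_eq_iff forall_3)

lemma plane_coord_on_plane [simp]: "plane_coord (on_plane q) = q"
  by (simp add: vec_eq_iff forall_2)

lemma linear_on_plane: "linear on_plane"
  by (intro linearI) (simp_all add: vec_eq_iff forall_3)

lemma linear_plane_coord: "linear plane_coord"
  by (intro linearI) (simp_all add: vec_eq_iff forall_2)

lemma norm_on_plane [simp]: "norm (on_plane q) = norm q"
  by (simp add: norm_eq_sqrt_inner inner_vec_def sum_3 sum_2)

lemma on_plane_diff: "on_plane a - on_plane b = on_plane (a - b)"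
  using linear_on_plane by (simp add: linear_diff)

lemma dist_on_plane [simp]: "dist (on_plane a) (on_plane b) = dist a b"
  by (simp add: dist_norm on_plane_diff)

lemma continuous_on_plane: "continuous_on S on_plane"
  by (intro linear_continuous_on linear_conv_bounded_linear[THEN iffD1] linear_on_plane)

abbreviation flat_coords :: "(real^3) set \<Rightarrow> (real^2) set" where
  "flat_coords \<Omega> \<equiv> {q. on_plane q \<in> flat_part \<Omega>}"

lemma flat_coords_alt: "flat_coords \<Omega> = on_plane -` frontier \<Omega>"
  by (auto simp: flat_part_def)

lemma compact_flat_coords: "bounded \<Omega> \<Longrightarrow> compact (flat_coords \<Omega>)"
proof -
  assume bd: "bounded \<Omega>"
  have "closed (flat_coords \<Omega>)"
    unfolding flat_coords_alt by (intro closed_vimage continuous_on_plane) simp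
  moreover have "bounded (flat_coords \<Omega>)"
  proof -
    obtain B where "\<And>x. x \<in> frontier \<Omega> \<Longrightarrow> norm x \<le> B" using compact_imp_bounded[OF compact_frontier_bounded[OF bd]] by (auto simp: bounded_iff)
    then have "norm q \<le> B" if "q \<in> flat_coords \<Omega>" for q using that norm_on_plane[of q] by (fastforce simp: flat_part_def)
    then show ?thesis by (auto simp: bounded_iff)
  qed
  ultimately show ?thesis by (simp add: compact_eq_bounded_closed)
qed

text \<open>\<open>H\<close> is Lipschitz and vanishes on the flat portion, so by thickness it is
  small of first order on the plane. Since it has slope -1 along \<open>e\<close>, the axis cannot
  lie in the plane, and up to this small error the sign of \<open>H\<close> at \<open>x\<close> is
  decided by the signed distance of \<open>x\<close> to the plane, measured along
  \<open>e\<close>.\<close>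

lemma outward_normal_thick:
  assumes op: "open \<Omega>" and c: "lip_chart \<Omega> p0 e H K r" and q: "on_plane q \<in> ball p0 r" "q \<in> flat_coords \<Omega>"
    and th: "thick (flat_coords \<Omega>) q"
  shows "e $ 3 \<noteq> 0" "outward_normal \<Omega> (on_plane q) (- sgn (e $ 3) *\<^sub>R axis 3 1)"
proof -
  define p where "p = on_plane q"
  have K: "K > 0" "\<And>x y. \<bar>H x - H y\<bar> \<le> K * norm (x - y)" and e: "norm e = 1"
    and sh: "\<And>x t. H (x + t *\<^sub>R e) = H x - t"
    and \<Omega>: "\<And>x. x \<in> ball p0 r \<Longrightarrow> x \<in> \<Omega> \<longleftrightarrow> H x < 0"
    using c by (auto simp: lip_chart_def)
  obtain d where d: "d > 0" "ball p d \<subseteq> ball p0 r" using q open_ball open_contains_ball unfolding p_def by metis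
  have th': "\<exists>\<rho>>0. \<forall>q'\<in>ball q \<rho>. \<bar>H (on_plane q')\<bar> \<le> \<epsilon> * norm (q' - q)" if \<epsilon>: "\<epsilon> > 0" for \<epsilon>
  proof -
    \<comment> \<open>The bound 1 keeps \<open>q''\<close> in the chart ball, the bound
      \<open>\<epsilon> / K\<close> compensates the Lipschitz constant.\<close>
    define \<epsilon>' where "\<epsilon>' = min 1 (\<epsilon> / K)"
    have \<epsilon>': "\<epsilon>' > 0" "\<epsilon>' \<le> 1" "K * \<epsilon>' \<le> \<epsilon>" using \<epsilon> K by (auto simp: \<epsilon>'_def min_def field_simps)
    obtain \<rho> where \<rho>: "\<rho> > 0" "\<And>q'. q' \<in> ball q \<rho> \<Longrightarrow> \<exists>q''\<in>flat_coords \<Omega>. norm (q' - q'') \<le> \<epsilon>' * norm (q' - q)"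
      using th \<epsilon>'(1) unfolding thick_in_def by auto
    have "\<bar>H (on_plane q')\<bar> \<le> \<epsilon> * norm (q' - q)" if q': "q' \<in> ball q (min \<rho> (d / 2))" for q'
    proof -
      obtain q'' where q'': "on_plane q'' \<in> frontier \<Omega>" "norm (q' - q'') \<le> \<epsilon>' * norm (q' - q)"
        using \<rho>(2)[of q'] q' by (auto simp: flat_part_def)
      have "norm (q' - q'') \<le> 1 * norm (q' - q)"
        by (rule order_trans[OF q''(2)]) (use \<epsilon>' in \<open>intro mult_right_mono, auto\<close>)
      then have "dist q q'' < d" using q' dist_triangle[of q q'' q'] by (simp add: dist_norm norm_minus_commute)
      then have "on_plane q'' \<in> ball p0 r" using d unfolding p_def by (metis dist_on_plane mem_ball subsetD)
      then have "H (on_plane q'') = 0" using lip_chart_frontier[OF c op] q'' by blast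
      then have "\<bar>H (on_plane q')\<bar> \<le> K * norm (q' - q'')" using K(2)[of "on_plane q'" "on_plane q''"] by (simp add: on_plane_diff)
      also have "\<dots> \<le> K * (\<epsilon>' * norm (q' - q))" using q'' K by (intro mult_left_mono) auto
      also have "\<dots> = (K * \<epsilon>') * norm (q' - q)" by simp
      also have "\<dots> \<le> \<epsilon> * norm (q' - q)" using \<epsilon>' by (intro mult_right_mono) auto
      finally show ?thesis .
    qed
    then show ?thesis using \<rho> d by (intro exI[of _ "min \<rho> (d / 2)"]) auto
  qed
  have Hp: "H p = 0" using lip_chart_frontier[OF c op] q by (auto simp: p_def flat_part_def)
  show e3: "e $ 3 \<noteq> 0"
  proof
    assume e3: "e $ 3 = 0"
    obtain \<rho> where \<rho>: "\<rho> > 0" "\<And>q'. q' \<in> ball q \<rho> \<Longrightarrow> \<bar>H (on_plane q')\<bar> \<le> (1/2) * norm (q' - q)" using th'[of "1/2"] by auto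
    define t where "t = \<rho> / 2"
    define q' where "q' = q + t *\<^sub>R plane_coord e"
    have pe: "on_plane (plane_coord e) = e" using e3 by (rule on_plane_coord)
    then have ne: "norm (plane_coord e) = 1" using e norm_on_plane[of "plane_coord e"] by simp
    have "on_plane q' = p + t *\<^sub>R e" unfolding q'_def p_def using linear_on_plane pe by (simp add: linear_add linear_scale)
    then have "H (on_plane q') = - t" using sh Hp by simp
    moreover have "norm (q' - q) = t" using ne \<rho> by (simp add: q'_def t_def)
    ultimately show False using \<rho>(2)[of q'] \<rho>(1) by (simp add: t_def dist_norm norm_minus_commute)
  qed
  define a where "a = \<bar>e $ 3\<bar>"
  have a: "0 < a" "a \<le> 1" using e3 component_le_norm_cart[of e 3] e by (auto simp: a_def)
  define n where "n = - sgn (e $ 3) *\<^sub>R (axis 3 1 :: real^3)"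
  have nn: "norm n = 1" using e3 by (simp add: n_def)
  have "outward_normal \<Omega> p n"
    unfolding outward_normal_def
  proof (intro conjI allI impI)
    show "p \<in> frontier \<Omega>" using q by (simp add: p_def flat_part_def)
    show "norm n = 1" by (rule nn)
    fix \<epsilon> :: real assume \<epsilon>: "\<epsilon> > 0"
    \<comment> \<open>Projecting along \<open>e\<close> onto the plane enlarges the distance to
      \<open>p\<close> at most by this factor, since a unit step along \<open>e\<close> changes the
      height by \<open>a\<close>.\<close>
    define C where "C = 1 + 1 / a"
    have C: "C > 0" using a by (simp add: C_def add_pos_pos)
    have "\<epsilon> / (2 * C) > 0" using \<epsilon> C by simp
    from th'[OF this] obtain \<rho> where \<rho>: "\<rho> > 0" "\<And>q'. q' \<in> ball q \<rho> \<Longrightarrow> \<bar>H (on_plane q')\<bar> \<le> \<epsilon> / (2 * C) * norm (q' - q)" by auto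
    show "\<exists>r>0. \<forall>x\<in>ball p r. ((x - p) \<bullet> n < - \<epsilon> * norm (x - p) \<longrightarrow> x \<in> \<Omega>) \<and> (\<epsilon> * norm (x - p) < (x - p) \<bullet> n \<longrightarrow> x \<notin> \<Omega>)"
    proof (intro exI[of _ "min d (\<rho> / C)"] conjI ballI)
      show "min d (\<rho> / C) > 0" using d \<rho> C by simp
      fix x assume x: "x \<in> ball p (min d (\<rho> / C))"
      then have xb: "x \<in> ball p0 r" using d by auto
      define t where "t = x $ 3 / e $ 3"
      define x' where "x' = x - t *\<^sub>R e"
      have x'3: "x' $ 3 = 0" using e3 by (simp add: x'_def t_def)
      define q' where "q' = plane_coord x'"
      have q'x: "on_plane q' = x'" unfolding q'_def by (rule on_plane_coord[OF x'3])
      have p3: "p $ 3 = 0" by (simp add: p_def)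
      have "\<bar>x $ 3\<bar> \<le> norm (x - p)" using component_le_norm_cart[of "x - p" 3] p3 by simp
      then have "\<bar>t\<bar> \<le> norm (x - p) / a" using a by (simp add: t_def a_def abs_divide divide_right_mono)
      moreover have "norm (x' - p) \<le> norm (x - p) + \<bar>t\<bar>"
        using norm_triangle_ineq4[of "x - p" "t *\<^sub>R e"] e by (simp add: x'_def algebra_simps)
      ultimately have x'n: "norm (x' - p) \<le> C * norm (x - p)" by (simp add: C_def algebra_simps)
      have qq: "norm (q' - q) = norm (x' - p)" unfolding q'x[symmetric] p_def on_plane_diff by simp
      have "C * norm (x - p) < \<rho>" using x C by (simp add: dist_norm norm_minus_commute field_simps)
      then have "q' \<in> ball q \<rho>" using x'n qq by (simp add: dist_norm norm_minus_commute)
      then have "\<bar>H x'\<bar> \<le> \<epsilon> / (2 * C) * norm (x' - p)" using \<rho>(2) q'x qq by metis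
      also have "\<dots> \<le> \<epsilon> / (2 * C) * (C * norm (x - p))" using x'n \<epsilon> C by (intro mult_left_mono) auto
      also have "\<dots> = \<epsilon> / 2 * norm (x - p)" using C by simp
      finally have Hx': "\<bar>H x'\<bar> \<le> \<epsilon> / 2 * norm (x - p)" .
      have "x = x' + t *\<^sub>R e" by (simp add: x'_def)
      then have Hx: "H x = H x' - t" using sh by metis
      have xn: "(x - p) \<bullet> n = - (a * t)"
      proof -
        have "(x - p) \<bullet> n = - sgn (e $ 3) * x $ 3" using p3 by (simp add: n_def inner_axis)
        also have "x $ 3 = e $ 3 * t" using e3 by (simp add: t_def)
        also have "- sgn (e $ 3) * (e $ 3 * t) = - (a * t)" unfolding a_def abs_sgn[of "e $ 3"] by (simp only: mult_minus_left mult_ac)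
        finally show ?thesis .
      qed
      have half: "\<epsilon> / 2 * norm (x - p) \<le> \<epsilon> * norm (x - p)" using \<epsilon> by (intro mult_right_mono) auto
      show "(x - p) \<bullet> n < - \<epsilon> * norm (x - p) \<longrightarrow> x \<in> \<Omega>"
      proof
        assume "(x - p) \<bullet> n < - \<epsilon> * norm (x - p)"
        then have at: "a * t > \<epsilon> * norm (x - p)" unfolding xn by simp
        moreover have "\<epsilon> * norm (x - p) \<ge> 0" using \<epsilon> by simp
        ultimately have "a * t > 0" by linarith
        then have "t > 0" using a(1) by (rule zero_less_mult_pos)
        then have "a * t \<le> t" using a by (simp add: mult_left_le_one_le)
        then have "H x < 0" using Hx Hx' at half by linarith
        then show "x \<in> \<Omega>" using \<Omega>[OF xb] by simp
      qed
      show "\<epsilon> * norm (x - p) < (x - p) \<bullet> n \<longrightarrow> x \<notin> \<Omega>"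
      proof
        assume "\<epsilon> * norm (x - p) < (x - p) \<bullet> n"
        then have at: "a * (- t) > \<epsilon> * norm (x - p)" unfolding xn by simp
        moreover have "\<epsilon> * norm (x - p) \<ge> 0" using \<epsilon> by simp
        ultimately have "a * (- t) > 0" by linarith
        then have "- t > 0" using a(1) by (rule zero_less_mult_pos)
        then have "a * (- t) \<le> - t" using a by (intro mult_left_le_one_le) auto
        then have "H x > 0" using Hx Hx' at half by linarith
        then show "x \<notin> \<Omega>" using \<Omega>[OF xb] by simp
      qed
    qed
  qed
  then show "outward_normal \<Omega> (on_plane q) (- sgn (e $ 3) *\<^sub>R axis 3 1)" by (simp add: p_def n_def)
qed

text \<open>A countable combination of open conditions, hence Borel measurable, in contrast to the
  \<open>THE\<close> in \<open>unit_normal\<close>. The probes descend from the plane: the value 1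
  stands for a domain below it, with the normal pointing up.\<close>

definition flat_sign :: "(real^3) set \<Rightarrow> real^2 \<Rightarrow> real" where
  "flat_sign \<Omega> q = (if \<exists>N. \<forall>k\<ge>N. on_plane q - (1 / real (Suc k)) *\<^sub>R axis 3 1 \<in> \<Omega> then 1 else -1)"

lemma flat_sign_measurable: "open \<Omega> \<Longrightarrow> flat_sign \<Omega> \<in> borel_measurable borel"
proof -
  assume op: "open \<Omega>"
  have "{q. on_plane q - (1 / real (Suc k)) *\<^sub>R axis 3 1 \<in> \<Omega>} \<in> sets borel" for k
  proof -
    have "continuous_on UNIV (\<lambda>q. on_plane q - (1 / real (Suc k)) *\<^sub>R axis 3 1)"
      by (intro continuous_intros continuous_on_plane)
    from open_vimage[OF op this] show ?thesis unfolding vimage_def by (rule borel_open)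
  qed
  then have [measurable]: "Measurable.pred borel (\<lambda>q. on_plane q - (1 / real (Suc k)) *\<^sub>R axis 3 1 \<in> \<Omega>)" for k
    by (simp add: pred_def)
  show ?thesis unfolding flat_sign_def[abs_def] by measurable
qed

text \<open>The probes lie on the normal line itself, so even the aperture 1/2 decides on which side
  of the boundary the late ones are.\<close>

lemma flat_sign_eq:
  assumes n: "outward_normal \<Omega> (on_plane q) (\<sigma> *\<^sub>R axis 3 1)" and \<sigma>: "\<sigma> = 1 \<or> \<sigma> = -1"
  shows "flat_sign \<Omega> q = \<sigma>"
proof -
  obtain r where r: "r > 0" and rn: "\<And>x. x \<in> ball (on_plane q) r \<Longrightarrow>
        ((x - on_plane q) \<bullet> (\<sigma> *\<^sub>R axis 3 1) < - (1/2) * norm (x - on_plane q) \<longrightarrow> x \<in> \<Omega>) \<and>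
        ((x - on_plane q) \<bullet> (\<sigma> *\<^sub>R axis 3 1) > 1/2 * norm (x - on_plane q) \<longrightarrow> x \<notin> \<Omega>)"
    using n[unfolded outward_normal_def] by (metis half_gt_zero_iff zero_less_one)
  obtain N where N: "1 / real (Suc N) < r" using nat_approx_posE[OF r] by auto
  define x where "x k = on_plane q - (1 / real (Suc k)) *\<^sub>R axis 3 1" for k
  have x: "x k \<in> \<Omega> \<longleftrightarrow> \<sigma> = 1" if "k \<ge> N" for k
  proof -
    have "1 / real (Suc k) \<le> 1 / real (Suc N)" using that by (simp add: frac_le)
    then have "x k \<in> ball (on_plane q) r" using N by (simp add: x_def dist_norm)
    note rn = rn[OF this]
    define c where "c = 1 / real (Suc k)"
    have "c > 0" by (simp add: c_def)
    have "(x k - on_plane q) \<bullet> (\<sigma> *\<^sub>R axis 3 1) = - \<sigma> * c" "norm (x k - on_plane q) = c"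
      by (simp_all add: x_def inner_axis_axis c_def)
    then show ?thesis using rn \<sigma> \<open>c > 0\<close> by auto
  qed
  show ?thesis
  proof (cases "\<sigma> = 1")
    case True
    then show ?thesis unfolding flat_sign_def x_def[symmetric] using x by auto
  next
    case False
    then have "\<not> (\<exists>N. \<forall>k\<ge>N. x k \<in> \<Omega>)" using x by (metis nle_le)
    then show ?thesis unfolding flat_sign_def x_def[symmetric] using False \<sigma> by simp
  qed
qed

lemma flat_normal_AE:
  assumes dom: "bounded_lipschitz_domain \<Omega>"
  shows "\<exists>N. negligible N \<and> (\<forall>q\<in>flat_coords \<Omega> - N. unit_normal \<Omega> (on_plane q) = flat_sign \<Omega> q *\<^sub>R axis 3 1)"
proof -
  have op: "open \<Omega>" and bd: "bounded \<Omega>" and lip: "lipschitz_boundary \<Omega>"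
    using dom by (auto simp: bounded_lipschitz_domain_def)
  obtain N where N: "negligible N" "\<And>q. q \<in> flat_coords \<Omega> - N \<Longrightarrow> thick (flat_coords \<Omega>) q"
    using thick_AE[OF compact_flat_coords[OF bd]] by blast
  have "unit_normal \<Omega> (on_plane q) = flat_sign \<Omega> q *\<^sub>R axis 3 1" if q: "q \<in> flat_coords \<Omega> - N" for q
  proof -
    have "on_plane q \<in> frontier \<Omega>" using q by (simp add: flat_part_def)
    then obtain e H K r where c: "lip_chart \<Omega> (on_plane q) e H K r" using lip_chart_exists[OF lip] by blast
    have "on_plane q \<in> ball (on_plane q) r" using c by (simp add: lip_chart_def)
    from outward_normal_thick[OF op c this _ N(2)[OF q]] q
    have "e $ 3 \<noteq> 0" "outward_normal \<Omega> (on_plane q) ((- sgn (e $ 3)) *\<^sub>R axis 3 1)" by auto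
    moreover from this have "flat_sign \<Omega> q = - sgn (e $ 3)" by (intro flat_sign_eq) (auto simp: sgn_if)
    ultimately show ?thesis using unit_normal_eq by simp
  qed
  with N(1) show ?thesis by blast
qed

text \<open>Near a relative interior point one chart serves a whole disc: sliding a nearby point
  along \<open>e\<close> by the amount \<open>H\<close> reaches the boundary, hence the plane, so
  the axis is transversal and the disc lies in the boundary. Thickness is then trivial, and the same
  \<open>e\<close> determines the normal at all points of the disc.\<close>

lemma flat_interior:
  assumes dom: "bounded_lipschitz_domain \<Omega>" and p: "p \<in> top_of_set (frontier \<Omega>) interior_of flat_part \<Omega>"
  obtains q0 \<rho> n where "p = on_plane q0" "\<rho> > 0" "\<And>q. q \<in> ball q0 \<rho> \<Longrightarrow> q \<in> flat_coords \<Omega>"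
    "\<And>q. q \<in> ball q0 \<rho> \<Longrightarrow> unit_normal \<Omega> (on_plane q) = n"
proof -
  have op: "open \<Omega>" and bd: "bounded \<Omega>" and lip: "lipschitz_boundary \<Omega>"
    using dom by (auto simp: bounded_lipschitz_domain_def)
  obtain U where U: "open U" "p \<in> U" "frontier \<Omega> \<inter> U \<subseteq> flat_part \<Omega>" and pf: "p \<in> frontier \<Omega>"
    using p by (auto simp: interior_of_def openin_open)
  have p3: "p $ 3 = 0" using U pf by (auto simp: flat_part_def)
  obtain e H K r where c: "lip_chart \<Omega> p e H K r" using lip_chart_exists[OF lip pf] .
  have K: "K > 0" "\<And>x y. \<bar>H x - H y\<bar> \<le> K * norm (x - y)" and e: "norm e = 1" and r: "r > 0"
    and sh: "\<And>x t. H (x + t *\<^sub>R e) = H x - t"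
    using c by (auto simp: lip_chart_def)
  obtain d where d: "d > 0" "ball p d \<subseteq> U" using U open_contains_ball by blast
  \<comment> \<open>Sliding takes a point at distance \<open>d\<close> from \<open>p\<close> to
    distance at most \<open>(1 + K) * d\<close>, which must stay inside the chart and inside
    \<open>U\<close>.\<close>
  define \<rho> where "\<rho> = min d r / (1 + K)"
  have \<rho>: "\<rho> > 0" "(1 + K) * \<rho> = min d r" using d r K by (auto simp: \<rho>_def)
  have Hp: "H p = 0" using lip_chart_frontier[OF c op, of p] r pf by simp
  have key: "(x + H x *\<^sub>R e) $ 3 = 0" if x: "x \<in> ball p \<rho>" for x
  proof -
    define y where "y = x + H x *\<^sub>R e"
    have "\<bar>H x\<bar> \<le> K * norm (x - p)" using K(2)[of x p] Hp by simp
    moreover have "norm (y - p) \<le> norm (x - p) + \<bar>H x\<bar>"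
      using norm_triangle_ineq[of "x - p" "H x *\<^sub>R e"] e by (simp add: y_def algebra_simps)
    ultimately have "norm (y - p) \<le> (1 + K) * norm (x - p)" by (simp add: algebra_simps)
    also have "\<dots> < (1 + K) * \<rho>" using x K by (intro mult_strict_left_mono) (auto simp: dist_norm norm_minus_commute)
    finally have y: "y \<in> ball p d" "y \<in> ball p r" unfolding \<rho>(2) by (auto simp: dist_norm norm_minus_commute)
    have "H y = 0" unfolding y_def sh by simp
    then have "y \<in> frontier \<Omega>" using lip_chart_frontier[OF c op y(2)] by simp
    then have "y \<in> flat_part \<Omega>" using U y d by blast
    then show ?thesis by (simp add: y_def flat_part_def)
  qed
  \<comment> \<open>With a horizontal axis sliding would preserve the height, but a point above
    \<open>p\<close> has to reach the plane.\<close>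
  have e3: "e $ 3 \<noteq> 0"
  proof
    assume "e $ 3 = 0"
    moreover have "p + (\<rho> / 2) *\<^sub>R axis 3 1 \<in> ball p \<rho>" using \<rho> by (simp add: dist_norm)
    ultimately show False using key[of "p + (\<rho> / 2) *\<^sub>R axis 3 1"] p3 \<rho> by (simp add: axis_def)
  qed
  define q0 where "q0 = plane_coord p"
  have pq: "p = on_plane q0" unfolding q0_def using on_plane_coord[OF p3] by simp
  have \<rho>r: "\<rho> \<le> r" using \<rho> K d r mult_right_mono[of 1 "1 + K" \<rho>] by (simp add: min_def split: if_splits)
  have fl: "q \<in> flat_coords \<Omega>" if q: "q \<in> ball q0 \<rho>" for q
  proof -
    have xb: "on_plane q \<in> ball p \<rho>" using q by (simp add: pq)
    from key[OF this] have "H (on_plane q) = 0" using e3 by simp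
    moreover have "on_plane q \<in> ball p r" using xb \<rho>r by auto
    ultimately have "on_plane q \<in> frontier \<Omega>" using lip_chart_frontier[OF c op] by blast
    then show ?thesis by (simp add: flat_part_def)
  qed
  have nrm: "unit_normal \<Omega> (on_plane q) = - sgn (e $ 3) *\<^sub>R axis 3 1" if q: "q \<in> ball q0 \<rho>" for q
  proof (rule unit_normal_eq, rule outward_normal_thick(2)[OF op c])
    show "on_plane q \<in> ball p r" using q \<rho>r by (auto simp: pq)
    show "q \<in> flat_coords \<Omega>" by (rule fl[OF q])
    obtain d' where d': "d' > 0" "ball q d' \<subseteq> ball q0 \<rho>" using q open_ball open_contains_ball by metis
    show "thick (flat_coords \<Omega>) q"
      unfolding thick_in_def
    proof (intro allI impI exI[of _ d'] conjI ballI)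
      fix \<epsilon> :: real and q' assume "\<epsilon> > 0" "q' \<in> ball q d'"
      then show "\<exists>q''\<in>flat_coords \<Omega>. norm (q' - q'') \<le> \<epsilon> * norm (q' - q)"
        using fl d' by (intro bexI[of _ q']) auto
    qed (rule d')
  qed
  show ?thesis by (rule that[OF pq \<rho>(1) fl nrm])
qed

text \<open>Continuity of \<open>X\<close> makes the limit in \<open>normal_derivative\<close>
  exist; the formula holds also at points where \<open>unit_normal\<close> is an unspecified
  vector.\<close>

lemma normal_derivative_eq:
  assumes op: "open \<Omega>" and X: "continuous_on (closure \<Omega>) X" "\<And>x. x \<in> \<Omega> \<Longrightarrow> X x = grad f x" and p: "p \<in> frontier \<Omega>"
  shows "normal_derivative \<Omega> f p = X p \<bullet> unit_normal \<Omega> p"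
  unfolding normal_derivative_def
proof (rule tendsto_Lim)
  have pc: "p \<in> closure \<Omega>" "p \<notin> \<Omega>" using p op by (auto simp: frontier_def interior_open)
  then show "\<not> trivial_limit (at p within \<Omega>)"
    by (simp add: trivial_limit_within) (metis closure_def UnE mem_Collect_eq)
  have "(X \<longlongrightarrow> X p) (at p within closure \<Omega>)" using X(1) pc by (simp add: continuous_on)
  then have "(X \<longlongrightarrow> X p) (at p within \<Omega>)" by (rule tendsto_within_subset) (rule closure_subset)
  then have "((\<lambda>x. X x \<bullet> unit_normal \<Omega> p) \<longlongrightarrow> X p \<bullet> unit_normal \<Omega> p) (at p within \<Omega>)" by (intro tendsto_intros)
  then show "((\<lambda>x. grad f x \<bullet> unit_normal \<Omega> p) \<longlongrightarrow> X p \<bullet> unit_normal \<Omega> p) (at p within \<Omega>)"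
    by (rule Lim_transform_eventually) (auto simp: eventually_at_topological X(2) intro!: exI[of _ UNIV])
qed

section \<open>The Euler-Lagrange equation of the Rayleighian\<close>

text \<open>Written with products instead of a power, to match the closure of
  \<open>Ck_up_to_boundary\<close> under multiplication.\<close>

lemma deriv_F: "deriv F s = s * (s * s) - s"
  unfolding F_def[abs_def]
  by (rule DERIV_imp_deriv) (auto intro!: derivative_eq_intros simp: power2_eq_square algebra_simps)

lemma deriv_f_w: "deriv f_w s = (3 * s\<^sup>2 - 3) / 4"
  unfolding f_w_def[abs_def]
  by (rule DERIV_imp_deriv) (auto intro!: derivative_eq_intros simp: power2_eq_square field_simps)

lemma linear_coeff_zero:
  fixes a b :: real
  assumes "\<And>t. 0 \<le> t * a + t\<^sup>2 * b"
  shows "a = 0"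
proof (rule ccontr)
  assume a: "a \<noteq> 0"
  \<comment> \<open>Bounds the expression by
    \<open>- (a\<^sup>2 / (\<bar>b\<bar> + 1)\<^sup>2)\<close>, whatever the sign of
    \<open>b\<close>.\<close>
  define t where "t = - a / (\<bar>b\<bar> + 1)"
  have "t * a + t\<^sup>2 * b \<le> t * a + t\<^sup>2 * \<bar>b\<bar>" by (intro add_left_mono mult_left_mono) auto
  also have "\<dots> = - (a\<^sup>2 / (\<bar>b\<bar> + 1)\<^sup>2)"
    by (simp add: t_def divide_simps power2_eq_square add_pos_nonneg) (simp add: algebra_simps)
  also have "\<dots> < 0" using a by (simp add: add_nonneg_pos)
  finally show False using assms[of t] by simp
qed

lemma AE_zero_continuous:
  fixes g :: "'a::euclidean_space \<Rightarrow> real"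
  assumes S: "open S" and g: "continuous_on S g" and z: "AE x in lebesgue. x \<in> S \<longrightarrow> g x = 0" and x: "x \<in> S"
  shows "g x = 0"
proof (rule ccontr)
  assume "g x \<noteq> 0"
  define A where "A = S \<inter> g -` (- {0})"
  have "open A" unfolding A_def by (rule continuous_open_preimage[OF g S]) (simp add: open_Compl)
  moreover have "A \<noteq> {}" using x \<open>g x \<noteq> 0\<close> by (auto simp: A_def)
  moreover have "AE x in lebesgue. x \<notin> A" using z by eventually_elim (auto simp: A_def)
  then have "negligible A"
    using \<open>open A\<close> unfolding negligible_iff_null_sets by (subst (asm) AE_iff_null_sets[symmetric]) (auto simp: borel_open)
  ultimately show False using open_not_negligible by blast
qed

section \<open>First variation in the domain and on its flat portion\<close>

context
  fixes \<Omega> :: "(real^3) set"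
  assumes dom: "bounded_lipschitz_domain \<Omega>"
begin

abbreviation (input) "\<Gamma> \<equiv> flat_coords \<Omega>"

lemma flat_sets: "\<Gamma> \<in> sets lebesgue" and flat_finite_measure: "finite_measure (lebesgue_on \<Gamma>)"
proof -
  have 1: "\<Gamma> \<in> lmeasurable" by (rule lmeasurable_compact[OF compact_flat_coords[OF domain_bounded[OF dom]]])
  then show "\<Gamma> \<in> sets lebesgue" by blast
  show "finite_measure (lebesgue_on \<Gamma>)" by (rule finite_measure_lebesgue_on[OF 1])
qed

lemma flat_integral: "flat_part_integral \<Omega> g = (LINT q|lebesgue_on \<Gamma>. g (on_plane q))"
  unfolding flat_part_integral_def set_lebesgue_integral_def using flat_sets by (simp add: integral_restrict_space)

lemma on_plane_closure: "q \<in> \<Gamma> \<Longrightarrow> on_plane q \<in> closure \<Omega>"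
  by (simp add: flat_part_def frontier_def)

lemma continuous_flat:
  "continuous_on (closure \<Omega>) u \<Longrightarrow> continuous_on \<Gamma> (\<lambda>q. u (on_plane q))"
  by (rule continuous_on_compose2[OF _ continuous_on_plane]) (use on_plane_closure in auto)

lemma L2_flat:
  fixes u :: "real^3 \<Rightarrow> real"
  assumes u: "continuous_on (closure \<Omega>) u"
  shows "L2 (lebesgue_on \<Gamma>) (\<lambda>q. u (on_plane q))"
proof -
  obtain B where B: "\<And>x. x \<in> closure \<Omega> \<Longrightarrow> norm (u x) \<le> B"
    using extends_to_closure_bounded[OF domain_bounded[OF dom] u] by blast
  show ?thesis
    by (rule L2_bounded[OF flat_finite_measure, of _ B])
      (use continuous_imp_measurable_on_sets_lebesgue[OF continuous_flat[OF u] flat_sets] B on_plane_closure in \<open>auto intro!: AE_I2\<close>)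
qed

text \<open>Measurability is the point: almost everywhere the normal derivative equals
  \<open>flat_sign\<close> times a continuous function, and completeness of Lebesgue measure
  transfers measurability along this equality.\<close>

lemma L2_normal_derivative:
  assumes f: "Ck_up_to_boundary (Suc 0) \<Omega> f"
  shows "L2 (lebesgue_on \<Gamma>) (\<lambda>q. normal_derivative \<Omega> f (on_plane q))"
proof -
  obtain X where X: "continuous_on (closure \<Omega>) X" "\<And>x. x \<in> \<Omega> \<Longrightarrow> X x = grad f x"
    using Ck_1_D(5)[OF domain_open[OF dom] f] by blast
  obtain B where B: "\<And>x. x \<in> closure \<Omega> \<Longrightarrow> norm (X x) \<le> B"
    using extends_to_closure_bounded[OF domain_bounded[OF dom] X(1)] by blast
  obtain N where N: "negligible N" "\<And>q. q \<in> \<Gamma> - N \<Longrightarrow> unit_normal \<Omega> (on_plane q) = flat_sign \<Omega> q *\<^sub>R axis 3 1"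
    using flat_normal_AE[OF dom] by blast
  have nd: "normal_derivative \<Omega> f (on_plane q) = flat_sign \<Omega> q * X (on_plane q) $ 3" if q: "q \<in> \<Gamma> - N" for q
    using normal_derivative_eq[OF domain_open[OF dom] X, of "on_plane q"] N(2)[OF q] q by (simp add: flat_part_def inner_axis)
  have AEN: "AE q in lebesgue. q \<notin> N" using N(1) by (intro AE_not_in) (simp add: negligible_iff_null_sets)
  define g where "g q = indicator \<Gamma> q * (flat_sign \<Omega> q * X (on_plane q) $ 3)" for q
  have "continuous_on \<Gamma> (\<lambda>q. X (on_plane q) $ 3)"
    by (rule continuous_flat) (intro continuous_intros X)
  then have "(\<lambda>q. X (on_plane q) $ 3) \<in> borel_measurable (lebesgue_on \<Gamma>)"
    using flat_sets by (rule continuous_imp_measurable_on_sets_lebesgue)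
  then have [measurable]: "(\<lambda>q. indicator \<Gamma> q *\<^sub>R X (on_plane q) $ 3) \<in> borel_measurable lebesgue"
    using flat_sets by (simp add: borel_measurable_restrict_space_iff)
  have [measurable]: "flat_sign \<Omega> \<in> borel_measurable lebesgue"
    using flat_sign_measurable[OF domain_open[OF dom]] by (simp add: measurable_completion)
  have geq: "g = (\<lambda>q. flat_sign \<Omega> q * (indicator \<Gamma> q *\<^sub>R X (on_plane q) $ 3))" by (simp add: g_def fun_eq_iff)
  have gme: "g \<in> borel_measurable lebesgue" unfolding geq by measurable
  have "AE q in lebesgue. g q = indicator \<Gamma> q *\<^sub>R normal_derivative \<Omega> f (on_plane q)"
    using AEN by eventually_elim (use nd in \<open>auto simp: g_def indicator_def\<close>)
  then have "(\<lambda>q. indicator \<Gamma> q *\<^sub>R normal_derivative \<Omega> f (on_plane q)) \<in> borel_measurable lebesgue"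
    by (rule borel_measurable_AE[OF gme])
  then have "(\<lambda>q. normal_derivative \<Omega> f (on_plane q)) \<in> borel_measurable (lebesgue_on \<Gamma>)"
    using flat_sets by (simp add: borel_measurable_restrict_space_iff)
  moreover have "AE q in lebesgue_on \<Gamma>. norm (normal_derivative \<Omega> f (on_plane q)) \<le> B"
  proof -
    have "AE q in lebesgue. q \<in> \<Gamma> \<longrightarrow> norm (normal_derivative \<Omega> f (on_plane q)) \<le> B"
      using AEN
    proof eventually_elim
      case (elim q)
      show ?case
      proof
        assume q: "q \<in> \<Gamma>"
        have "\<bar>X (on_plane q) $ 3\<bar> \<le> B"
          using component_le_norm_cart[of "X (on_plane q)" 3] B[OF on_plane_closure[OF q]] by linarith
        then show "norm (normal_derivative \<Omega> f (on_plane q)) \<le> B"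
          using nd[of q] elim q by (auto simp: flat_sign_def abs_mult)
      qed
    qed
    then show ?thesis using flat_sets by (simp add: AE_restrict_space_iff)
  qed
  ultimately show ?thesis by (intro L2_bounded[OF flat_finite_measure])
qed

text \<open>Volume and boundary are separated by the weight \<open>\<omega>\<close>, the distance to
  the complement, which is positive in \<Omega> and 0 on the flat portion. It is merely continuous,
  so the identity is first extended from polynomials to continuous functions.\<close>

lemma polynomial_orthogonal_pair:
  assumes k: "L2 (lebesgue_on \<Omega>) k" and B: "L2 (lebesgue_on \<Gamma>) B"
    and z: "\<And>P. real_polynomial_function P \<Longrightarrow>
      (LINT x|lebesgue_on \<Omega>. k x * P x) + (LINT q|lebesgue_on \<Gamma>. B q * P (on_plane q)) = 0"
  shows "AE x in lebesgue_on \<Omega>. k x = 0" "AE q in lebesgue_on \<Gamma>. B q = 0"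
proof -
  let ?M = "lebesgue_on \<Omega>" and ?G = "lebesgue_on \<Gamma>"
  have co: "compact (closure \<Omega>)" using domain_bounded[OF dom] by simp
  have ki: "integrable ?M k" by (rule L2_imp_integrable[OF domain_finite_measure[OF dom] k])
  have Bi: "integrable ?G B" by (rule L2_imp_integrable[OF flat_finite_measure B])
  have cont: "(LINT x|?M. k x * c x) + (LINT q|?G. B q * c (on_plane q)) = 0"
    if c: "continuous_on (closure \<Omega>) c" for c
  proof (rule ccontr)
    define d where "d = (LINT x|?M. k x * c x) + (LINT q|?G. B q * c (on_plane q))"
    assume "\<not> ?thesis"
    then have d: "\<bar>d\<bar> > 0" by (simp add: d_def)
    define I where "I = (LINT x|?M. \<bar>k x\<bar>) + (LINT q|?G. \<bar>B q\<bar>)"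
    have I0: "I \<ge> 0" by (simp add: I_def)
    define e where "e = \<bar>d\<bar> / (2 * (I + 1))"
    have e: "e > 0" using d I0 by (simp add: e_def)
    obtain Bc where Bc: "\<And>x. x \<in> closure \<Omega> \<Longrightarrow> norm (c x) \<le> Bc"
      using extends_to_closure_bounded[OF domain_bounded[OF dom] c] by blast
    obtain P where P: "real_polynomial_function P" "\<And>x. x \<in> closure \<Omega> \<Longrightarrow> \<bar>c x - P x\<bar> < e"
      using Stone_Weierstrass_real_polynomial_function[OF co c e] by blast
    have cP: "continuous_on (closure \<Omega>) P" by (rule continuous_on_real_polynomial[OF P(1)])
    have "\<bar>(LINT x|?M. k x * c x) - (LINT x|?M. k x * P x)\<bar> \<le> e * (LINT x|?M. \<bar>k x\<bar>)"
    proof (rule LINT_uniform_approx(3)[OF ki, of c P Bc e])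
      show "c \<in> borel_measurable ?M" "P \<in> borel_measurable ?M"
        using continuous_on_subset[OF c closure_subset] continuous_on_subset[OF cP closure_subset] domain_sets[OF dom]
        by (auto intro: continuous_imp_measurable_on_sets_lebesgue)
      fix x assume "x \<in> space ?M"
      then have "x \<in> closure \<Omega>" using closure_subset by auto
      then show "\<bar>c x\<bar> \<le> Bc" "\<bar>c x - P x\<bar> \<le> e" using Bc[of x] P(2)[of x] by auto
    qed
    moreover have "\<bar>(LINT q|?G. B q * c (on_plane q)) - (LINT q|?G. B q * P (on_plane q))\<bar> \<le> e * (LINT q|?G. \<bar>B q\<bar>)"
    proof (rule LINT_uniform_approx(3)[OF Bi, of "\<lambda>q. c (on_plane q)" "\<lambda>q. P (on_plane q)" Bc e])
      show "(\<lambda>q. c (on_plane q)) \<in> borel_measurable ?G" "(\<lambda>q. P (on_plane q)) \<in> borel_measurable ?G"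
        using L2_flat[OF c] L2_flat[OF cP] by (auto simp: L2_def)
      fix q assume "q \<in> space ?G"
      then have "on_plane q \<in> closure \<Omega>" using on_plane_closure by simp
      then show "\<bar>c (on_plane q)\<bar> \<le> Bc" "\<bar>c (on_plane q) - P (on_plane q)\<bar> \<le> e" using Bc[of "on_plane q"] P(2)[of "on_plane q"] by auto
    qed
    ultimately have "\<bar>d\<bar> \<le> e * (LINT x|?M. \<bar>k x\<bar>) + e * (LINT q|?G. \<bar>B q\<bar>)"
      using z[OF P(1)] unfolding d_def by linarith
    also have "\<dots> = e * I" by (simp add: I_def distrib_left)
    also have "\<dots> \<le> e * (I + 1)" using e by simp
    also have "\<dots> = \<bar>d\<bar> / 2" using I0 by (simp add: e_def field_simps)
    finally show False using d by linarith
  qed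
  define \<omega> where "\<omega> x = infdist x (- \<Omega>)" for x
  have c\<omega>: "continuous_on S \<omega>" for S unfolding \<omega>_def by (intro continuous_intros)
  have ne: "- \<Omega> \<noteq> {}" using domain_bounded[OF dom] not_bounded_UNIV by (metis double_compl Compl_empty_eq)
  have \<omega>0: "\<omega> x = 0" if "x \<notin> \<Omega>" for x using that by (simp add: \<omega>_def)
  have \<omega>p: "\<omega> x > 0" if "x \<in> \<Omega>" for x
    unfolding \<omega>_def using that ne domain_open[OF dom] by (intro infdist_pos_not_in_closed) auto
  have \<omega>\<Gamma>: "\<omega> (on_plane q) = 0" if "q \<in> \<Gamma>" for q
    using that domain_open[OF dom] by (intro \<omega>0) (simp add: flat_part_def frontier_def interior_open)
  have "AE x in ?M. k x * \<omega> x = 0"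
  proof (rule orthogonal_polynomials_imp_zero[OF domain_sets[OF dom] domain_bounded[OF dom]])
    show "integrable ?M (\<lambda>x. k x * \<omega> x)" by (intro L2_mult k L2_continuous_UNIV[OF dom] c\<omega>)
    fix P :: "real^3 \<Rightarrow> real" assume P: "real_polynomial_function P"
    have "(LINT x|?M. k x * (\<omega> x * P x)) + (LINT q|?G. B q * (\<omega> (on_plane q) * P (on_plane q))) = 0"
      by (rule cont) (intro continuous_intros c\<omega> continuous_on_real_polynomial P)
    moreover have "(LINT q|?G. B q * (\<omega> (on_plane q) * P (on_plane q))) = (LINT q|?G. 0)"
      by (intro Bochner_Integration.integral_cong) (auto simp: \<omega>\<Gamma>)
    ultimately show "(LINT x|?M. k x * \<omega> x * P x) = 0" by (simp add: mult.assoc)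
  qed
  moreover have "AE x in ?M. x \<in> \<Omega>" by (rule AE_I2) simp
  ultimately show k0: "AE x in ?M. k x = 0"
    by eventually_elim (use \<omega>p in force)
  have kP: "(LINT x|?M. k x * P x) = 0" for P
  proof -
    have "AE x in ?M. k x * P x = 0" using k0 by eventually_elim simp
    then show ?thesis by (rule integral_eq_zero_AE)
  qed
  show "AE q in ?G. B q = 0"
  proof (rule orthogonal_polynomials_imp_zero[OF flat_sets compact_imp_bounded[OF compact_flat_coords[OF domain_bounded[OF dom]]] Bi])
    fix P :: "real^2 \<Rightarrow> real" assume P: "real_polynomial_function P"
    \<comment> \<open>A polynomial in the plane, read as one in space that ignores the third
      coordinate, is again a test function.\<close>
    have "polynomial_function plane_coord"
      using linear_plane_coord by (intro polynomial_function_bounded_linear) (simp add: linear_conv_bounded_linear)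
    then have "real_polynomial_function (P \<circ> plane_coord)" using P by (rule real_polynomial_function_compose)
    from z[OF this] kP show "(LINT q|?G. B q * P q) = 0" by simp
  qed
qed

text \<open>The rate \<open>u0\<close> is detached from \<open>f\<close>: at a fixed time the
  evolution enters only through the minimality of its rate.\<close>

lemma cahn_hilliard_at_time:
  fixes \<sigma>LG \<sigma>SG \<sigma>SL \<delta> \<xi> \<zeta> :: real
  assumes pos: "\<sigma>LG > 0" "\<delta> > 0" "\<xi> > 0" "\<zeta> > 0"
    and f: "C_closure 4 \<Omega> f" and u0: "C_closure m \<Omega> u0" and mean: "mean_zero \<Omega> u0"
    and min: "is_arg_min (rayleighian \<Omega> \<sigma>LG \<sigma>SG \<sigma>SL \<delta> \<xi> \<zeta> f) (\<lambda>u. C_closure m \<Omega> u \<and> mean_zero \<Omega> u) u0"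
  shows "\<And>x. x \<in> \<Omega> \<Longrightarrow> \<xi> * u0 x = laplacian (chemical_potential \<sigma>LG \<delta> f) x"
    and "holds_on_flat_part \<Omega> (\<lambda>p. \<zeta> * \<delta> * u0 p = - \<sigma>LG * \<delta> * normal_derivative \<Omega> f p
        - (\<sigma>SL - \<sigma>SG) * (4 / (3 * sqrt 2)) * deriv f_w (f p))"
    and "zero_normal_derivative_on \<Omega> (frontier \<Omega>) (chemical_potential \<sigma>LG \<delta> f)"
proof -
  let ?M = "lebesgue_on \<Omega>" and ?G = "lebesgue_on \<Gamma>"
  define \<mu> where "\<mu> = chemical_potential \<sigma>LG \<delta> f"
  define c1 where "c1 = 3 * sqrt 2 / 4"
  have c1: "c1 > 0" by (simp add: c1_def)
  note opn = domain_open[OF dom] and finM = domain_finite_measure[OF dom]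
  have cf: "continuous_on (closure \<Omega>) f" and f4: "Ck_up_to_boundary 4 \<Omega> f"
    using f by (auto simp: C_closure_def numeral_eq_enat)
  \<comment> \<open>Two of the four derivatives of \<open>f\<close> are spent on the Laplacian
    inside \<mu>; the other two give \<mu> a Laplacian that is continuous up to the
    boundary.\<close>
  have f3: "Ck_up_to_boundary 3 \<Omega> f" using f4 Ck_Suc_imp[of 3] by simp
  then have f2: "Ck_up_to_boundary 2 \<Omega> f" using Ck_Suc_imp[of 2] by simp
  then have f1: "Ck_up_to_boundary (Suc 0) \<Omega> f" using Ck_Suc_imp[of 1] by (simp add: numeral_2_eq_2)
  have fi: "Ck_up_to_boundary 3 \<Omega> (partial i f)" for i
    using f4 Ck_up_to_boundary.simps(2)[of 3 \<Omega> f] by simp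
  have fii: "Ck_up_to_boundary 2 \<Omega> (partial i (partial i f))" for i
    using fi[of i] Ck_up_to_boundary.simps(2)[of 2 \<Omega> "partial i f"] by simp
  have lap2: "Ck_up_to_boundary 2 \<Omega> (laplacian f)"
    unfolding laplacian_def[abs_def] UNIV_3 using fii by (auto intro!: Ck_add[OF opn])
  have F2: "Ck_up_to_boundary 2 \<Omega> (\<lambda>x. deriv F (f x))"
  proof -
    have "(\<lambda>x. deriv F (f x)) = (\<lambda>x. f x * (f x * f x) + (- 1) * f x)" by (simp add: deriv_F fun_eq_iff)
    then show ?thesis by (simp only:) (intro Ck_add Ck_mult Ck_const f2 opn)
  qed
  have \<mu>eq: "\<mu> = (\<lambda>x. (- \<sigma>LG * \<delta>) * laplacian f x + \<sigma>LG / \<delta> * deriv F (f x))"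
    by (simp add: \<mu>_def chemical_potential_def[abs_def])
  have \<mu>2: "Ck_up_to_boundary 2 \<Omega> \<mu>" unfolding \<mu>eq by (intro Ck_add Ck_cmul lap2 F2 opn)
  then have \<mu>1: "Ck_up_to_boundary (Suc 0) \<Omega> \<mu>" using Ck_Suc_imp[of 1] by (simp add: numeral_2_eq_2)
  define A where "A x = 1 / \<delta> * deriv F (f x) - \<delta> * laplacian f x" for x
  have A\<mu>: "\<sigma>LG * A x = \<mu> x" for x by (simp add: A_def \<mu>eq algebra_simps)
  have LF: "L2 ?M (\<lambda>x. deriv F (f x))" and Ll: "L2 ?M (laplacian f)"
    using F2 lap2 by (auto intro: L2_extends[OF dom] Ck_extends)
  have LA: "L2 ?M A" unfolding A_def[abs_def] by (intro L2_diff L2_cmul LF Ll)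
  have cu0: "continuous_on (closure \<Omega>) u0" using u0 by (simp add: C_closure_def)
  have Lu0: "L2 ?M u0" by (rule L2_continuous[OF dom cu0]) simp
  define nd where "nd q = normal_derivative \<Omega> f (on_plane q)" for q
  define fw where "fw q = deriv f_w (f (on_plane q))" for q
  have Lnd: "L2 ?G nd" unfolding nd_def by (rule L2_normal_derivative[OF f1])
  have cfw: "continuous_on (closure \<Omega>) (\<lambda>x. deriv f_w (f x))"
    unfolding deriv_f_w by (intro continuous_intros cf) auto
  have Lfw: "L2 ?G fw" unfolding fw_def by (rule L2_flat[OF cfw])
  have Lu0G: "L2 ?G (\<lambda>q. u0 (on_plane q))" by (rule L2_flat[OF cu0])
  define \<psi> where "\<psi> = inv_neumann_laplacian \<Omega> u0"
  have w\<psi>: "weak_neumann_solution \<Omega> u0 \<psi>" unfolding \<psi>_def by (rule inv_neumann_laplacian_works[OF dom cu0 mean])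
  then obtain G where G: "H1_gradient \<Omega> \<psi> G"
    "\<And>v H. H1_gradient \<Omega> v H \<Longrightarrow> (LINT x|?M. G x \<bullet> H x) = (LINT x|?M. u0 x * v x)"
    unfolding weak_neumann_iff[OF dom] by blast
  have L\<psi>: "L2 ?M \<psi>" using G(1) unfolding H1_gradient_iff[OF dom] by blast
  let ?R = "rayleighian \<Omega> \<sigma>LG \<sigma>SG \<sigma>SL \<delta> \<xi> \<zeta> f"
  have R_eq: "?R u = c1 * \<sigma>LG * (LINT x|?M. A x * u x) + c1 * \<sigma>LG * \<delta> * (LINT q|?G. nd q * u (on_plane q))
    + (\<sigma>SL - \<sigma>SG) * (LINT q|?G. fw q * u (on_plane q))
    + (c1 * (\<xi> / 2) * (LINT x|?M. u x * inv_neumann_laplacian \<Omega> u x)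
    + c1 * (\<zeta> * \<delta> / 2) * (LINT q|?G. (u (on_plane q))\<^sup>2))" for u
    by (simp only: rayleighian_def energy_rate_def dissipation_def set_LINT[OF dom] flat_integral c1_def A_def nd_def fw_def)
  \<comment> \<open>\<open>k\<close> and \<open>B\<close> are the densities of the first variation
    at \<open>u0\<close>, in \<Omega> and on the flat portion.\<close>
  define k where "k x = c1 * \<sigma>LG * A x + c1 * \<xi> * \<psi> x" for x
  define B where "B q = c1 * \<sigma>LG * \<delta> * nd q + (\<sigma>SL - \<sigma>SG) * fw q + c1 * \<zeta> * \<delta> * u0 (on_plane q)" for q
  have Lk: "L2 ?M k" unfolding k_def[abs_def] by (intro L2_add L2_cmul LA L\<psi>)
  have LB: "L2 ?G B" unfolding B_def[abs_def] by (intro L2_add L2_cmul Lnd Lfw Lu0G)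
  have var: "(LINT x|?M. k x * v x) + (LINT q|?G. B q * v (on_plane q)) = 0"
    if v: "C_closure m \<Omega> v" "mean_zero \<Omega> v" for v
  proof (rule linear_coeff_zero)
    fix t :: real
    have cv: "continuous_on (closure \<Omega>) v" using v by (simp add: C_closure_def)
    have Lv: "L2 ?M v" by (rule L2_continuous[OF dom cv]) simp
    have LvG: "L2 ?G (\<lambda>q. v (on_plane q))" by (rule L2_flat[OF cv])
    define \<eta> where "\<eta> = inv_neumann_laplacian \<Omega> v"
    have w\<eta>: "weak_neumann_solution \<Omega> v \<eta>" unfolding \<eta>_def by (rule inv_neumann_laplacian_works[OF dom cv v(2)])
    let ?u = "\<lambda>x. u0 x + t * v x"
    have cu: "continuous_on (closure \<Omega>) ?u" by (intro continuous_intros cu0 cv)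
    have mz: "mean_zero \<Omega> ?u"
      using mean v(2) L2_imp_integrable[OF finM Lu0] L2_imp_integrable[OF finM Lv]
      by (simp add: mean_zero_def set_LINT[OF dom])
    have Cu: "C_closure m \<Omega> ?u" by (intro C_closure_add C_closure_cmul opn u0 v)
    have wu: "weak_neumann_solution \<Omega> ?u (inv_neumann_laplacian \<Omega> ?u)" by (rule inv_neumann_laplacian_works[OF dom cu mz])
    note D = dissipation_expand[OF dom Lu0 w\<psi> Lv w\<eta> wu]
    have "\<not> ?R ?u < ?R u0" using min Cu mz unfolding is_arg_min_def by blast
    then have "0 \<le> ?R ?u - ?R u0" by simp
    have lin: "(LINT x|N. g x * (a x + t * b x)) = (LINT x|N. g x * a x) + t * (LINT x|N. g x * b x)"
      if "L2 N g" "L2 N a" "L2 N b" for N :: "'c measure" and g a b :: "'c \<Rightarrow> real"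
    proof -
      have "(LINT x|N. g x * (a x + t * b x)) = (LINT x|N. g x * a x + t * (g x * b x))" by (simp add: algebra_simps)
      then show ?thesis using L2_mult[OF that(1,2)] L2_mult[OF that(1,3)] by simp
    qed
    have sq: "(LINT q|?G. (u0 (on_plane q) + t * v (on_plane q))\<^sup>2) = (LINT q|?G. (u0 (on_plane q))\<^sup>2)
      + 2 * t * (LINT q|?G. u0 (on_plane q) * v (on_plane q)) + t\<^sup>2 * (LINT q|?G. (v (on_plane q))\<^sup>2)"
      using L2_expand[OF Lu0G LvG, of t] by simp
    \<comment> \<open>The energy rate is linear in the rate, so the second-order part is the
      dissipation of \<open>v\<close> alone.\<close>
    define b where "b = c1 * (\<xi> / 2) * (LINT x|?M. v x * \<eta> x) + c1 * (\<zeta> * \<delta> / 2) * (LINT q|?G. (v (on_plane q))\<^sup>2)"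
    have kv: "(LINT x|?M. k x * v x) = c1 * \<sigma>LG * (LINT x|?M. A x * v x) + c1 * \<xi> * (LINT x|?M. \<psi> x * v x)"
    proof -
      have "(LINT x|?M. k x * v x) = (LINT x|?M. c1 * \<sigma>LG * (A x * v x) + c1 * \<xi> * (\<psi> x * v x))"
        by (simp add: k_def algebra_simps)
      then show ?thesis using L2_mult[OF LA Lv] L2_mult[OF L\<psi> Lv] by simp
    qed
    have Bv: "(LINT q|?G. B q * v (on_plane q)) = c1 * \<sigma>LG * \<delta> * (LINT q|?G. nd q * v (on_plane q))
      + (\<sigma>SL - \<sigma>SG) * (LINT q|?G. fw q * v (on_plane q)) + c1 * \<zeta> * \<delta> * (LINT q|?G. u0 (on_plane q) * v (on_plane q))"
    proof -
      have "(LINT q|?G. B q * v (on_plane q)) = (LINT q|?G. c1 * \<sigma>LG * \<delta> * (nd q * v (on_plane q))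
        + (\<sigma>SL - \<sigma>SG) * (fw q * v (on_plane q)) + c1 * \<zeta> * \<delta> * (u0 (on_plane q) * v (on_plane q)))"
        by (simp add: B_def algebra_simps)
      then show ?thesis using L2_mult[OF Lnd LvG] L2_mult[OF Lfw LvG] L2_mult[OF Lu0G LvG] by simp
    qed
    have "?R ?u - ?R u0 = t * ((LINT x|?M. k x * v x) + (LINT q|?G. B q * v (on_plane q))) + t\<^sup>2 * b"
      unfolding R_eq D \<psi>_def[symmetric] lin[OF LA Lu0 Lv] lin[OF Lnd Lu0G LvG] lin[OF Lfw Lu0G LvG] sq kv Bv b_def
      by (simp add: algebra_simps)
    then show "0 \<le> t * ((LINT x|?M. k x * v x) + (LINT q|?G. B q * v (on_plane q))) + t\<^sup>2 * b"
      using \<open>0 \<le> ?R ?u - ?R u0\<close> by simp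
  qed
  define vol where "vol = measure ?M \<Omega>"
  have volp: "vol > 0" unfolding vol_def by (rule domain_measure_pos[OF dom])
  \<comment> \<open>The Lagrange multiplier of the mean-zero constraint: replacing a polynomial by
    its deviation from its mean \<open>a\<close> produces exactly this correction of
    \<open>k\<close>.\<close>
  define \<Lambda> where "\<Lambda> = ((LINT x|?M. k x) + (LINT q|?G. B q)) / vol"
  have ki: "integrable ?M k" by (rule L2_imp_integrable[OF finM Lk])
  have Bi: "integrable ?G B" by (rule L2_imp_integrable[OF flat_finite_measure LB])
  have Lk\<Lambda>: "L2 ?M (\<lambda>x. k x - \<Lambda>)" by (intro L2_diff Lk L2_const finM)
  have orth: "(LINT x|?M. (k x - \<Lambda>) * P x) + (LINT q|?G. B q * P (on_plane q)) = 0"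
    if P: "real_polynomial_function P" for P
  proof -
    define a where "a = (LINT x|?M. P x) / vol"
    have cP: "continuous_on (closure \<Omega>) P" by (rule continuous_on_real_polynomial[OF P])
    have LP: "L2 ?M P" by (rule L2_continuous[OF dom cP]) simp
    have LPG: "L2 ?G (\<lambda>q. P (on_plane q))" by (rule L2_flat[OF cP])
    have Pi: "integrable ?M P" by (rule L2_imp_integrable[OF finM LP])
    let ?v = "\<lambda>x. P x - a"
    have "real_polynomial_function ?v" using P by (intro real_polynomial_function_diff) (auto intro: real_polynomial_function.intros)
    then have 1: "C_closure m \<Omega> ?v" by (rule C_closure_polynomial[OF opn])
    have 2: "mean_zero \<Omega> ?v"
      using Pi finite_measure.integrable_const[OF finM, of a] volp
      by (simp add: mean_zero_def set_LINT[OF dom] a_def vol_def)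
    have kv: "(LINT x|?M. k x * ?v x) = (LINT x|?M. k x * P x) - a * (LINT x|?M. k x)"
      using L2_mult[OF Lk LP] ki by (simp add: right_diff_distrib)
    have Bv: "(LINT q|?G. B q * ?v (on_plane q)) = (LINT q|?G. B q * P (on_plane q)) - a * (LINT q|?G. B q)"
      using L2_mult[OF LB LPG] Bi by (simp add: right_diff_distrib)
    have k\<Lambda>: "(LINT x|?M. (k x - \<Lambda>) * P x) = (LINT x|?M. k x * P x) - \<Lambda> * (LINT x|?M. P x)"
      using L2_mult[OF Lk LP] Pi by (simp add: left_diff_distrib)
    have "\<Lambda> * (LINT x|?M. P x) = a * ((LINT x|?M. k x) + (LINT q|?G. B q))"
      by (simp add: \<Lambda>_def a_def)
    then show ?thesis using var[OF 1 2] unfolding kv Bv k\<Lambda> by (simp add: algebra_simps)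
  qed
  have zero: "AE x in ?M. k x - \<Lambda> = 0" "AE q in ?G. B q = 0"
    by (rule polynomial_orthogonal_pair[OF Lk\<Lambda> LB]; rule orth; assumption)+
  \<comment> \<open>The equation \<open>k = \<Lambda>\<close> solved for \<open>\<psi>\<close>;
    being built from \<mu>, it is a continuously differentiable representative of
    \<open>\<psi>\<close>.\<close>
  define w where "w x = (\<Lambda> / (c1 * \<xi>)) + (- 1 / \<xi>) * \<mu> x" for x
  have w1: "Ck_up_to_boundary (Suc 0) \<Omega> w"
    unfolding w_def[abs_def] by (rule Ck_add[OF opn Ck_const Ck_cmul[OF opn \<mu>1]])
  have \<psi>w: "AE x in ?M. \<psi> x = w x"
    using zero(1)
  proof eventually_elim
    case (elim x)
    have "c1 * \<mu> x + c1 * \<xi> * \<psi> x = \<Lambda>" using elim A\<mu>[of x] by (simp add: k_def mult.assoc)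
    then show ?case using c1 pos by (simp add: w_def field_simps)
  qed
  have Gw: "AE x in ?M. G x = grad w x" by (rule H1_gradient_unique[OF dom G(1) w1 \<psi>w])
  have gradw: "grad w x = (- 1 / \<xi>) *\<^sub>R grad \<mu> x" if "x \<in> \<Omega>" for x
  proof -
    have d: "\<mu> differentiable at x" using Ck_1_D(1)[OF opn \<mu>1 that] .
    then have d2: "(\<lambda>x. (- 1 / \<xi>) * \<mu> x) differentiable at x" by (intro differentiable_mult differentiable_const)
    have "grad w x = grad (\<lambda>x. \<Lambda> / (c1 * \<xi>)) x + grad (\<lambda>x. (- 1 / \<xi>) * \<mu> x) x"
      unfolding w_def[abs_def] by (rule grad_add[OF differentiable_const d2])
    also have "\<dots> = (- 1 / \<xi>) *\<^sub>R grad \<mu> x" using grad_cmul[OF d, of "- 1 / \<xi>"] by simp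
    finally show ?thesis .
  qed
  note \<mu>f = Ck1_facts[OF dom \<mu>1]
  \<comment> \<open>The Neumann equation for \<open>\<psi>\<close>, rewritten by means of
    \<open>G = - grad \<mu> / \<xi>\<close>; the boundary condition for \<mu> is contained in it
    because the polynomials do not vanish on the boundary.\<close>
  have weak: "(LINT x|?M. grad \<mu> x \<bullet> grad P x) + (LINT x|?M. (\<xi> * u0 x) * P x) = 0"
    if P: "real_polynomial_function P" for P
  proof -
    have PC: "C_closure \<infinity> \<Omega> P" by (rule C_closure_polynomial[OF opn P])
    have LgP: "L2 ?M (grad P)" and LP: "L2 ?M P" using smooth_facts[OF dom PC] by auto
    have "AE x in ?M. x \<in> \<Omega>" by (rule AE_I2) simp
    with Gw have "AE x in ?M. G x \<bullet> grad P x = (- 1 / \<xi>) * (grad \<mu> x \<bullet> grad P x)"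
      by eventually_elim (simp add: gradw)
    then have "(LINT x|?M. G x \<bullet> grad P x) = (LINT x|?M. (- 1 / \<xi>) * (grad \<mu> x \<bullet> grad P x))"
      using G(1) L2_inner[OF \<mu>f(3) LgP] LgP
      by (intro integral_cong_AE) (auto simp: H1_gradient_iff[OF dom] L2_def)
    then have "(LINT x|?M. u0 x * P x) = (- 1 / \<xi>) * (LINT x|?M. grad \<mu> x \<bullet> grad P x)"
      using G(2)[OF H1_smooth[OF dom PC]] by simp
    then show ?thesis using pos by (simp add: mult.assoc field_simps)
  qed
  have c\<xi>u: "continuous_on (closure \<Omega>) (\<lambda>x. \<xi> * u0 x)" by (intro continuous_intros cu0)
  show "\<xi> * u0 x = laplacian (chemical_potential \<sigma>LG \<delta> f) x" if "x \<in> \<Omega>" for x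
    using weak_form_interior[OF dom \<mu>2 c\<xi>u weak that] by (simp add: \<mu>_def)
  obtain X where X: "continuous_on (closure \<Omega>) X" "\<And>x. x \<in> \<Omega> \<Longrightarrow> X x = grad \<mu> x"
    using Ck_1_D(5)[OF opn \<mu>1] by blast
  show "zero_normal_derivative_on \<Omega> (frontier \<Omega>) (chemical_potential \<sigma>LG \<delta> f)"
    unfolding zero_normal_derivative_on_def
  proof (intro ballI impI)
    fix p assume p: "p \<in> frontier \<Omega>" and "\<exists>n. outward_normal \<Omega> p n"
    then obtain n where n: "outward_normal \<Omega> p n" by blast
    have "X p \<bullet> n = 0"
    proof (rule weak_form_boundary[OF dom X(1) c\<xi>u _ n])
      fix P :: "real^3 \<Rightarrow> real" assume P: "real_polynomial_function P"
      have "(LINT x|?M. X x \<bullet> grad P x) = (LINT x|?M. grad \<mu> x \<bullet> grad P x)"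
        by (intro LINT_cong[OF dom]) (simp add: X(2))
      then show "(LINT x|?M. X x \<bullet> grad P x) + (LINT x|?M. (\<xi> * u0 x) * P x) = 0" using weak[OF P] by simp
    qed
    then show "normal_derivative \<Omega> (chemical_potential \<sigma>LG \<delta> f) p = 0"
      using normal_derivative_eq[OF opn X p] unit_normal_eq[OF n] by (simp add: \<mu>_def)
  qed
  \<comment> \<open>The wall energy is the only term without the factor \<open>c1\<close>, so
    division by \<open>c1\<close> leaves the inverse factor \<open>4 / (3 * sqrt 2)\<close> with
    it.\<close>
  have B_iff: "B q = 0 \<longleftrightarrow> \<zeta> * \<delta> * u0 (on_plane q) = - \<sigma>LG * \<delta> * normal_derivative \<Omega> f (on_plane q)
        - (\<sigma>SL - \<sigma>SG) * (4 / (3 * sqrt 2)) * deriv f_w (f (on_plane q))" for q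
  proof -
    have c1i: "4 / (3 * sqrt 2) = 1 / c1" by (simp add: c1_def)
    have "B q = c1 * (\<zeta> * \<delta> * u0 (on_plane q) + \<sigma>LG * \<delta> * nd q + (\<sigma>SL - \<sigma>SG) * (1 / c1) * fw q)"
      using c1 by (simp add: B_def distrib_left mult.assoc)
    then show ?thesis unfolding c1i nd_def fw_def using c1 by auto
  qed
  have BAE: "AE q in lebesgue. q \<in> \<Gamma> \<longrightarrow> B q = 0" using zero(2) flat_sets by (simp add: AE_restrict_space_iff)
  show "holds_on_flat_part \<Omega> (\<lambda>p. \<zeta> * \<delta> * u0 p = - \<sigma>LG * \<delta> * normal_derivative \<Omega> f p
        - (\<sigma>SL - \<sigma>SG) * (4 / (3 * sqrt 2)) * deriv f_w (f p))"
    unfolding holds_on_flat_part_def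
  proof (intro conjI ballI)
    show "AE q in lebesgue. on_plane q \<in> flat_part \<Omega> \<longrightarrow> \<zeta> * \<delta> * u0 (on_plane q) = - \<sigma>LG * \<delta> * normal_derivative \<Omega> f (on_plane q)
        - (\<sigma>SL - \<sigma>SG) * (4 / (3 * sqrt 2)) * deriv f_w (f (on_plane q))"
      using BAE unfolding B_iff by simp
    fix p assume "p \<in> top_of_set (frontier \<Omega>) interior_of flat_part \<Omega>"
    note p_in = this
    obtain q0 \<rho> n where p: "p = on_plane q0" and \<rho>: "\<rho> > 0" and fl: "\<And>q. q \<in> ball q0 \<rho> \<Longrightarrow> q \<in> \<Gamma>"
      and n: "\<And>q. q \<in> ball q0 \<rho> \<Longrightarrow> unit_normal \<Omega> (on_plane q) = n"
      by (rule flat_interior[OF dom p_in]) (rule that)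
    obtain Y where Y: "continuous_on (closure \<Omega>) Y" "\<And>x. x \<in> \<Omega> \<Longrightarrow> Y x = grad f x"
      using Ck_1_D(5)[OF opn f1] by blast
    have ndY: "nd q = Y (on_plane q) \<bullet> n" if q: "q \<in> ball q0 \<rho>" for q
      using normal_derivative_eq[OF opn Y, of "on_plane q"] n[OF q] fl[OF q] by (simp add: nd_def flat_part_def)
    have sub: "ball q0 \<rho> \<subseteq> \<Gamma>" using fl by blast
    \<comment> \<open>The normal is constant on the disc, so \<open>B\<close> is continuous there,
      and vanishing almost everywhere becomes vanishing at the centre.\<close>
    have "continuous_on (ball q0 \<rho>) (\<lambda>q. Y (on_plane q) \<bullet> n)"
      by (rule continuous_on_subset[OF continuous_flat sub]) (intro continuous_intros Y)
    then have "continuous_on (ball q0 \<rho>) nd"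
      by (rule continuous_on_eq) (rule ndY[symmetric])
    moreover have "continuous_on (ball q0 \<rho>) fw" unfolding fw_def
      by (rule continuous_on_subset[OF continuous_flat[OF cfw] sub])
    moreover have "continuous_on (ball q0 \<rho>) (\<lambda>q. u0 (on_plane q))"
      by (rule continuous_on_subset[OF continuous_flat[OF cu0] sub])
    ultimately have cB: "continuous_on (ball q0 \<rho>) B" unfolding B_def by (intro continuous_intros)
    have "AE q in lebesgue. q \<in> ball q0 \<rho> \<longrightarrow> B q = 0" using BAE by eventually_elim (use fl in blast)
    then have "B q0 = 0" by (rule AE_zero_continuous[OF open_ball cB]) (use \<rho> in simp)
    then show "\<zeta> * \<delta> * u0 p = - \<sigma>LG * \<delta> * normal_derivative \<Omega> f p
        - (\<sigma>SL - \<sigma>SG) * (4 / (3 * sqrt 2)) * deriv f_w (f p)" unfolding B_iff p .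
  qed
qed

end

theorem proposition4p1:
  fixes \<Omega> :: "(real^3) set" and \<phi> :: "real \<Rightarrow> real^3 \<Rightarrow> real" and m :: enat
    and \<sigma>LG \<sigma>SG \<sigma>SL \<delta> \<xi> \<zeta> :: real
  assumes "\<sigma>LG > 0" "\<sigma>SG > 0" "\<sigma>SL > 0" "\<delta> > 0" "\<xi> > 0" "\<zeta> > 0"
    and "bounded_lipschitz_domain \<Omega>"
    and "sufficiently_smooth m \<Omega> \<phi>"
    and "\<And>t. t \<ge> 0 \<Longrightarrow> zero_normal_derivative_on \<Omega> (frontier \<Omega> - flat_part \<Omega>) (\<phi> t)"
    and "\<And>t. t \<ge> 0 \<Longrightarrow> mean_zero \<Omega> (time_derivative \<phi> t)"
    and onsager: "\<And>t. t \<ge> 0 \<Longrightarrow>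
      is_arg_min (rayleighian \<Omega> \<sigma>LG \<sigma>SG \<sigma>SL \<delta> \<xi> \<zeta> (\<phi> t))
        (\<lambda>u. C_closure m \<Omega> u \<and> mean_zero \<Omega> u) (time_derivative \<phi> t)"
  shows "\<forall>t\<ge>0.
    (\<forall>x\<in>\<Omega>. \<xi> * time_derivative \<phi> t x = laplacian (chemical_potential \<sigma>LG \<delta> (\<phi> t)) x) \<and>
    holds_on_flat_part \<Omega> (\<lambda>p.
      \<zeta> * \<delta> * time_derivative \<phi> t p =
        - \<sigma>LG * \<delta> * normal_derivative \<Omega> (\<phi> t) p
        - (\<sigma>SL - \<sigma>SG) * (4 / (3 * sqrt 2)) * deriv f_w (\<phi> t p)) \<and>
    zero_normal_derivative_on \<Omega> (frontier \<Omega> - flat_part \<Omega>) (\<phi> t) \<and>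
    zero_normal_derivative_on \<Omega> (frontier \<Omega>) (chemical_potential \<sigma>LG \<delta> (\<phi> t))"
proof (intro allI impI)
  fix t :: real assume t: "t \<ge> 0"
  have C: "C_closure 4 \<Omega> (\<phi> t)" "C_closure m \<Omega> (time_derivative \<phi> t)"
    using assms(8) t by (auto simp: sufficiently_smooth_def)
  note * = cahn_hilliard_at_time[OF assms(7,1,4,5,6) C assms(10)[OF t] onsager[OF t]]
  \<comment> \<open>The condition off the flat portion is carried over from the hypotheses; it is
    what gives the energy rate its present form.\<close>
  show "(\<forall>x\<in>\<Omega>. \<xi> * time_derivative \<phi> t x = laplacian (chemical_potential \<sigma>LG \<delta> (\<phi> t)) x) \<and>
    holds_on_flat_part \<Omega> (\<lambda>p.
      \<zeta> * \<delta> * time_derivative \<phi> t p =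
        - \<sigma>LG * \<delta> * normal_derivative \<Omega> (\<phi> t) p
        - (\<sigma>SL - \<sigma>SG) * (4 / (3 * sqrt 2)) * deriv f_w (\<phi> t p)) \<and>
    zero_normal_derivative_on \<Omega> (frontier \<Omega> - flat_part \<Omega>) (\<phi> t) \<and>
    zero_normal_derivative_on \<Omega> (frontier \<Omega>) (chemical_potential \<sigma>LG \<delta> (\<phi> t))"
    using *(1) by (intro conjI ballI *(2,3) assms(9)[OF t])
qed

end
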